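(* For all $n,k\in\mathbb{N}$ and $\varepsilon>0$, there is a learning algorithm for $(n,k)$-SIIRVs with the following properties. Let $X=\sum_{i=1}^nX_i$ be any $(n,k)$-SIIRV. The algorithm uses $k^{5k}\cdot O(\log^{k+2}(1/\varepsilon)/\varepsilon^2)$ independent samples from $X$ and runs in time $2^{O(k^{5k}\log^{k+2}(1/\varepsilon))}$. With probability at least $9/10$ it outputs a random variable $\tilde X$ with $d_{TV}(X,\tilde X)\le\varepsilon$.
   Context: An $(n,k)$-SIIRV (sum of independent integer random variables) is the law of $\sum_{i=1}^nX_i$, where the $X_i$ are independent, not necessarily identically distributed, random variables, each supported on $\{0,1,\dots,k-1\}$. $d_{TV}$ denotes total variation distance, $d_{TV}(P,Q)=\frac12\|P-Q\|_1$. Running time is measured in the word RAM model, and $O(\cdot)$ hides absolute constants.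
   Formalization: In the sample and time bounds log(1/ε) is read as max(1, log₂(1/ε)); this changes nothing for ε ≤ 1/2, and without it the claim would require learning from zero samples as ε approaches 1, which is impossible for large n. *)

theory Defs
  imports "HOL-Probability.Probability"
begin

definition siirv :: "nat \<Rightarrow> nat \<Rightarrow> nat pmf set" where
  "siirv n k = {map_pmf (\<lambda>x. \<Sum>i<n. x i) (Pi_pmf {..<n} 0 p) | p.
     \<forall>i<n. set_pmf (p i) \<subseteq> {..<k}}"

definition tv_dist :: "'a pmf \<Rightarrow> 'a pmf \<Rightarrow> real" where
  "tv_dist P Q = (1 / 2) * (\<Sum>\<^sub>\<infinity>x. \<bar>pmf P x - pmf Q x\<bar>)"

(* log (1/eps), kept away from 0: asymptotic bounds in log (1/eps) refer to small eps, and taken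
   literally they would require no samples as eps tends to 1. No effect for 0 < eps \<le> 1/2. *)
definition log_recip :: "real \<Rightarrow> real" where
  "log_recip \<epsilon> = max 1 (log 2 (1 / \<epsilon>))"


text \<open>
  A word RAM with word size w: memory cells hold integers below 2 ^ w and are addressed by words;
  every instruction takes unit time. Operands of instructions are addresses; constants and
  addresses are reduced modulo 2 ^ w. A program halts when its program counter leaves the program.
\<close>

datatype operation =
  Add | Sub | Mult | Divide | Modulo | BitAnd | BitOr | BitXor | ShiftL | ShiftR

datatype instr =
  SetConst nat nat              (* M[a] := c *)
| Compute operation nat nat nat (* M[a] := M[b] op M[c] *)
| Load nat nat                  (* M[a] := M[M[b]] *)
| Store nat nat                 (* M[M[a]] := M[b] *)
| Jump nat
| JumpLess nat nat nat          (* if M[a] < M[b] then jump to l *)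
| Sample nat                    (* M[a] := a fresh sample from the unknown distribution *)
| Random nat                    (* M[a] := a fresh uniformly random word *)

record ram_state =
  pc :: nat
  mem :: "nat \<Rightarrow> nat"
  samples_used :: nat

definition init_state :: ram_state where
  "init_state = \<lparr>pc = 0, mem = (\<lambda>_. 0), samples_used = 0\<rparr>"

fun apply_operation :: "nat \<Rightarrow> operation \<Rightarrow> nat \<Rightarrow> nat \<Rightarrow> nat" where
  "apply_operation w Add x y = x + y"
| "apply_operation w Sub x y = x + 2 ^ w - y"
| "apply_operation w Mult x y = x * y"
| "apply_operation w Divide x y = x div y"
| "apply_operation w Modulo x y = x mod y"
| "apply_operation w BitAnd x y = semiring_bit_operations_class.and x y"
| "apply_operation w BitOr x y = semiring_bit_operations_class.or x y"
| "apply_operation w BitXor x y = semiring_bit_operations_class.xor x y"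
| "apply_operation w ShiftL x y = push_bit y x"
| "apply_operation w ShiftR x y = drop_bit y x"

definition fetch :: "nat \<Rightarrow> ram_state \<Rightarrow> nat \<Rightarrow> nat" where
  "fetch w \<sigma> a = mem \<sigma> (a mod 2 ^ w)"

definition put :: "nat \<Rightarrow> nat \<Rightarrow> nat \<Rightarrow> ram_state \<Rightarrow> ram_state" where
  "put w a v \<sigma> = \<sigma>\<lparr>pc := Suc (pc \<sigma>), mem := (mem \<sigma>)(a mod 2 ^ w := v mod 2 ^ w)\<rparr>"

fun exec_instr :: "nat \<Rightarrow> nat pmf \<Rightarrow> instr \<Rightarrow> ram_state \<Rightarrow> ram_state pmf" where
  "exec_instr w P (SetConst a c) \<sigma> = return_pmf (put w a c \<sigma>)"
| "exec_instr w P (Compute f a b c) \<sigma> =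
     return_pmf (put w a (apply_operation w f (fetch w \<sigma> b) (fetch w \<sigma> c)) \<sigma>)"
| "exec_instr w P (Load a b) \<sigma> = return_pmf (put w a (fetch w \<sigma> (fetch w \<sigma> b)) \<sigma>)"
| "exec_instr w P (Store a b) \<sigma> = return_pmf (put w (fetch w \<sigma> a) (fetch w \<sigma> b) \<sigma>)"
| "exec_instr w P (Jump l) \<sigma> = return_pmf (\<sigma>\<lparr>pc := l\<rparr>)"
| "exec_instr w P (JumpLess a b l) \<sigma> =
     return_pmf (\<sigma>\<lparr>pc := (if fetch w \<sigma> a < fetch w \<sigma> b then l else Suc (pc \<sigma>))\<rparr>)"
| "exec_instr w P (Sample a) \<sigma> =
     map_pmf (\<lambda>x. put w a x (\<sigma>\<lparr>samples_used := Suc (samples_used \<sigma>)\<rparr>)) P"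
| "exec_instr w P (Random a) \<sigma> = map_pmf (\<lambda>x. put w a x \<sigma>) (pmf_of_set {..<2 ^ w})"

definition halted :: "instr list \<Rightarrow> ram_state \<Rightarrow> bool" where
  "halted prog \<sigma> \<longleftrightarrow> pc \<sigma> \<ge> length prog"

definition ram_step :: "nat \<Rightarrow> nat pmf \<Rightarrow> instr list \<Rightarrow> ram_state \<Rightarrow> ram_state pmf" where
  "ram_step w P prog \<sigma> =
     (if halted prog \<sigma> then return_pmf \<sigma> else exec_instr w P (prog ! pc \<sigma>) \<sigma>)"

primrec run :: "nat \<Rightarrow> nat pmf \<Rightarrow> instr list \<Rightarrow> nat \<Rightarrow> ram_state \<Rightarrow> ram_state pmf" where
  "run w P prog 0 \<sigma> = return_pmf \<sigma>"
| "run w P prog (Suc t) \<sigma> = bind_pmf (ram_step w P prog \<sigma>) (run w P prog t)"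

text \<open>
  A learning algorithm consists of two programs. The learner has sample access to the unknown
  distribution; the memory contents it leaves behind describe the random variable that it outputs.
  This random variable is the word that the generator, started on that memory, leaves in
  cell 0. The generator has no access to the unknown distribution: its sample instructions
  return 0.
\<close>

definition run_learner :: "nat \<Rightarrow> nat pmf \<Rightarrow> instr list \<Rightarrow> nat \<Rightarrow> ram_state pmf" where
  "run_learner w P learner T = run w P learner T init_state"

definition run_generator :: "nat \<Rightarrow> instr list \<Rightarrow> nat \<Rightarrow> ram_state \<Rightarrow> ram_state pmf" where
  "run_generator w generator T \<sigma> = run w (return_pmf 0) generator T (\<sigma>\<lparr>pc := 0\<rparr>)"

definition output_rv :: "nat \<Rightarrow> instr list \<Rightarrow> nat \<Rightarrow> ram_state \<Rightarrow> nat pmf" where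
  "output_rv w generator T \<sigma> = map_pmf (\<lambda>\<tau>. mem \<tau> 0) (run_generator w generator T \<sigma>)"

(* Every execution on P halts, the learner within T steps and the generator within T further ones.
   The programs may depend on the parameters of the learning problem, so their length is charged
   as well: otherwise tables of arbitrary size could be hard-wired into them. *)
definition runs_in_time ::
    "nat \<Rightarrow> nat pmf \<Rightarrow> instr list \<Rightarrow> instr list \<Rightarrow> nat \<Rightarrow> bool" where
  "runs_in_time w P learner generator T \<longleftrightarrow>
     length learner \<le> T \<and> length generator \<le> T \<and>
     (\<forall>\<sigma> \<in> set_pmf (run_learner w P learner T).
        halted learner \<sigma> \<and>
        (\<forall>\<tau> \<in> set_pmf (run_generator w generator T \<sigma>). halted generator \<tau>))"

definition uses_samples :: "nat \<Rightarrow> nat pmf \<Rightarrow> instr list \<Rightarrow> nat \<Rightarrow> nat \<Rightarrow> bool" where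
  "uses_samples w P learner T m \<longleftrightarrow>
     (\<forall>\<sigma> \<in> set_pmf (run_learner w P learner T). samples_used \<sigma> \<le> m)"

definition success_prob ::
    "nat \<Rightarrow> nat pmf \<Rightarrow> instr list \<Rightarrow> instr list \<Rightarrow> nat \<Rightarrow> real \<Rightarrow> real" where
  "success_prob w P learner generator T \<epsilon> =
     measure_pmf.prob (run_learner w P learner T)
       {\<sigma>. tv_dist P (output_rv w generator T \<sigma>) \<le> \<epsilon>}"

(* Words must have room for log n bits, the order of a sample, and for the logarithm of the running
   time, the order of an address. *)
definition word_size_ok :: "real \<Rightarrow> nat \<Rightarrow> nat \<Rightarrow> real \<Rightarrow> nat \<Rightarrow> bool" where
  "word_size_ok C n k \<epsilon> w \<longleftrightarrow>
     real w \<ge> C * (log 2 (real n + 1) + real k ^ (5 * k) * log_recip \<epsilon> ^ (k + 2))"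

end

theory Submission
  imports Defs
begin

text \<open>
  The learner works in two rounds. The minimum and the maximum of \<open>O(1/\<epsilon>)\<close> samples enclose all but \<open>O(\<epsilon>)\<close> of the mass,
  in a window of width \<open>S = O((s + k) log (1/\<epsilon>))\<close>, where \<open>s\<^sup>2\<close> is the variance.
  Reduce modulo a multiple \<open>M = k! N\<close> of \<open>k!\<close> that exceeds \<open>S\<close>. Differences of two samples of a summand divide \<open>k!\<close>,
  and \<open>\<bar>sin (j t)\<bar> \<le> j \<bar>sin t\<bar>\<close>, so the characteristic function satisfies
  \<open>\<bar>\<phi> \<theta>\<bar>\<^sup>2 \<le> exp (- 4 s\<^sup>2 sin\<^sup>2 (k! \<theta> / 2) / k!\<^sup>2)\<close>: modulo \<open>M\<close>, the law is concentrated, up to exponentially small error,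
  on \<open>k! (2 D + 1)\<close> frequencies near the multiples of \<open>N\<close>, where \<open>D\<close> is polylogarithmic. By Plancherel, the empirical measure of
  \<open>O(k! D / \<epsilon>\<^sup>2)\<close> samples, projected to these frequencies, is \<open>\<epsilon>\<close>-close to the law in \<open>L\<^sup>1\<close>.

  The projection is a convolution with a kernel that is supported on multiples of \<open>k!\<close> and has Lipschitz constant \<open>O(D\<^sup>2/N\<^sup>2)\<close> there,
  so it may be replaced by a function constant on blocks, \<open>G = poly(k!, D, 1/\<epsilon>)\<close> of them in each residue class.
  All kernel values are therefore constants in a program whose size does not depend on \<open>n\<close>, and the program needs no jumps.
\<close>

text \<open>The time bound does not involve n, while the window that carries the law can have width
  of order \<open>k * sqrt n\<close>. A program of admissible length cannot hold one number per
  point of the window, and a table of kernel values might have to depend on the window, which is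
  known only after the first round. Two facts remove both obstacles. Within blocks of g consecutive
  points of a residue class modulo \<open>k!\<close>, the kernel hardly changes. At block ends, the
  kernel of period \<open>g * h\<close> is exactly \<open>1 / g\<close> times the kernel of period
  h, and the generator supplies the factor \<open>1 / g\<close> itself by choosing a uniform point
  of the block that it draws. So one table for each \<open>h \<le> G\<close> serves all windows.

  The scale throughout is \<open>s + k\<close> and not s: the decay bound is void for
  \<open>s = 0\<close>, but exchanging s for \<open>s + k\<close> in its exponent costs only a
  factor \<open>exp 4\<close>, so that small variances need no separate treatment.\<close>

abbreviation (input) "prob \<equiv> measure_pmf.prob"

abbreviation (input) "expect \<equiv> measure_pmf.expectation"

section \<open>Band-limited projection on a cyclic group\<close>

definition chi :: "nat \<Rightarrow> int \<Rightarrow> complex" where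
  "chi M z = cis (2 * pi * of_int z / of_nat M)"

lemma chi_0 [simp]: "chi M 0 = 1"
  by (simp add: chi_def)

lemma chi_add: "chi M (a + b) = chi M a * chi M b"
  by (simp add: chi_def cis_mult add_divide_distrib distrib_left)

lemma norm_chi [simp]: "norm (chi M z) = 1"
  by (simp add: chi_def)

lemma cnj_chi: "cnj (chi M z) = chi M (- z)"
  by (simp add: chi_def cis_cnj)

lemma chi_eq_1_iff:
  assumes "M > 0"
  shows "chi M z = 1 \<longleftrightarrow> int M dvd z"
proof
  assume "chi M z = 1"
  then have "exp (\<i> * of_real (2 * pi * of_int z / of_nat M)) = 1"
    by (simp add: chi_def cis_conv_exp)
  then obtain n :: int where n: "2 * pi * of_int z / of_nat M = of_int (2 * n) * pi"
    by (auto simp: exp_eq_1)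
  then have "real_of_int z = of_int (n * int M)"
    using assms by (simp add: field_simps)
  then have "z = n * int M" by linarith
  then show "int M dvd z" by simp
next
  assume "int M dvd z"
  then obtain n where "z = int M * n" by auto
  then have "2 * pi * of_int z / of_nat M = 2 * pi * real_of_int n"
    using assms by simp
  then have "chi M z = cis (2 * pi * of_int n)"
    by (simp only: chi_def)
  also have "\<dots> = 1" by (rule cis_multiple_2pi) simp
  finally show "chi M z = 1" .
qed

lemma chi_cong:
  assumes "M > 0" "int M dvd a - b"
  shows "chi M a = chi M b"
proof -
  have "chi M a = chi M (a - b) * chi M b" by (simp flip: chi_add)
  then show ?thesis using assms by (simp add: chi_eq_1_iff)
qed

lemma chi_power: "chi M (z * int x) = chi M z ^ x"
proof -
  have "chi M z ^ x = cis (real x * (2 * pi * of_int z / of_nat M))"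
    unfolding chi_def by (rule Complex.DeMoivre)
  then show ?thesis by (simp add: chi_def mult_ac)
qed

lemma sum_chi:
  assumes "M > 0"
  shows "(\<Sum>x<M. chi M (z * int x)) = (if int M dvd z then of_nat M else 0)"
proof (cases "int M dvd z")
  case True
  then have "chi M (z * int x) = 1" for x using assms by (simp add: chi_eq_1_iff)
  then show ?thesis using True by simp
next
  case False
  then have "chi M z \<noteq> 1" using assms by (simp add: chi_eq_1_iff)
  moreover have "chi M z ^ M = 1"
    using assms by (simp flip: chi_power add: chi_eq_1_iff)
  ultimately have "(\<Sum>x<M. chi M z ^ x) = 0"
    by (simp add: geometric_sum)
  then show ?thesis using False by (simp add: chi_power)
qed

text \<open>The block of M frequencies may start anywhere. It will start at \<open>- D\<close>, so
  that the frequencies near 0 are consecutive integers.\<close>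

lemma sum_chi_interval:
  assumes "M > 0"
  shows "(\<Sum>b\<in>{c..<c + int M}. chi M (b * z)) = (if int M dvd z then of_nat M else 0)"
proof -
  have "(\<Sum>b\<in>{c..<c + int M}. chi M (b * z)) = (\<Sum>x<M. chi M ((c + int x) * z))"
    by (rule sum.reindex_bij_witness[of _ "\<lambda>x. c + int x" "\<lambda>b. nat (b - c)"]) auto
  also have "\<dots> = chi M (c * z) * (\<Sum>x<M. chi M (z * int x))"
    unfolding sum_distrib_left by (intro sum.cong refl) (simp flip: chi_add add: algebra_simps)
  also have "\<dots> = (if int M dvd z then of_nat M else 0)"
    using assms by (auto simp: sum_chi chi_eq_1_iff)
  finally show ?thesis .
qed

lemma dvd_diff_small:
  fixes x y :: nat
  assumes "x < M" "y < M"
  shows "int M dvd int x - int y \<longleftrightarrow> x = y"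
proof
  assume "int M dvd int x - int y"
  moreover have "\<bar>int x - int y\<bar> < int M" using assms by auto
  ultimately have "int x - int y = 0" using dvd_imp_le_int[of "int x - int y" "int M"] by linarith
  then show "x = y" by simp
qed auto

lemma dvd_diff_interval:
  assumes "a \<in> {c..<c + int M}" "b \<in> {c..<c + int M}"
  shows "int M dvd a - b \<longleftrightarrow> a = b"
proof
  assume "int M dvd a - b"
  moreover have "\<bar>a - b\<bar> < int M" using assms by auto
  ultimately have "a - b = 0" using dvd_imp_le_int[of "a - b" "int M"] by linarith
  then show "a = b" by simp
qed auto

section \<open>Plancherel identity and projection onto a set of frequencies\<close>

lemma parseval:
  assumes M: "M > 0"
  shows "(\<Sum>b\<in>{c..<c + int M}. (norm (\<Sum>x<M. F x * chi M (b * int x)))\<^sup>2)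
       = of_nat M * (\<Sum>x<M. (norm (F x))\<^sup>2)"
proof -
  let ?B = "{c..<c + int M}"
  have "complex_of_real (\<Sum>b\<in>?B. (norm (\<Sum>x<M. F x * chi M (b * int x)))\<^sup>2)
      = (\<Sum>b\<in>?B. (\<Sum>x<M. F x * chi M (b * int x)) * cnj (\<Sum>y<M. F y * chi M (b * int y)))"
    by (simp only: of_real_sum of_real_mult of_real_of_nat_eq complex_norm_square)
  also have "\<dots> = (\<Sum>b\<in>?B. \<Sum>x<M. \<Sum>y<M. F x * cnj (F y) * chi M (b * (int x - int y)))"
  proof (intro sum.cong refl)
    fix b
    have chi: "chi M (b * (int x - int y)) = chi M (b * int x) * chi M (- (b * int y))" for x y
      by (simp flip: chi_add add: algebra_simps)
    show "(\<Sum>x<M. F x * chi M (b * int x)) * cnj (\<Sum>y<M. F y * chi M (b * int y))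
        = (\<Sum>x<M. \<Sum>y<M. F x * cnj (F y) * chi M (b * (int x - int y)))"
      by (simp add: sum_product cnj_chi chi mult_ac)
  qed
  also have "\<dots> = (\<Sum>x<M. \<Sum>y<M. F x * cnj (F y) * (\<Sum>b\<in>?B. chi M (b * (int x - int y))))"
    unfolding sum_distrib_left by (subst sum.swap, intro sum.cong refl, rule sum.swap)
  also have "\<dots> = (\<Sum>x<M. \<Sum>y<M. if x = y then F x * cnj (F x) * of_nat M else 0)"
    using M by (intro sum.cong refl) (auto simp: sum_chi_interval dvd_diff_small)
  also have "\<dots> = of_nat M * (\<Sum>x<M. F x * cnj (F x))"
    by (simp add: sum_distrib_left mult_ac)
  also have "\<dots> = complex_of_real (of_nat M * (\<Sum>x<M. (norm (F x))\<^sup>2))"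
    by (simp only: of_real_sum of_real_mult of_real_of_nat_eq complex_norm_square)
  finally show ?thesis by (simp only: of_real_eq_iff)
qed

text \<open>The inverse Fourier transform of the indicator function of A modulo M; convolution with
  it is the orthogonal projection onto the frequencies in A.\<close>

definition band_kernel :: "nat \<Rightarrow> int set \<Rightarrow> int \<Rightarrow> complex" where
  "band_kernel M A z = (\<Sum>a\<in>A. chi M (a * z)) / of_nat M"

text \<open>Orthogonality leaves only the a congruent to b, and since A and b lie in one interval of
  length M, congruent means equal.\<close>

lemma band_kernel_transform:
  assumes M: "M > 0" and A: "A \<subseteq> {c..<c + int M}" and b: "b \<in> {c..<c + int M}"
  shows "(\<Sum>x<M. band_kernel M A (y - int x) * chi M (b * int x)) = (if b \<in> A then chi M (b * y) else 0)"
proof -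
  have fin: "finite A" using A finite_subset by blast
  have "(\<Sum>x<M. band_kernel M A (y - int x) * chi M (b * int x))
      = (\<Sum>x<M. \<Sum>a\<in>A. chi M (a * y) * chi M ((b - a) * int x) / of_nat M)"
    unfolding band_kernel_def sum_divide_distrib sum_distrib_right
    by (intro sum.cong refl) (simp flip: chi_add add: algebra_simps)
  also have "\<dots> = (\<Sum>a\<in>A. chi M (a * y) * (\<Sum>x<M. chi M ((b - a) * int x)) / of_nat M)"
    unfolding sum_distrib_left sum_divide_distrib by (rule sum.swap)
  also have "\<dots> = (\<Sum>a\<in>A. if a = b then chi M (b * y) else 0)"
  proof (intro sum.cong refl)
    fix a assume "a \<in> A"
    then have "int M dvd b - a \<longleftrightarrow> b = a" using A b by (intro dvd_diff_interval) auto
    then show "chi M (a * y) * (\<Sum>x<M. chi M ((b - a) * int x)) / of_nat M = (if a = b then chi M (b * y) else 0)"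
      using M by (auto simp: sum_chi)
  qed
  also have "\<dots> = (if b \<in> A then chi M (b * y) else 0)" using fin by simp
  finally show ?thesis .
qed

text \<open>By \<open>parseval\<close>, each frequency in A contributes exactly 1, whatever y is.
  This uniformity in y controls the variance of the empirical projection without any knowledge of
  the law.\<close>

lemma band_kernel_energy:
  assumes M: "M > 0" and A: "A \<subseteq> {c..<c + int M}"
  shows "(\<Sum>x<M. (norm (band_kernel M A (y - int x)))\<^sup>2) = card A / of_nat M"
proof -
  let ?B = "{c..<c + int M}"
  have "of_nat M * (\<Sum>x<M. (norm (band_kernel M A (y - int x)))\<^sup>2)
      = (\<Sum>b\<in>?B. (norm (if b \<in> A then chi M (b * y) else 0))\<^sup>2)"
    unfolding parseval[OF M, symmetric, of _ c]
    by (intro sum.cong refl) (simp add: band_kernel_transform[OF M A])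
  also have "\<dots> = (\<Sum>b\<in>?B. if b \<in> A then 1 else 0)"
    by (intro sum.cong) auto
  also have "\<dots> = card A"
    using A by (simp add: sum.If_cases Int_absorb1)
  finally show ?thesis using M by (simp add: field_simps)
qed

text \<open>The residual has the transform of p off A and 0 on A, so its energy is the spectral mass
  that the projection cuts off.\<close>

lemma band_kernel_bias:
  fixes p :: "nat \<Rightarrow> complex"
  assumes M: "M > 0" and A: "A \<subseteq> {c..<c + int M}"
  shows "of_nat M * (\<Sum>x<M. (norm (p x - (\<Sum>y<M. p y * band_kernel M A (int y - int x))))\<^sup>2)
       = (\<Sum>b\<in>{c..<c + int M} - A. (norm (\<Sum>y<M. p y * chi M (b * int y)))\<^sup>2)"
proof -
  let ?B = "{c..<c + int M}"
  let ?P = "\<lambda>b. \<Sum>y<M. p y * chi M (b * int y)"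
  have tr: "(\<Sum>x<M. (p x - (\<Sum>y<M. p y * band_kernel M A (int y - int x))) * chi M (b * int x))
      = (if b \<in> A then 0 else ?P b)" if "b \<in> ?B" for b
  proof -
    have "(\<Sum>x<M. (\<Sum>y<M. p y * band_kernel M A (int y - int x)) * chi M (b * int x))
        = (\<Sum>y<M. p y * (\<Sum>x<M. band_kernel M A (int y - int x) * chi M (b * int x)))"
      unfolding sum_distrib_left sum_distrib_right by (subst sum.swap) (simp add: mult_ac)
    also have "\<dots> = (if b \<in> A then ?P b else 0)"
      by (simp add: band_kernel_transform[OF M A that])
    finally show ?thesis by (simp add: left_diff_distrib sum_subtractf)
  qed
  have "of_nat M * (\<Sum>x<M. (norm (p x - (\<Sum>y<M. p y * band_kernel M A (int y - int x))))\<^sup>2)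
      = (\<Sum>b\<in>?B. (norm (if b \<in> A then 0 else ?P b))\<^sup>2)"
    unfolding parseval[OF M, symmetric, of _ c] by (intro sum.cong refl) (simp add: tr)
  also have "\<dots> = (\<Sum>b\<in>?B - A. (norm (if b \<in> A then 0 else ?P b))\<^sup>2)"
    by (rule sum.mono_neutral_right) auto
  also have "\<dots> = (\<Sum>b\<in>?B - A. (norm (?P b))\<^sup>2)"
    by (intro sum.cong) auto
  finally show ?thesis .
qed

section \<open>Tail and Fourier decay of a sum of independent variables\<close>

definition sum_law :: "nat \<Rightarrow> (nat \<Rightarrow> nat pmf) \<Rightarrow> nat pmf" where
  "sum_law n p = map_pmf (\<lambda>x. \<Sum>i<n. x i) (Pi_pmf {..<n} 0 p)"

lemma sum_law_0: "sum_law 0 p = return_pmf 0"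
  by (simp add: sum_law_def)

lemma sum_law_Suc: "sum_law (Suc n) p = bind_pmf (p n) (\<lambda>y. map_pmf (\<lambda>s. s + y) (sum_law n p))"
proof -
  have "sum_law (Suc n) p
      = bind_pmf (p n) (\<lambda>y. bind_pmf (Pi_pmf {..<n} 0 p) (\<lambda>f. return_pmf (\<Sum>i<Suc n. (f(n := y)) i)))"
    by (simp add: sum_law_def lessThan_Suc Pi_pmf_insert' map_bind_pmf)
  also have "\<dots> = bind_pmf (p n) (\<lambda>y. bind_pmf (Pi_pmf {..<n} 0 p) (\<lambda>f. return_pmf ((\<Sum>i<n. f i) + y)))"
    by simp
  finally show ?thesis
    by (simp add: sum_law_def map_pmf_def bind_assoc_pmf bind_return_pmf)
qed

lemma set_sum_law:
  assumes "\<And>i. i < n \<Longrightarrow> set_pmf (p i) \<subseteq> {..k}"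
  shows "set_pmf (sum_law n p) \<subseteq> {..n * k}"
  using assms
proof (induction n)
  case (Suc n)
  have "set_pmf (sum_law n p) \<subseteq> {..n * k}" "set_pmf (p n) \<subseteq> {..k}"
    using Suc by auto
  then have "s + y \<le> Suc n * k" if "y \<in> set_pmf (p n)" "s \<in> set_pmf (sum_law n p)" for s y
    using that by fastforce
  then show ?case by (auto simp: sum_law_Suc)
qed (simp add: sum_law_0)

text \<open>The codomain is general so that one induction serves both the complex characteristic
  function and the real moment generating function.\<close>

lemma expectation_sum_law:
  fixes \<phi> :: "nat \<Rightarrow> 'a :: {banach, second_countable_topology, real_normed_field}"
  assumes "\<phi> 0 = 1" "\<And>x y. \<phi> (x + y) = \<phi> x * \<phi> y"
    and "\<And>i. i < n \<Longrightarrow> set_pmf (p i) \<subseteq> {..k}"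
  shows "expect (sum_law n p) \<phi> = (\<Prod>i<n. expect (p i) \<phi>)"
  using assms(3)
proof (induction n)
  case (Suc n)
  have fin1: "finite (set_pmf (p n))"
    using Suc.prems[of n] by (simp add: finite_subset)
  have "set_pmf (sum_law n p) \<subseteq> {..n * k}"
    using Suc.prems by (intro set_sum_law) simp
  then have fin2: "finite (set_pmf (sum_law n p))"
    by (rule finite_subset) simp
  note fin = fin1 fin2
  have "expect (sum_law (Suc n) p) \<phi>
      = (\<Sum>y\<in>set_pmf (p n). pmf (p n) y *\<^sub>R expect (map_pmf (\<lambda>s. s + y) (sum_law n p)) \<phi>)"
    unfolding sum_law_Suc using fin by (intro pmf_expectation_bind) auto
  also have "\<dots> = (\<Sum>y\<in>set_pmf (p n). pmf (p n) y *\<^sub>R \<phi> y) * expect (sum_law n p) \<phi>"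
    unfolding sum_distrib_right by (intro sum.cong refl) (simp add: assms(2) mult.commute)
  also have "(\<Sum>y\<in>set_pmf (p n). pmf (p n) y *\<^sub>R \<phi> y) = expect (p n) \<phi>"
    using fin by (intro integral_measure_pmf[symmetric]) auto
  finally show ?case using Suc by (simp add: mult.commute)
qed (simp add: sum_law_0 assms(1))

section \<open>Decay of the characteristic function\<close>

lemma abs_sin_mult_le: "\<bar>sin (real m * t)\<bar> \<le> real m * \<bar>sin t\<bar>"
proof (induction m)
  case (Suc m)
  have "\<bar>sin (real (Suc m) * t)\<bar> = \<bar>sin (real m * t) * cos t + cos (real m * t) * sin t\<bar>"
    by (simp add: distrib_right sin_add algebra_simps)
  also have "\<dots> \<le> \<bar>sin (real m * t)\<bar> * \<bar>cos t\<bar> + \<bar>cos (real m * t)\<bar> * \<bar>sin t\<bar>"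
    by (metis abs_mult abs_triangle_ineq)
  also have "\<dots> \<le> \<bar>sin (real m * t)\<bar> * 1 + 1 * \<bar>sin t\<bar>"
    by (intro add_mono mult_mono) auto
  finally show ?case using Suc by (simp add: distrib_right)
qed simp

text \<open>Write \<open>L = m * j\<close> and apply \<open>abs_sin_mult_le\<close> to
  \<open>sin (m * (j * t))\<close>. Dividing by \<open>L^2\<close> and not by \<open>m^2\<close>
  retains the factor \<open>j^2\<close>, which averages to twice the variance when j is the
  difference of two independent copies.\<close>

lemma sin_sq_divisor:
  fixes j L :: nat
  assumes "j dvd L" "L > 0"
  shows "(real j)\<^sup>2 * (sin (real L * t))\<^sup>2 / (real L)\<^sup>2 \<le> (sin (real j * t))\<^sup>2"
proof -
  obtain m where L: "L = m * j" using assms by (metis dvd_def mult.commute)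
  have "\<bar>sin (real L * t)\<bar> \<le> real m * \<bar>sin (real j * t)\<bar>"
    using abs_sin_mult_le[of m "real j * t"] by (simp add: L mult_ac)
  then have "(sin (real L * t))\<^sup>2 \<le> (real m)\<^sup>2 * (sin (real j * t))\<^sup>2"
    by (metis abs_ge_zero power2_abs power_mono power_mult_distrib)
  then have "(real j)\<^sup>2 * (sin (real L * t))\<^sup>2 \<le> (real j)\<^sup>2 * ((real m)\<^sup>2 * (sin (real j * t))\<^sup>2)"
    by (intro mult_left_mono) auto
  then show ?thesis using assms(2) by (simp add: L field_simps power_mult_distrib)
qed

definition pmf_var :: "nat pmf \<Rightarrow> real" where
  "pmf_var p = expect p (\<lambda>x. (real x)\<^sup>2) - (expect p real)\<^sup>2"

text \<open>Half the mean squared difference of two independent copies: the form in which the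
  variance appears when the squared modulus of a characteristic function is expanded.\<close>

lemma pmf_var_alt:
  assumes "finite (set_pmf p)"
  shows "pmf_var p = (\<Sum>x\<in>set_pmf p. \<Sum>y\<in>set_pmf p. pmf p x * pmf p y * (real x - real y)\<^sup>2) / 2"
proof -
  let ?S = "set_pmf p" and ?w = "pmf p"
  have one: "(\<Sum>x\<in>?S. ?w x) = 1" using assms by (simp add: sum_pmf_eq_1)
  have "(\<Sum>x\<in>?S. \<Sum>y\<in>?S. ?w x * ?w y * (real x - real y)\<^sup>2)
     = (\<Sum>x\<in>?S. \<Sum>y\<in>?S. ?w x * (real x)\<^sup>2 * ?w y + ?w x * (?w y * (real y)\<^sup>2) - 2 * (?w x * real x * (?w y * real y)))"
    by (intro sum.cong refl) (simp add: power2_eq_square algebra_simps)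
  also have "\<dots> = (\<Sum>x\<in>?S. ?w x * (real x)\<^sup>2) * (\<Sum>y\<in>?S. ?w y) + (\<Sum>x\<in>?S. ?w x) * (\<Sum>y\<in>?S. ?w y * (real y)\<^sup>2)
      - 2 * ((\<Sum>x\<in>?S. ?w x * real x) * (\<Sum>y\<in>?S. ?w y * real y))"
    unfolding sum_product sum_subtractf sum.distrib by (simp only: sum_distrib_left)
  also have "\<dots> = 2 * pmf_var p"
    using assms unfolding pmf_var_def one
    by (simp add: integral_measure_pmf_real[of ?S] power2_eq_square mult_ac)
  finally show ?thesis by simp
qed

text \<open>The squared modulus is the mean of \<open>cos (\<theta> * (x - y))\<close> over
  independent copies x and y. Every nonzero difference divides L, so \<open>sin_sq_divisor\<close>
  bounds each cosine in terms of \<open>(x - y)^2\<close>, and the average is a variance.\<close>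

lemma char_fun_bound:
  assumes supp: "set_pmf p \<subseteq> {..<k}" and L: "L > 0" "\<And>j. j < k \<Longrightarrow> j > 0 \<Longrightarrow> j dvd L"
  shows "(norm (expect p (\<lambda>x. cis (\<theta> * real x))))\<^sup>2
       \<le> exp (- (4 * pmf_var p * (sin (real L * (\<theta> / 2)))\<^sup>2 / (real L)\<^sup>2))"
proof -
  let ?S = "set_pmf p" and ?w = "pmf p"
  have fin: "finite ?S" by (rule finite_subset[OF supp]) simp
  have one: "(\<Sum>x\<in>?S. ?w x) = 1" using fin by (simp add: sum_pmf_eq_1)
  define s where "s = (sin (real L * (\<theta> / 2)))\<^sup>2 / (real L)\<^sup>2"
  have E: "expect p (\<lambda>x. cis (\<theta> * real x)) = (\<Sum>x\<in>?S. ?w x *\<^sub>R cis (\<theta> * real x))"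
    using fin by (intro integral_measure_pmf) auto
  have "(norm (\<Sum>x\<in>?S. ?w x *\<^sub>R cis (\<theta> * real x)))\<^sup>2
      = (\<Sum>x\<in>?S. ?w x * cos (\<theta> * real x))\<^sup>2 + (\<Sum>x\<in>?S. ?w x * sin (\<theta> * real x))\<^sup>2"
    by (simp add: cmod_power2)
  also have "\<dots> = (\<Sum>x\<in>?S. \<Sum>y\<in>?S. ?w x * ?w y * cos (\<theta> * (real x - real y)))"
    unfolding power2_eq_square sum_product sum.distrib[symmetric]
    by (intro sum.cong refl) (simp add: right_diff_distrib cos_diff algebra_simps)
  also have "\<dots> \<le> (\<Sum>x\<in>?S. \<Sum>y\<in>?S. ?w x * ?w y * (1 - 2 * ((real x - real y)\<^sup>2 * s)))"
  proof (intro sum_mono mult_left_mono)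
    fix x y assume xy: "x \<in> ?S" "y \<in> ?S"
    define j where "j = (if x \<le> y then y - x else x - y)"
    have "x < k" "y < k" using xy supp by auto
    then have j: "j < k" by (auto simp: j_def)
    have jd: "real j = \<bar>real x - real y\<bar>" by (auto simp: j_def of_nat_diff)
    have "(real j)\<^sup>2 * s \<le> (sin (real j * (\<theta> / 2)))\<^sup>2"
    proof (cases "j = 0")
      case False
      then show ?thesis
        using sin_sq_divisor[OF L(2)[OF j] L(1), of "\<theta> / 2"] by (simp add: s_def)
    qed simp
    moreover have "2 * (real j * (\<theta> / 2)) = (if x \<le> y then - (\<theta> * (real x - real y)) else \<theta> * (real x - real y))"
      by (auto simp: jd abs_if algebra_simps)
    then have "cos (\<theta> * (real x - real y)) = cos (2 * (real j * (\<theta> / 2)))"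
      by simp
    moreover have "\<dots> = 1 - 2 * (sin (real j * (\<theta> / 2)))\<^sup>2" by (rule cos_double_sin)
    ultimately show "cos (\<theta> * (real x - real y)) \<le> 1 - 2 * ((real x - real y)\<^sup>2 * s)"
      unfolding jd power2_abs by linarith
  qed auto
  also have "\<dots> = 1 - 4 * pmf_var p * s"
  proof -
    have "(\<Sum>x\<in>?S. \<Sum>y\<in>?S. ?w x * ?w y * (1 - 2 * ((real x - real y)\<^sup>2 * s)))
        = (\<Sum>x\<in>?S. \<Sum>y\<in>?S. ?w x * ?w y - 2 * s * (?w x * ?w y * (real x - real y)\<^sup>2))"
      by (intro sum.cong refl) (simp add: algebra_simps)
    also have "\<dots> = (\<Sum>x\<in>?S. ?w x) * (\<Sum>y\<in>?S. ?w y)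
        - 2 * s * (\<Sum>x\<in>?S. \<Sum>y\<in>?S. ?w x * ?w y * (real x - real y)\<^sup>2)"
      unfolding sum_product sum_subtractf by (simp only: sum_distrib_left)
    finally show ?thesis unfolding pmf_var_alt[OF fin] one by simp
  qed
  also have "\<dots> \<le> exp (- (4 * pmf_var p * s))" using exp_ge_add_one_self[of "- (4 * pmf_var p * s)"] by simp
  finally show ?thesis unfolding E s_def by simp
qed

section \<open>Exponential moments and tails\<close>

lemma exp_le_quadratic:
  fixes y :: real assumes "\<bar>y\<bar> \<le> 1" shows "exp y \<le> 1 + y + y\<^sup>2"
proof (cases "y \<ge> 0")
  case True then show ?thesis using assms exp_bound by auto
next
  case False
  define z where "z = - y"
  have z: "0 \<le> z" "z \<le> 1" using False assms by (auto simp: z_def)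
  have "1 - z + z\<^sup>2 = (z - 1 / 2)\<^sup>2 + 3 / 4"
    by (simp add: algebra_simps power2_eq_square)
  then have pos: "1 - z + z\<^sup>2 > 0" using zero_le_power2[of "z - 1 / 2"] by linarith
  \<comment> \<open>For negative y the claim is \<open>1 \<le> exp z * (1 - z + z^2)\<close>.
    Multiplied by the quadratic Taylor polynomial of exp, the linear term cancels and all other
    coefficients are nonnegative.\<close>
  have "1 \<le> 1 + (z * z / 2 + z * z * z / 2 + z * z * z * z / 2)" using z by simp
  also have "\<dots> = (1 + z + z\<^sup>2 / 2) * (1 - z + z\<^sup>2)"
    by (simp add: field_simps power2_eq_square)
  also have "\<dots> \<le> exp z * (1 - z + z\<^sup>2)"
    using z pos by (intro mult_right_mono exp_lower_Taylor_quadratic) auto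
  finally have "1 \<le> exp z * (1 - z + z\<^sup>2)" .
  then have "exp (- z) \<le> 1 - z + z\<^sup>2" by (simp add: exp_minus field_simps)
  then show ?thesis by (simp add: z_def)
qed

text \<open>Centred at the mean, the exponent stays in [-1, 1], where
  \<open>exp_le_quadratic\<close> applies; the linear term averages to 0 and the quadratic one to
  the variance rather than the raw second moment.\<close>

lemma mgf_bound:
  assumes supp: "set_pmf p \<subseteq> {..<k}" and l: "\<bar>l\<bar> * real k \<le> 1"
  shows "expect p (\<lambda>x. exp (l * real x))
       \<le> exp (l * expect p real + l\<^sup>2 * pmf_var p)"
proof -
  let ?S = "set_pmf p" and ?w = "pmf p"
  have fin: "finite ?S" by (rule finite_subset[OF supp]) simp
  have one: "(\<Sum>x\<in>?S. ?w x) = 1" using fin by (simp add: sum_pmf_eq_1)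
  define \<mu> where "\<mu> = (\<Sum>x\<in>?S. ?w x * real x)"
  have mu: "expect p real = \<mu>"
    unfolding \<mu>_def using fin by (subst integral_measure_pmf_real[of ?S]) (auto simp: mult_ac)
  have E2: "expect p (\<lambda>x. (real x)\<^sup>2) = (\<Sum>x\<in>?S. ?w x * (real x)\<^sup>2)"
    using fin by (subst integral_measure_pmf_real[of ?S]) (auto simp: mult_ac)
  have mub: "0 \<le> \<mu>" "\<mu> \<le> real k"
  proof -
    show "0 \<le> \<mu>" unfolding \<mu>_def by (intro sum_nonneg) auto
    have "\<mu> \<le> (\<Sum>x\<in>?S. ?w x * real k)"
      unfolding \<mu>_def using supp by (intro sum_mono mult_left_mono) auto
    then show "\<mu> \<le> real k" by (simp add: one flip: sum_distrib_right)
  qed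
  have "expect p (\<lambda>x. exp (l * real x)) = (\<Sum>x\<in>?S. ?w x * exp (l * real x))"
    using fin by (subst integral_measure_pmf_real[of ?S]) (auto simp: mult_ac)
  also have "\<dots> = exp (l * \<mu>) * (\<Sum>x\<in>?S. ?w x * exp (l * (real x - \<mu>)))"
    unfolding sum_distrib_left by (intro sum.cong refl) (simp add: exp_diff right_diff_distrib)
  also have "(\<Sum>x\<in>?S. ?w x * exp (l * (real x - \<mu>)))
      \<le> (\<Sum>x\<in>?S. ?w x * (1 + l * (real x - \<mu>) + (l * (real x - \<mu>))\<^sup>2))"
  proof (intro sum_mono mult_left_mono exp_le_quadratic)
    fix x assume "x \<in> ?S"
    then have "\<bar>real x - \<mu>\<bar> \<le> real k" using supp mub by fastforce
    then have "\<bar>l\<bar> * \<bar>real x - \<mu>\<bar> \<le> \<bar>l\<bar> * real k" by (intro mult_left_mono) auto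
    then show "\<bar>l * (real x - \<mu>)\<bar> \<le> 1" using l by (simp add: abs_mult)
  qed auto
  also have "\<dots> = (\<Sum>x\<in>?S. ?w x) * (1 - l * \<mu> + l\<^sup>2 * \<mu>\<^sup>2) + (l - 2 * l\<^sup>2 * \<mu>) * (\<Sum>x\<in>?S. ?w x * real x) + l\<^sup>2 * (\<Sum>x\<in>?S. ?w x * (real x)\<^sup>2)"
    unfolding sum_distrib_left sum_distrib_right sum.distrib[symmetric]
    by (intro sum.cong refl) (simp add: power2_eq_square algebra_simps)
  also have "\<dots> = 1 + l\<^sup>2 * pmf_var p"
    unfolding pmf_var_def mu E2 one \<mu>_def[symmetric] by (simp add: power2_eq_square algebra_simps)
  also have "\<dots> \<le> exp (l\<^sup>2 * pmf_var p)" by (rule exp_ge_add_one_self)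
  finally show ?thesis by (simp add: mu exp_add)
qed

lemma pmf_markov:
  fixes f :: "'a \<Rightarrow> real"
  assumes "finite (set_pmf p)" "\<And>x. x \<in> set_pmf p \<Longrightarrow> f x \<ge> 0" "c > 0"
  shows "prob p {x. f x \<ge> c} \<le> expect p f / c"
proof -
  have int: "integrable (measure_pmf p) g" for g :: "'a \<Rightarrow> real"
    using assms(1) by (rule integrable_measure_pmf_finite)
  have "c * prob p {x. f x \<ge> c} = expect p (\<lambda>x. c * indicator {x. f x \<ge> c} x)"
    by simp
  also have "\<dots> \<le> expect p f"
    using assms by (intro integral_mono_AE int AE_pmfI) (auto simp: indicator_def)
  finally show ?thesis using assms(3) by (simp add: field_simps)
qed

definition sum_mean :: "nat \<Rightarrow> (nat \<Rightarrow> nat pmf) \<Rightarrow> real" where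
  "sum_mean n p = (\<Sum>i<n. expect (p i) real)"

definition sum_var :: "nat \<Rightarrow> (nat \<Rightarrow> nat pmf) \<Rightarrow> real" where
  "sum_var n p = (\<Sum>i<n. pmf_var (p i))"

lemma sum_law_char_bound:
  assumes supp: "\<And>i. i < n \<Longrightarrow> set_pmf (p i) \<subseteq> {..<k}"
    and L: "L > 0" "\<And>j. j < k \<Longrightarrow> j > 0 \<Longrightarrow> j dvd L"
  shows "(norm (expect (sum_law n p) (\<lambda>x. cis (\<theta> * real x))))\<^sup>2
       \<le> exp (- (4 * sum_var n p * (sin (real L * (\<theta> / 2)))\<^sup>2 / (real L)\<^sup>2))"
proof -
  have supp': "set_pmf (p i) \<subseteq> {..k}" if "i < n" for i using supp[OF that] by auto
  have "expect (sum_law n p) (\<lambda>x. cis (\<theta> * real x))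
      = (\<Prod>i<n. expect (p i) (\<lambda>x. cis (\<theta> * real x)))"
    by (rule expectation_sum_law[OF _ _ supp']) (auto simp: cis_mult distrib_left)
  then have "(norm (expect (sum_law n p) (\<lambda>x. cis (\<theta> * real x))))\<^sup>2
      = (\<Prod>i<n. (norm (expect (p i) (\<lambda>x. cis (\<theta> * real x))))\<^sup>2)"
    by (simp add: prod_norm[symmetric] prod_power_distrib)
  also have "\<dots> \<le> (\<Prod>i<n. exp (- (4 * pmf_var (p i) * (sin (real L * (\<theta> / 2)))\<^sup>2 / (real L)\<^sup>2)))"
    by (intro prod_mono conjI zero_le_power2 char_fun_bound[OF supp L]) simp_all
  also have "\<dots> = exp (- (4 * sum_var n p * (sin (real L * (\<theta> / 2)))\<^sup>2 / (real L)\<^sup>2))"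
    unfolding exp_sum[OF finite_lessThan, symmetric] sum_var_def
    by (simp only: sum_negf sum_distrib_left sum_distrib_right sum_divide_distrib)
  finally show ?thesis .
qed

lemma pmf_var_nonneg: "finite (set_pmf p) \<Longrightarrow> pmf_var p \<ge> 0"
  by (simp add: pmf_var_alt sum_nonneg)

text \<open>A Chernoff bound with one fixed exponent. An exponential tail at scale
  \<open>sqrt (sum_var n p) + k\<close> is enough, since the window may be wider than the scale by a
  logarithmic factor.\<close>

lemma sum_law_tail:
  assumes supp: "\<And>i. i < n \<Longrightarrow> set_pmf (p i) \<subseteq> {..<k}" and k: "k > 0"
  shows "prob (sum_law n p) {x. \<bar>real x - sum_mean n p\<bar> \<ge> t}
       \<le> 2 * exp (1 - t / (sqrt (sum_var n p) + real k))"
proof -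
  let ?P = "sum_law n p"
  define \<tau> where "\<tau> = sqrt (sum_var n p) + real k"
  have supp': "set_pmf (p i) \<subseteq> {..k}" if "i < n" for i using supp[OF that] by auto
  have fin: "finite (set_pmf ?P)"
    by (rule finite_subset[OF set_sum_law[OF supp']]) simp_all
  have var0: "sum_var n p \<ge> 0"
    unfolding sum_var_def using supp by (intro sum_nonneg pmf_var_nonneg) (auto intro: finite_subset)
  have tau: "\<tau> > 0" "\<tau> \<ge> real k" "sum_var n p \<le> \<tau>\<^sup>2"
  proof -
    show "\<tau> \<ge> real k" using var0 by (simp add: \<tau>_def)
    then show "\<tau> > 0" using k by linarith
    have "sqrt (sum_var n p) \<le> \<tau>" by (simp add: \<tau>_def)
    then have "(sqrt (sum_var n p))\<^sup>2 \<le> \<tau>\<^sup>2" using var0 by (intro power_mono) auto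
    then show "sum_var n p \<le> \<tau>\<^sup>2" using var0 by simp
  qed
  have one_sided: "prob ?P {x. \<sigma> * (real x - sum_mean n p) \<ge> t} \<le> exp (1 - t / \<tau>)"
    if \<sigma>: "\<sigma> = 1 \<or> \<sigma> = -1" for \<sigma> :: real
  proof -
    \<comment> \<open>The value \<open>1 / \<tau>\<close> meets both constraints:
      \<open>\<bar>l\<bar> * k \<le> 1\<close> for \<open>mgf_bound\<close>, and a variance term of
      at most 1, which is the 1 in \<open>exp (1 - t / \<tau>)\<close>.\<close>
    define l where "l = \<sigma> / \<tau>"
    have lk: "\<bar>l\<bar> * real k \<le> 1" using \<sigma> tau by (auto simp: l_def field_simps)
    have l2: "l\<^sup>2 * sum_var n p \<le> 1" using \<sigma> tau by (auto simp: l_def field_simps)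
    have "expect ?P (\<lambda>x. exp (l * real x)) = (\<Prod>i<n. expect (p i) (\<lambda>x. exp (l * real x)))"
      by (rule expectation_sum_law[OF _ _ supp']) (auto simp: exp_add distrib_left)
    also have "\<dots> \<le> (\<Prod>i<n. exp (l * expect (p i) real + l\<^sup>2 * pmf_var (p i)))"
      by (intro prod_mono conjI mgf_bound[OF supp lk] Bochner_Integration.integral_nonneg) simp_all
    also have "\<dots> = exp (l * sum_mean n p + l\<^sup>2 * sum_var n p)"
      unfolding exp_sum[OF finite_lessThan, symmetric] sum_mean_def sum_var_def
      by (simp only: sum_distrib_left sum.distrib)
    also have "\<dots> \<le> exp (l * sum_mean n p + 1)" using l2 by simp
    finally have mgf: "expect ?P (\<lambda>x. exp (l * real x)) \<le> exp (l * sum_mean n p + 1)" .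
    have "{x. \<sigma> * (real x - sum_mean n p) \<ge> t} = {x. exp (l * real x) \<ge> exp (l * sum_mean n p + t / \<tau>)}"
    proof (intro Collect_cong)
      fix x :: nat
      have "l * real x - (l * sum_mean n p + t / \<tau>) = (\<sigma> * (real x - sum_mean n p) - t) / \<tau>"
        by (simp add: l_def algebra_simps diff_divide_distrib add_divide_distrib)
      then show "t \<le> \<sigma> * (real x - sum_mean n p) \<longleftrightarrow> exp (l * sum_mean n p + t / \<tau>) \<le> exp (l * real x)"
        using tau(1) by (smt (verit) divide_nonneg_pos exp_le_cancel_iff divide_neg_pos)
    qed
    then have "prob ?P {x. \<sigma> * (real x - sum_mean n p) \<ge> t}
        \<le> expect ?P (\<lambda>x. exp (l * real x)) / exp (l * sum_mean n p + t / \<tau>)"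
      by (simp only:) (rule pmf_markov[OF fin], auto)
    also have "\<dots> \<le> exp (l * sum_mean n p + 1) / exp (l * sum_mean n p + t / \<tau>)"
      using mgf by (intro divide_right_mono) auto
    also have "\<dots> = exp (1 - t / \<tau>)" by (simp flip: exp_diff)
    finally show ?thesis .
  qed
  have "prob ?P {x. \<bar>real x - sum_mean n p\<bar> \<ge> t}
      \<le> prob ?P ({x. 1 * (real x - sum_mean n p) \<ge> t} \<union> {x. - 1 * (real x - sum_mean n p) \<ge> t})"
    by (intro measure_pmf.finite_measure_mono) auto
  also have "\<dots> \<le> prob ?P {x. 1 * (real x - sum_mean n p) \<ge> t}
      + prob ?P {x. - 1 * (real x - sum_mean n p) \<ge> t}"
    by (rule measure_Un_le) simp_all
  also have "\<dots> \<le> exp (1 - t / \<tau>) + exp (1 - t / \<tau>)"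
    by (intro add_mono one_sided) simp_all
  finally show ?thesis by (simp add: \<tau>_def)
qed

text \<open>Everything that the analysis uses about the class: one scale s, the standard deviation,
  governs both the tail and the Fourier decay. The learner never sees s; the range of a sample takes
  its place.\<close>

lemma siirv_analytic:
  assumes "P \<in> siirv n k" "k > 0"
  obtains \<mu> s :: real where "s \<ge> 0" "set_pmf P \<subseteq> {..n * k}"
    "\<And>t. prob P {x. \<bar>real x - \<mu>\<bar> \<ge> t} \<le> 2 * exp (1 - t / (s + real k))"
    "\<And>\<theta>. (norm (expect P (\<lambda>x. cis (\<theta> * real x))))\<^sup>2
      \<le> exp (- (4 * s\<^sup>2 * (sin (fact k * (\<theta> / 2)))\<^sup>2 / (fact k)\<^sup>2))"
proof -
  obtain p where P: "P = sum_law n p" and supp: "\<And>i. i < n \<Longrightarrow> set_pmf (p i) \<subseteq> {..<k}"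
    using assms(1) unfolding siirv_def sum_law_def by auto
  have var0: "sum_var n p \<ge> 0"
    unfolding sum_var_def using supp by (intro sum_nonneg pmf_var_nonneg) (auto intro: finite_subset)
  have dvd: "j dvd fact k" if "j < k" "j > 0" for j :: nat
    using that by (intro dvd_fact) auto
  show ?thesis
  proof (rule that[of "sqrt (sum_var n p)" "sum_mean n p"])
    show "set_pmf P \<subseteq> {..n * k}"
    proof -
      have "set_pmf (p i) \<subseteq> {..k}" if "i < n" for i using supp[OF that] by auto
      then show ?thesis unfolding P by (rule set_sum_law)
    qed
    show "prob P {x. \<bar>real x - sum_mean n p\<bar> \<ge> t} \<le> 2 * exp (1 - t / (sqrt (sum_var n p) + real k))" for t
      unfolding P using supp assms(2) by (rule sum_law_tail)
    show "(norm (expect P (\<lambda>x. cis (\<theta> * real x))))\<^sup>2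
      \<le> exp (- (4 * (sqrt (sum_var n p))\<^sup>2 * (sin (fact k * (\<theta> / 2)))\<^sup>2 / (fact k)\<^sup>2))" for \<theta>
    proof -
      have "fact k > (0 :: nat)" by (rule fact_gt_zero)
      from sum_law_char_bound[OF supp this dvd, where \<theta> = \<theta>]
      show ?thesis unfolding P real_sqrt_pow2[OF var0] of_nat_fact .
    qed
  qed (use var0 in auto)
qed

section \<open>Empirical averages and sample ranges\<close>

lemma finite_set_replicate_pmf:
  assumes "finite (set_pmf P)"
  shows "finite (set_pmf (replicate_pmf m P))"
  using assms by (induction m) auto

lemma expectation_replicate_pmf_Suc:
  fixes h :: "'a list \<Rightarrow> real"
  assumes "finite (set_pmf P)"
  shows "expect (replicate_pmf (Suc m) P) h
       = (\<Sum>x\<in>set_pmf P. pmf P x * expect (replicate_pmf m P) (\<lambda>xs. h (x # xs)))"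
proof -
  have "replicate_pmf (Suc m) P = bind_pmf P (\<lambda>x. map_pmf (\<lambda>xs. x # xs) (replicate_pmf m P))"
    by (simp add: map_pmf_def)
  then have "expect (replicate_pmf (Suc m) P) h
      = (\<Sum>x\<in>set_pmf P. pmf P x *\<^sub>R expect (map_pmf (\<lambda>xs. x # xs) (replicate_pmf m P)) h)"
    using assms finite_set_replicate_pmf[OF assms, of m] by (simp only:) (intro pmf_expectation_bind, auto)
  then show ?thesis by simp
qed

lemma expectation_finite:
  fixes f :: "'a \<Rightarrow> real"
  assumes "finite (set_pmf P)"
  shows "expect P f = (\<Sum>x\<in>set_pmf P. pmf P x * f x)"
  using assms by (subst integral_measure_pmf_real[of "set_pmf P"]) (auto simp: mult.commute)

lemma iid_sum_moments:
  fixes g :: "'a \<Rightarrow> real"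
  assumes fin: "finite (set_pmf P)" and zero: "expect P g = 0"
  shows "expect (replicate_pmf m P) (\<lambda>xs. \<Sum>x\<leftarrow>xs. g x) = 0 \<and>
    expect (replicate_pmf m P) (\<lambda>xs. (\<Sum>x\<leftarrow>xs. g x)\<^sup>2)
      = real m * expect P (\<lambda>x. (g x)\<^sup>2)"
proof (induction m)
  case (Suc m)
  let ?R = "replicate_pmf m P"
  let ?S = "\<lambda>xs. \<Sum>x\<leftarrow>xs. g x"
  have int: "integrable (measure_pmf ?R) h" for h :: "'a list \<Rightarrow> real"
    by (rule integrable_measure_pmf_finite) (rule finite_set_replicate_pmf[OF fin])
  have one: "(\<Sum>x\<in>set_pmf P. pmf P x) = 1" using fin by (simp add: sum_pmf_eq_1)
  have z: "(\<Sum>x\<in>set_pmf P. pmf P x * g x) = 0" using zero fin by (simp add: expectation_finite)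
  have "expect ?R (\<lambda>xs. ?S (x # xs)) = g x" for x
    using Suc by (simp add: int)
  moreover have "expect ?R (\<lambda>xs. (?S (x # xs))\<^sup>2)
      = (g x)\<^sup>2 + real m * expect P (\<lambda>x. (g x)\<^sup>2)" for x
  proof -
    have "expect ?R (\<lambda>xs. (?S (x # xs))\<^sup>2)
        = expect ?R (\<lambda>xs. (g x)\<^sup>2 + 2 * g x * ?S xs + (?S xs)\<^sup>2)"
      by (simp add: power2_eq_square algebra_simps)
    also have "\<dots> = (g x)\<^sup>2 + 2 * g x * expect ?R ?S + expect ?R (\<lambda>xs. (?S xs)\<^sup>2)"
      by (simp add: int)
    finally show ?thesis using Suc by simp
  qed
  ultimately show ?case
    unfolding expectation_replicate_pmf_Suc[OF fin]
    by (simp add: z distrib_left sum.distrib expectation_finite[OF fin] one distrib_right flip: sum_distrib_right)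
qed simp

lemma iid_second_moment:
  fixes f :: "'a \<Rightarrow> real"
  assumes fin: "finite (set_pmf P)"
  shows "expect (replicate_pmf m P)
      (\<lambda>xs. ((\<Sum>x\<leftarrow>xs. f x) - real m * expect P f)\<^sup>2)
    \<le> real m * expect P (\<lambda>x. (f x)\<^sup>2)"
proof -
  define e where "e = expect P f"
  define g where "g = (\<lambda>x. f x - e)"
  have int: "integrable (measure_pmf P) h" for h :: "'a \<Rightarrow> real"
    by (rule integrable_measure_pmf_finite) (rule fin)
  have zero: "expect P g = 0"
    unfolding g_def e_def by (simp add: int)
  have "expect (replicate_pmf m P) (\<lambda>xs. ((\<Sum>x\<leftarrow>xs. f x) - real m * e)\<^sup>2)
      = expect (replicate_pmf m P) (\<lambda>xs. (\<Sum>x\<leftarrow>xs. g x)\<^sup>2)"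
  proof (intro integral_cong_AE AE_pmfI)
    fix xs assume "xs \<in> set_pmf (replicate_pmf m P)"
    then have "length xs = m" by (simp add: set_replicate_pmf)
    then have "(\<Sum>x\<leftarrow>xs. g x) = (\<Sum>x\<leftarrow>xs. f x) - real m * e"
      by (simp add: g_def sum_list_subtractf sum_list_triv)
    then show "((\<Sum>x\<leftarrow>xs. f x) - real m * e)\<^sup>2 = (\<Sum>x\<leftarrow>xs. g x)\<^sup>2" by simp
  qed auto
  also have "\<dots> = real m * expect P (\<lambda>x. (g x)\<^sup>2)"
    using iid_sum_moments[OF fin zero] by blast
  also have "expect P (\<lambda>x. (g x)\<^sup>2)
      = expect P (\<lambda>x. (f x)\<^sup>2 - 2 * e * f x + e\<^sup>2)"
    by (simp add: g_def power2_eq_square algebra_simps)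
  also have "\<dots> = expect P (\<lambda>x. (f x)\<^sup>2) - e\<^sup>2"
    by (simp add: int power2_eq_square flip: e_def)
  also have "real m * \<dots> \<le> real m * expect P (\<lambda>x. (f x)\<^sup>2)"
    by (intro mult_left_mono) auto
  finally show ?thesis by (simp add: e_def)
qed

text \<open>The bound V is on the sum over all coordinates for each single sample, so the number of
  coordinates does not enter. The variances add up to at most \<open>V / m\<close>, and Markov's
  inequality is applied to the total.\<close>

lemma iid_vector_deviation:
  fixes f :: "'b \<Rightarrow> 'a \<Rightarrow> real"
  assumes fin: "finite (set_pmf P)" and X: "finite X" and c: "c > 0" and m: "m > 0"
    and V: "\<And>y. y \<in> set_pmf P \<Longrightarrow> (\<Sum>x\<in>X. (f x y)\<^sup>2) \<le> V"
  shows "prob (replicate_pmf m P)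
      {ys. (\<Sum>x\<in>X. ((\<Sum>y\<leftarrow>ys. f x y) / real m - expect P (f x))\<^sup>2) \<ge> c}
    \<le> V / (real m * c)"
proof -
  let ?R = "replicate_pmf m P"
  have finR: "finite (set_pmf ?R)" by (rule finite_set_replicate_pmf[OF fin])
  have int: "integrable (measure_pmf ?R) h" for h :: "'a list \<Rightarrow> real"
    by (rule integrable_measure_pmf_finite) (rule finR)
  have int': "integrable (measure_pmf P) h" for h :: "'a \<Rightarrow> real"
    by (rule integrable_measure_pmf_finite) (rule fin)
  have sq: "((\<Sum>y\<leftarrow>ys. f x y) / real m - e)\<^sup>2 = ((\<Sum>y\<leftarrow>ys. f x y) - real m * e)\<^sup>2 / (real m)\<^sup>2" for x e ys
  proof -
    have "(\<Sum>y\<leftarrow>ys. f x y) / real m - e = ((\<Sum>y\<leftarrow>ys. f x y) - real m * e) / real m"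
      using m by (simp add: field_simps)
    then show ?thesis by (simp add: power_divide)
  qed
  have "expect ?R (\<lambda>ys. \<Sum>x\<in>X. ((\<Sum>y\<leftarrow>ys. f x y) / real m - expect P (f x))\<^sup>2)
      = (\<Sum>x\<in>X. expect ?R (\<lambda>ys. ((\<Sum>y\<leftarrow>ys. f x y) - real m * expect P (f x))\<^sup>2) / (real m)\<^sup>2)"
    by (simp add: sq int)
  also have "\<dots> \<le> (\<Sum>x\<in>X. (real m * expect P (\<lambda>y. (f x y)\<^sup>2)) / (real m)\<^sup>2)"
    by (intro sum_mono divide_right_mono iid_second_moment[OF fin]) simp
  also have "\<dots> = expect P (\<lambda>y. \<Sum>x\<in>X. (f x y)\<^sup>2) / real m"
    using m by (simp add: int' power2_eq_square sum_divide_distrib)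
  also have "\<dots> \<le> V / real m"
  proof (intro divide_right_mono)
    have "expect P (\<lambda>y. \<Sum>x\<in>X. (f x y)\<^sup>2) \<le> expect P (\<lambda>y. V)"
      using V by (intro integral_mono_AE int' AE_pmfI) auto
    then show "expect P (\<lambda>y. \<Sum>x\<in>X. (f x y)\<^sup>2) \<le> V" by simp
  qed simp
  finally have E: "expect ?R (\<lambda>ys. \<Sum>x\<in>X. ((\<Sum>y\<leftarrow>ys. f x y) / real m - expect P (f x))\<^sup>2) \<le> V / real m" .
  have "prob ?R {ys. (\<Sum>x\<in>X. ((\<Sum>y\<leftarrow>ys. f x y) / real m - expect P (f x))\<^sup>2) \<ge> c}
      \<le> expect ?R (\<lambda>ys. \<Sum>x\<in>X. ((\<Sum>y\<leftarrow>ys. f x y) / real m - expect P (f x))\<^sup>2) / c"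
    by (rule pmf_markov[OF finR _ c]) (simp add: sum_nonneg)
  also have "\<dots> \<le> V / real m / c" using E c by (intro divide_right_mono) auto
  finally show ?thesis by simp
qed

section \<open>Extremes and range of a sample\<close>

lemma prob_replicate_all:
  fixes P :: "'a :: countable pmf"
  shows "prob (replicate_pmf m P) {xs. \<forall>x\<in>set xs. x \<in> A} = prob P A ^ m"
proof (induction m)
  case (Suc m)
  have "replicate_pmf (Suc m) P = map_pmf (\<lambda>(x, xs). x # xs) (pair_pmf P (replicate_pmf m P))"
    by (simp add: pair_pmf_def map_bind_pmf map_pmf_def bind_assoc_pmf bind_return_pmf)
  then have "prob (replicate_pmf (Suc m) P) {xs. \<forall>x\<in>set xs. x \<in> A}
      = prob (pair_pmf P (replicate_pmf m P)) (A \<times> {xs. \<forall>x\<in>set xs. x \<in> A})"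
    by (simp only: measure_map_pmf) (rule arg_cong[where f = "prob _"], auto)
  also have "\<dots> = prob P A * prob (replicate_pmf m P) {xs. \<forall>x\<in>set xs. x \<in> A}"
    by (rule measure_pmf_prob_product) (rule countableI_type)+
  finally show ?case using Suc by simp
qed simp

text \<open>The union bound, read off from the product formula for the complement by Bernoulli's
  inequality.\<close>

lemma prob_replicate_ex_le:
  fixes P :: "'a :: countable pmf"
  shows "prob (replicate_pmf m P) {xs. \<exists>x\<in>set xs. x \<in> A} \<le> real m * prob P A"
proof -
  let ?a = "prob P A"
  have "{xs. \<exists>x\<in>set xs. x \<in> A} = - {xs. \<forall>x\<in>set xs. x \<in> - A}" by auto
  then have "prob (replicate_pmf m P) {xs. \<exists>x\<in>set xs. x \<in> A}
      = 1 - prob P (- A) ^ m"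
    using measure_pmf.prob_compl[of "{xs. \<forall>x\<in>set xs. x \<in> - A}" "replicate_pmf m P"]
      prob_replicate_all[of m P "- A"]
    by (simp add: Compl_eq_Diff_UNIV[symmetric])
  also have "prob P (- A) = 1 + - ?a"
    using measure_pmf.prob_compl[of A P] by (simp add: Compl_eq_Diff_UNIV)
  finally have "prob (replicate_pmf m P) {xs. \<exists>x\<in>set xs. x \<in> A} = 1 - (1 + - ?a) ^ m" .
  moreover have "(1 + - ?a) ^ m \<ge> 1 + real m * (- ?a)"
    by (rule Bernoulli_inequality) simp
  ultimately show ?thesis by linarith
qed

text \<open>The law has atoms, so there may be no point that splits off mass exactly
  \<open>\<delta>\<close>. The least q with mass at least \<open>\<delta>\<close> up to and
  including q satisfies both inequalities.\<close>

lemma lower_quantile: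
  fixes P :: "nat pmf"
  assumes "set_pmf P \<subseteq> {..b}" "0 \<le> \<delta>" "\<delta> \<le> 1"
  obtains q where "prob P {x. x < q} \<le> \<delta>" "prob P {x. x \<le> q} \<ge> \<delta>"
proof -
  define Q where "Q = (\<lambda>q. prob P {x. x \<le> q} \<ge> \<delta>)"
  have "prob P {x. x \<le> b} = 1"
    using assms(1) by (intro measure_pmf.prob_eq_1[THEN iffD2]) (auto simp: AE_measure_pmf_iff)
  then have Qb: "Q b" using assms(3) by (simp add: Q_def)
  define q where "q = (LEAST q. Q q)"
  have Qq: "Q q" unfolding q_def using Qb by (rule LeastI)
  have "prob P {x. x < q} \<le> \<delta>"
  proof (cases q)
    case 0
    then show ?thesis using assms(2) by simp
  next
    case (Suc r)
    then have "\<not> Q r" using not_less_Least[of r Q] by (simp add: q_def)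
    moreover have "{x. x < q} = {x. x \<le> r}" using Suc by auto
    ultimately show ?thesis by (simp add: Q_def)
  qed
  then show ?thesis using that Qq by (simp add: Q_def)
qed

lemma prob_mono_supp:
  assumes "\<And>x. x \<in> set_pmf P \<Longrightarrow> x \<in> A \<Longrightarrow> x \<in> B"
  shows "prob P A \<le> prob P B"
  using assms by (intro measure_pmf.finite_measure_mono_AE AE_pmfI) auto

lemma upper_quantile:
  fixes P :: "nat pmf"
  assumes supp: "set_pmf P \<subseteq> {..b}" and d: "0 \<le> \<delta>" "\<delta> \<le> 1"
  obtains q where "prob P {x. x > q} \<le> \<delta>" "prob P {x. x \<ge> q} \<ge> \<delta>"
proof -
  \<comment> \<open>Reflecting the support \<open>{..b}\<close> turns upper quantiles into lower
    ones.\<close>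
  let ?R = "map_pmf (\<lambda>x. b - x) P"
  obtain q where q: "prob ?R {x. x < q} \<le> \<delta>" "prob ?R {x. x \<le> q} \<ge> \<delta>"
    by (rule lower_quantile[of ?R b \<delta>]) (use d in auto)
  show ?thesis
  proof (rule that[of "b - q"])
    have "prob P {x. x > b - q} \<le> prob P {x. b - x < q}"
      using supp by (intro prob_mono_supp) auto
    then show "prob P {x. x > b - q} \<le> \<delta>" using q(1) by (simp add: vimage_def)
    have "prob P {x. b - x \<le> q} \<le> prob P {x. x \<ge> b - q}"
      by (intro prob_mono_supp) auto
    then show "prob P {x. x \<ge> b - q} \<ge> \<delta>" using q(2) by (simp add: vimage_def)
  qed
qed

text \<open>The fold starts at b, an upper bound of the support, and that of \<open>range_hi\<close>
  at 0; these are the contents of the two registers before the scan.\<close>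

definition range_lo :: "nat \<Rightarrow> nat list \<Rightarrow> nat" where
  "range_lo b xs = fold min xs b"

definition range_hi :: "nat list \<Rightarrow> nat" where
  "range_hi xs = fold max xs 0"

lemma range_lo_eq: "range_lo b xs = Min (insert b (set xs))"
  unfolding range_lo_def by (simp flip: Min.set_eq_fold)

lemma range_hi_eq: "range_hi xs = Max (insert 0 (set xs))"
  unfolding range_hi_def by (simp flip: Max.set_eq_fold)

text \<open>Failure needs one of three events: all samples exceed the lower quantile, all samples
  are below the upper quantile, or some sample is an outlier at distance at least t from
  \<open>\<mu>\<close>. The first two cost \<open>(1 - \<delta>) ^ m\<close> each, the third a union
  bound.\<close>

lemma sample_range:
  fixes P :: "nat pmf"
  assumes supp: "set_pmf P \<subseteq> {..b}" and d: "0 \<le> \<delta>" "\<delta> \<le> 1" and m: "m > 0"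
    and tail: "prob P {x. \<bar>real x - \<mu>\<bar> \<ge> t} \<le> \<eta>"
  shows "prob (replicate_pmf m P)
      {xs. \<not> (prob P {range_lo b xs..range_hi xs} \<ge> 1 - 2 * \<delta> \<and>
              range_lo b xs \<le> range_hi xs \<and> real (range_hi xs - range_lo b xs) \<le> 2 * t)}
    \<le> 2 * (1 - \<delta>) ^ m + real m * \<eta>"
proof -
  obtain p where p: "prob P {x. x < p} \<le> \<delta>" "prob P {x. x \<le> p} \<ge> \<delta>"
    by (rule lower_quantile[OF supp d])
  obtain q where q: "prob P {x. x > q} \<le> \<delta>" "prob P {x. x \<ge> q} \<ge> \<delta>"
    by (rule upper_quantile[OF supp d])
  let ?R = "replicate_pmf m P"
  define A where "A = {xs. \<forall>x\<in>set xs. x \<in> - {x. x \<le> p}}"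
  define B where "B = {xs. \<forall>x\<in>set xs. x \<in> - {x. x \<ge> q}}"
  define C where "C = {xs. \<exists>x\<in>set xs. x \<in> {x. \<bar>real x - \<mu>\<bar> \<ge> t}}"
  have compl: "prob P (- S) = 1 - prob P S" for S
    using measure_pmf.prob_compl[of S P] by (simp add: Compl_eq_Diff_UNIV)
  have A: "prob ?R A \<le> (1 - \<delta>) ^ m"
    unfolding A_def prob_replicate_all compl using p(2) by (intro power_mono) auto
  have B: "prob ?R B \<le> (1 - \<delta>) ^ m"
    unfolding B_def prob_replicate_all compl using q(2) by (intro power_mono) auto
  have "prob ?R C \<le> real m * prob P {x. \<bar>real x - \<mu>\<bar> \<ge> t}"
    unfolding C_def by (rule prob_replicate_ex_le)
  also have "\<dots> \<le> real m * \<eta>" using tail by (intro mult_left_mono) auto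
  finally have C: "prob ?R C \<le> real m * \<eta>" .
  have "prob ?R
      {xs. \<not> (prob P {range_lo b xs..range_hi xs} \<ge> 1 - 2 * \<delta> \<and>
              range_lo b xs \<le> range_hi xs \<and> real (range_hi xs - range_lo b xs) \<le> 2 * t)}
    \<le> prob ?R ((A \<union> B) \<union> C)"
  proof (rule prob_mono_supp, rule ccontr)
    fix xs
    assume xs: "xs \<in> set_pmf ?R" and bad: "xs \<in> {xs. \<not> (prob P {range_lo b xs..range_hi xs} \<ge> 1 - 2 * \<delta> \<and>
        range_lo b xs \<le> range_hi xs \<and> real (range_hi xs - range_lo b xs) \<le> 2 * t)}"
      and good: "xs \<notin> A \<union> B \<union> C"
    have le: "x \<le> b" if "x \<in> set xs" for x using xs that supp by (auto simp: set_replicate_pmf)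
    have "length xs = m" using xs by (simp add: set_replicate_pmf)
    then have ne: "set xs \<noteq> {}" using m by auto
    define lo where "lo = range_lo b xs"
    define hi where "hi = range_hi xs"
    have lo: "lo \<le> x" "x \<le> hi" if "x \<in> set xs" for x
      using that by (auto simp: lo_def hi_def range_lo_eq range_hi_eq)
    have "lo \<in> insert b (set xs)" "hi \<in> insert 0 (set xs)"
      unfolding lo_def hi_def range_lo_eq range_hi_eq by (rule Min_in Max_in; simp)+
    then have mem: "lo \<in> set xs" "hi \<in> set xs"
    proof -
      obtain x0 where x0: "x0 \<in> set xs" using ne by (cases xs) auto
      \<comment> \<open>If the minimum equals the start value b, then every sample equals b, as none
        exceeds b; the maximum is treated likewise with 0.\<close>
      have "lo = b \<Longrightarrow> x0 = lo" "hi = 0 \<Longrightarrow> x0 = hi" using lo[OF x0] le[OF x0] by linarith+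
      then show "lo \<in> set xs" "hi \<in> set xs"
        using x0 \<open>lo \<in> insert b (set xs)\<close> \<open>hi \<in> insert 0 (set xs)\<close> by blast+
    qed
    then have lohi: "lo \<le> hi" using lo by blast
    have "lo \<le> p" using good lo by (force simp: A_def)
    then have l: "prob P {x. x < lo} \<le> \<delta>"
      by (intro order.trans[OF _ p(1)] measure_pmf.finite_measure_mono) auto
    have "q \<le> hi" using good lo by (force simp: B_def)
    then have u: "prob P {x. x > hi} \<le> \<delta>"
      by (intro order.trans[OF _ q(1)] measure_pmf.finite_measure_mono) auto
    have "{lo..hi} = - ({x. x < lo} \<union> {x. x > hi})" by auto
    then have "prob P {lo..hi} = 1 - prob P ({x. x < lo} \<union> {x. x > hi})"
      by (simp only: compl)
    moreover have "prob P ({x. x < lo} \<union> {x. x > hi}) \<le> prob P {x. x < lo} + prob P {x. x > hi}"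
      by (rule measure_Un_le) simp_all
    ultimately have "prob P {lo..hi} \<ge> 1 - 2 * \<delta>" using l u by linarith
    moreover have "real (hi - lo) \<le> 2 * t"
    proof -
      have "\<bar>real lo - \<mu>\<bar> < t" "\<bar>real hi - \<mu>\<bar> < t" using good mem by (auto simp: C_def)
      then show ?thesis using lohi by (simp add: of_nat_diff)
    qed
    ultimately show False using bad lohi by (simp add: lo_def hi_def)
  qed
  also have "\<dots> \<le> (prob ?R A + prob ?R B) + prob ?R C"
    by (intro order.trans[OF measure_Un_le] add_right_mono measure_Un_le) simp_all
  also have "\<dots> \<le> 2 * (1 - \<delta>) ^ m + real m * \<eta>" using A B C by linarith
  finally show ?thesis .
qed

section \<open>Spectral concentration and the kernel estimator\<close>

text \<open>For \<open>2 * D < N\<close> these are the integers of absolute value at most D.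
  Otherwise the \<open>min\<close> leaves N consecutive integers, a full residue system, and the
  projection becomes the identity.\<close>

definition freqs :: "nat \<Rightarrow> nat \<Rightarrow> int set" where
  "freqs N D = {- int D..min (int D) (int N - int D - 1)}"

text \<open>Representatives modulo \<open>L * N\<close> of the frequencies within D of a multiple of
  N. For \<open>\<theta> = 2 * pi * b / (L * N)\<close>, it is near the multiples of N that
  \<open>sin (L * \<theta> / 2)\<close> is small and the decay bound weak.\<close>

definition spectrum :: "nat \<Rightarrow> nat \<Rightarrow> nat \<Rightarrow> int set" where
  "spectrum L N D = (\<lambda>(\<beta>, d). \<beta> * int N + d) ` ({0..<int L} \<times> freqs N D)"

lemma finite_freqs [simp]: "finite (freqs N D)"
  by (simp add: freqs_def)

lemma card_freqs_le: "card (freqs N D) \<le> 2 * D + 1"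
proof -
  have "card (freqs N D) \<le> card {- int D..int D}"
    by (rule card_mono) (auto simp: freqs_def)
  then show ?thesis by simp
qed

lemma spectrum_subset:
  assumes "M = L * N"
  shows "spectrum L N D \<subseteq> {- int D..< - int D + int M}"
proof
  fix b assume "b \<in> spectrum L N D"
  then obtain \<beta> d where b: "b = \<beta> * int N + d" "0 \<le> \<beta>" "\<beta> < int L" "- int D \<le> d" "d \<le> int N - int D - 1"
    by (auto simp: spectrum_def freqs_def)
  have "\<beta> * int N \<le> (int L - 1) * int N" using b by (intro mult_right_mono) auto
  then have "\<beta> * int N \<le> int M - int N" by (simp add: assms left_diff_distrib)
  moreover have "0 \<le> \<beta> * int N" using b by simp
  ultimately show "b \<in> {- int D..< - int D + int M}"
    using b(1,4,5) unfolding atLeastLessThan_iff by linarith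
qed

lemma card_spectrum_le: "card (spectrum L N D) \<le> L * (2 * D + 1)"
proof -
  have "card (spectrum L N D) \<le> card ({0..<int L} \<times> freqs N D)"
    unfolding spectrum_def by (rule card_image_le) simp
  also have "\<dots> = L * card (freqs N D)" by (simp add: card_cartesian_product)
  also have "\<dots> \<le> L * (2 * D + 1)" using card_freqs_le by (rule mult_le_mono2)
  finally show ?thesis .
qed

lemma spectrum_compl:
  assumes "N > 0" "M = L * N"
  shows "{- int D..< - int D + int M} - spectrum L N D
    \<subseteq> (\<lambda>(\<beta>, d). \<beta> * int N + int d) ` ({0..<int L} \<times> {d. D < d \<and> d < N - D})"
proof
  fix b assume b: "b \<in> {- int D..< - int D + int M} - spectrum L N D"
  \<comment> \<open>Shifting by D before the division puts the remainder into
    \<open>[- D, N - D)\<close>, so that a frequency slightly below a multiple of N is assigned to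
    that multiple.\<close>
  define \<beta> where "\<beta> = (b + int D) div int N"
  define d where "d = (b + int D) mod int N - int D"
  have eq: "b = \<beta> * int N + d" unfolding \<beta>_def d_def using div_mult_mod_eq[of "b + int D" "int N"] by linarith
  have range: "0 \<le> b + int D" "b + int D < int L * int N" using b assms by auto
  have beta: "\<beta> \<in> {0..<int L}"
  proof -
    have "\<beta> * int N + (b + int D) mod int N = b + int D"
      unfolding \<beta>_def by (rule div_mult_mod_eq)
    moreover have "(b + int D) mod int N \<ge> 0" using assms(1) by simp
    ultimately have "\<beta> * int N < int L * int N" using range by linarith
    then have "\<beta> < int L" using assms(1) by simp
    moreover have "0 \<le> \<beta>" using range assms(1) by (simp add: \<beta>_def pos_imp_zdiv_nonneg_iff)
    ultimately show ?thesis by simp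
  qed
  have d: "- int D \<le> d" "d < int N - int D"
    using assms(1) by (auto simp: d_def)
  have "d \<notin> freqs N D" using b eq beta by (auto simp: spectrum_def)
  then have "d > int D" using d by (auto simp: freqs_def)
  then have "nat d \<in> {d. D < d \<and> d < N - D}" "int (nat d) = d" using d by auto
  then show "b \<in> (\<lambda>(\<beta>, d). \<beta> * int N + int d) ` ({0..<int L} \<times> {d. D < d \<and> d < N - D})"
    using beta eq by (intro image_eqI[of _ _ "(\<beta>, nat d)"]) auto
qed

lemma sin_ge_half:
  fixes x :: real
  assumes "0 \<le> x" "x \<le> pi / 2"
  shows "x / 2 \<le> sin x"
proof -
  \<comment> \<open>This makes the Taylor remainder \<open>x^3 / 6\<close> at most
    \<open>x / 2\<close>.\<close>
  have x2: "x\<^sup>2 \<le> 3"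
  proof -
    have "x \<le> 1.7" using assms pi_approx by simp
    then have "x\<^sup>2 \<le> 1.7\<^sup>2" using assms by (intro power_mono) auto
    then show ?thesis by (simp add: power2_eq_square)
  qed
  have "\<bar>sin x - (\<Sum>m<3. sin_coeff m * x ^ m)\<bar> \<le> inverse (fact 3) * \<bar>x\<bar> ^ 3"
    by (rule Maclaurin_sin_bound)
  moreover have "(\<Sum>m<3. sin_coeff m * x ^ m) = x"
    by (simp add: sin_coeff_def eval_nat_numeral)
  moreover have "inverse (fact 3) * \<bar>x\<bar> ^ 3 = x * x\<^sup>2 / 6"
    using assms by (simp add: fact_numeral power3_eq_cube power2_eq_square)
  moreover have "x * x\<^sup>2 \<le> x * 3" using assms x2 by (intro mult_left_mono) auto
  ultimately show ?thesis by linarith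
qed

text \<open>Reflecting d to \<open>N - d\<close> leaves the sine unchanged and moves the angle into
  \<open>[0, pi / 2]\<close>. There \<open>sin_ge_half\<close> gives the factor
  \<open>(pi / 2)^2\<close>, which is rounded down to 2.\<close>

lemma sin_sq_ge:
  fixes d N :: nat
  assumes "0 < d" "d < N"
  shows "2 * (real (min d (N - d)) / real N)\<^sup>2 \<le> (sin (pi * real d / real N))\<^sup>2"
proof -
  define \<mu> where "\<mu> = min d (N - d)"
  have N: "real N > 0" using assms by auto
  have eq: "sin (pi * real d / real N) = sin (pi * real \<mu> / real N)"
  proof (cases "d \<le> N - d")
    case False
    then have "pi * real \<mu> / real N = pi - pi * real d / real N"
      using assms N by (simp add: \<mu>_def min_def of_nat_diff field_simps)
    then show ?thesis by simp
  qed (simp add: \<mu>_def min_def)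
  have "2 * \<mu> \<le> N" using assms by (auto simp: \<mu>_def min_def)
  then have "2 * real \<mu> \<le> real N" by linarith
  then have "pi * real \<mu> / real N \<le> pi / 2" using N by (simp add: field_simps)
  then have s: "pi * real \<mu> / real N / 2 \<le> sin (pi * real \<mu> / real N)"
    using N by (intro sin_ge_half) auto
  have "2 * (real \<mu> / real N)\<^sup>2 \<le> (pi / 2)\<^sup>2 * (real \<mu> / real N)\<^sup>2"
  proof (intro mult_right_mono)
    have "(3 / 2)\<^sup>2 \<le> (pi / 2)\<^sup>2" using pi_approx by (intro power_mono) auto
    then show "2 \<le> (pi / 2)\<^sup>2" by (simp add: power2_eq_square)
  qed auto
  also have "\<dots> = (pi * real \<mu> / real N / 2)\<^sup>2" by (simp add: power_divide power_mult_distrib)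
  also have "\<dots> \<le> (sin (pi * real \<mu> / real N))\<^sup>2" using s N by (intro power_mono) auto
  finally show ?thesis by (simp add: eq \<mu>_def)
qed

lemma exp_tail_sum: "(\<Sum>d\<in>{D<..n}. exp (- 4 * real d)) \<le> exp (- 4 * real D)"
proof -
  \<comment> \<open>The subtracted term makes the induction telescope: as
    \<open>exp (- 4) \<le> 1 / 2\<close>, each summand is at most the increase of the bound.\<close>
  have "(\<Sum>d\<in>{D<..D + j}. exp (- 4 * real d)) \<le> exp (- 4 * real D) - exp (- 4 * real (D + j))" for j
  proof (induction j)
    case (Suc j)
    have "exp (- 4 * real (D + Suc j)) = exp (- 4) * exp (- 4 * real (D + j))"
      by (simp flip: exp_add)
    moreover have "exp (- 4 :: real) \<le> 1 / 2"
      using exp_ge_add_one_self[of "4 :: real"] by (simp add: exp_minus field_simps)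
    ultimately have "2 * exp (- 4 * real (D + Suc j)) \<le> exp (- 4 * real (D + j))"
      using mult_right_mono[of "exp (- 4)" "1 / 2" "exp (- 4 * real (D + j))"] by simp
    moreover have "{D<..D + Suc j} = insert (D + Suc j) {D<..D + j}" by auto
    then have "(\<Sum>d\<in>{D<..D + Suc j}. exp (- 4 * real d))
        = exp (- 4 * real (D + Suc j)) + (\<Sum>d\<in>{D<..D + j}. exp (- 4 * real d))"
      by (simp only:) (rule sum.insert, auto)
    ultimately show ?case using Suc by linarith
  qed simp
  from this[of "n - D"] have "(\<Sum>d\<in>{D<..D + (n - D)}. exp (- 4 * real d)) \<le> exp (- 4 * real D)"
    using exp_gt_zero[of "- 4 * real (D + (n - D))"] by linarith
  moreover have "(\<Sum>d\<in>{D<..n}. exp (- 4 * real d)) \<le> (\<Sum>d\<in>{D<..D + (n - D)}. exp (- 4 * real d))"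
    by (intro sum_mono2) (auto simp del: mult_minus_left)
  ultimately show ?thesis by linarith
qed

section \<open>Bias and energy of the spectral kernel estimator\<close>

lemma expectation_mod:
  fixes f :: "nat \<Rightarrow> complex"
  assumes M: "M > 0"
  shows "(\<Sum>y<M. of_real (pmf (map_pmf (\<lambda>x. x mod M) P) y) * f y) = expect P (\<lambda>x. f (x mod M))"
proof -
  have "expect P (\<lambda>x. f (x mod M)) = expect (map_pmf (\<lambda>x. x mod M) P) f"
    by simp
  also have "\<dots> = (\<Sum>y<M. pmf (map_pmf (\<lambda>x. x mod M) P) y *\<^sub>R f y)"
    using M by (intro integral_measure_pmf) auto
  finally show ?thesis by (simp add: scaleR_conv_of_real)
qed

lemma chi_mod: "M > 0 \<Longrightarrow> chi M (b * int (x mod M)) = chi M (b * int x)"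
  by (rule chi_cong) (simp_all add: of_nat_mod flip: right_diff_distrib mod_eq_dvd_iff)

lemma band_kernel_cong:
  assumes "M > 0" "int M dvd z - z'"
  shows "band_kernel M A z = band_kernel M A z'"
  unfolding band_kernel_def using assms
  by (intro arg_cong2[where f = "(/)"] sum.cong refl chi_cong) (simp_all flip: right_diff_distrib)

text \<open>Taking the real part makes the estimator real valued. The target is real, so this does
  not increase the error, and it does not increase the energy either.\<close>

definition est_kernel :: "nat \<Rightarrow> nat \<Rightarrow> nat \<Rightarrow> nat \<Rightarrow> nat \<Rightarrow> real" where
  "est_kernel L N D x y = Re (band_kernel (L * N) (spectrum L N D) (int y - int x))"

lemma est_kernel_energy:
  assumes "L > 0" "N > 0"
  shows "(\<Sum>x<L * N. (est_kernel L N D x y)\<^sup>2) \<le> real (L * (2 * D + 1)) / real (L * N)"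
proof -
  have M: "L * N > 0" using assms by simp
  have "(\<Sum>x<L * N. (est_kernel L N D x y)\<^sup>2)
      \<le> (\<Sum>x<L * N. (norm (band_kernel (L * N) (spectrum L N D) (int y - int x)))\<^sup>2)"
    by (intro sum_mono) (simp add: est_kernel_def cmod_power2)
  also have "\<dots> = real (card (spectrum L N D)) / real (L * N)"
    by (rule band_kernel_energy[OF M spectrum_subset]) simp
  also have "\<dots> \<le> real (L * (2 * D + 1)) / real (L * N)"
    by (intro divide_right_mono of_nat_mono card_spectrum_le) simp
  finally show ?thesis .
qed

text \<open>The bias is the Fourier mass outside the spectrum. These frequencies keep a distance of
  more than D from the multiples of N on both sides, hence the two exponentials in
  \<open>decay\<close>; each of the L gaps contributes two geometric series.\<close>

lemma est_kernel_bias: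
  fixes P :: "nat pmf"
  assumes fin: "finite (set_pmf P)" and L: "L > 0" and N: "N > 0"
    and decay: "\<And>\<beta> d. D < d \<Longrightarrow> d < N - D \<Longrightarrow>
      (norm (expect P (\<lambda>x. chi (L * N) ((\<beta> * int N + int d) * int x))))\<^sup>2
        \<le> c * (exp (- 4 * real d) + exp (- 4 * real (N - d)))"
    and c: "c \<ge> 0"
  shows "real (L * N) * (\<Sum>x<L * N. (pmf (map_pmf (\<lambda>x. x mod (L * N)) P) x - expect P (est_kernel L N D x))\<^sup>2)
    \<le> real L * (2 * c * exp (- 4 * real D))"
proof -
  define M where "M = L * N"
  have M: "M > 0" using L N by (simp add: M_def)
  let ?A = "spectrum L N D" and ?p = "\<lambda>x. pmf (map_pmf (\<lambda>x. x mod M) P) x"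
  let ?c = "- int D"
  have int: "integrable (measure_pmf P) h" for h :: "nat \<Rightarrow> complex"
    by (rule integrable_measure_pmf_finite) (rule fin)
  have kernel: "(\<Sum>y<M. of_real (?p y) * band_kernel M ?A (int y - int x))
      = expect P (\<lambda>y. band_kernel M ?A (int y - int x))" for x
    unfolding expectation_mod[OF M]
    by (intro arg_cong[where f = "expect P"] ext band_kernel_cong M)
       (simp add: of_nat_mod flip: mod_eq_dvd_iff)
  have trans: "(\<Sum>y<M. of_real (?p y) * chi M (b * int y)) = expect P (\<lambda>x. chi M (b * int x))" for b
    unfolding expectation_mod[OF M] by (simp add: chi_mod[OF M])
  have "real M * (\<Sum>x<M. (?p x - expect P (est_kernel L N D x))\<^sup>2)
     \<le> real M * (\<Sum>x<M. (norm (of_real (?p x) - (\<Sum>y<M. of_real (?p y) * band_kernel M ?A (int y - int x))))\<^sup>2)"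
  proof (intro mult_left_mono sum_mono)
    fix x
    have "expect P (est_kernel L N D x) = Re (expect P (\<lambda>y. band_kernel M ?A (int y - int x)))"
      unfolding est_kernel_def M_def[symmetric] by (rule integral_Re) (rule int)
    then have eq: "?p x - expect P (est_kernel L N D x)
        = Re (of_real (?p x) - (\<Sum>y<M. of_real (?p y) * band_kernel M ?A (int y - int x)))"
      unfolding kernel by simp
    show "(?p x - expect P (est_kernel L N D x))\<^sup>2
        \<le> (norm (of_real (?p x) - (\<Sum>y<M. of_real (?p y) * band_kernel M ?A (int y - int x))))\<^sup>2"
      unfolding eq cmod_power2 by simp
  qed simp
  also have "\<dots> = (\<Sum>b\<in>{?c..<?c + int M} - ?A. (norm (\<Sum>y<M. of_real (?p y) * chi M (b * int y)))\<^sup>2)"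
    using band_kernel_bias[OF M spectrum_subset[OF M_def], of "\<lambda>x. of_real (?p x)"] by simp
  also have "\<dots> = (\<Sum>b\<in>{?c..<?c + int M} - ?A. (norm (expect P (\<lambda>x. chi M (b * int x))))\<^sup>2)"
    by (simp only: trans)
  also have "\<dots> \<le> (\<Sum>b\<in>(\<lambda>(\<beta>, d). \<beta> * int N + int d) ` ({0..<int L} \<times> {d. D < d \<and> d < N - D}).
      (norm (expect P (\<lambda>x. chi M (b * int x))))\<^sup>2)"
    by (intro sum_mono2 spectrum_compl[OF N M_def]) auto
  also have "\<dots> \<le> (\<Sum>(\<beta>, d)\<in>{0..<int L} \<times> {d. D < d \<and> d < N - D}.
      (norm (expect P (\<lambda>x. chi M ((\<beta> * int N + int d) * int x))))\<^sup>2)"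
    by (rule order.trans[OF sum_image_le]) (auto simp: case_prod_unfold o_def)
  also have "\<dots> \<le> (\<Sum>(\<beta>, d)\<in>{0..<int L} \<times> {d. D < d \<and> d < N - D}.
      c * (exp (- 4 * real d) + exp (- 4 * real (N - d))))"
  proof (intro sum_mono, clarify)
    fix \<beta> d assume "D < d" "d < N - D"
    then show "(norm (expect P (\<lambda>x. chi M ((\<beta> * int N + int d) * int x))))\<^sup>2
      \<le> c * (exp (- 4 * real d) + exp (- 4 * real (N - d)))"
      unfolding M_def by (rule decay)
  qed
  also have "\<dots> = real L * (c * ((\<Sum>d | D < d \<and> d < N - D. exp (- 4 * real d)) + (\<Sum>d | D < d \<and> d < N - D. exp (- 4 * real (N - d)))))"
    by (simp add: sum.cartesian_product[symmetric] sum_distrib_left[symmetric] sum.distrib del: mult_minus_left)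
  \<comment> \<open>The reflection of d to \<open>N - d\<close> exchanges the two sides of a
    gap.\<close>
  also have "(\<Sum>d | D < d \<and> d < N - D. exp (- 4 * real (N - d))) = (\<Sum>d | D < d \<and> d < N - D. exp (- 4 * real d))"
    by (rule sum.reindex_bij_witness[of _ "\<lambda>d. N - d" "\<lambda>d. N - d"]) auto
  also have "real L * (c * ((\<Sum>d | D < d \<and> d < N - D. exp (- 4 * real d)) + (\<Sum>d | D < d \<and> d < N - D. exp (- 4 * real d))))
      \<le> real L * (c * (exp (- 4 * real D) + exp (- 4 * real D)))"
  proof -
    have "(\<Sum>d | D < d \<and> d < N - D. exp (- 4 * real d)) \<le> (\<Sum>d\<in>{D<..N}. exp (- 4 * real d))"
      by (intro sum_mono2) auto
    also have "\<dots> \<le> exp (- 4 * real D)" by (rule exp_tail_sum)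
    finally show ?thesis using c by (intro mult_left_mono add_mono) auto
  qed
  also have "\<dots> = real L * (2 * c * exp (- 4 * real D))" by simp
  finally show ?thesis unfolding M_def .
qed

section \<open>Closed form of the kernel and its approximation on blocks\<close>

lemma chi_scale:
  assumes "c > 0"
  shows "chi (c * N) (int c * z) = chi N z"
proof -
  have "2 * pi * of_int (int c * z) / of_nat (c * N) = 2 * pi * of_int z / of_nat N"
    using assms by simp
  then show ?thesis by (simp only: chi_def)
qed

lemma spectrum_inj:
  assumes "N > 0"
  shows "inj_on (\<lambda>(\<beta>, d). \<beta> * int N + d) ({0..<int L} \<times> freqs N D)"
proof (rule inj_onI, clarify)
  fix \<beta> d \<beta>' d'
  assume d: "d \<in> freqs N D" "d' \<in> freqs N D" and eq: "\<beta> * int N + d = \<beta>' * int N + d'"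
  have "d - d' = (\<beta>' - \<beta>) * int N" using eq by (simp add: left_diff_distrib)
  then have "int N dvd d - d'" by simp
  then have "d = d'"
    using d by (subst (asm) dvd_diff_interval[of _ "- int D"]) (auto simp: freqs_def)
  with eq assms show "\<beta> = \<beta>' \<and> d = d'" by simp
qed

text \<open>The spectrum is indexed by a product set, so the character sum factors: the sum over the
  multiples of N vanishes unless L divides z, and what remains is the sum over \<open>freqs\<close>.
  Hence the kernel never mixes residue classes modulo L.\<close>

lemma band_kernel_spectrum:
  assumes "L > 0" "N > 0"
  shows "band_kernel (L * N) (spectrum L N D) z
    = (if int L dvd z then (\<Sum>d\<in>freqs N D. chi N (d * (z div int L))) / of_nat N else 0)"
proof -
  let ?M = "L * N"
  have "(\<Sum>a\<in>spectrum L N D. chi ?M (a * z))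
      = (\<Sum>(\<beta>, d)\<in>{0..<int L} \<times> freqs N D. chi ?M ((\<beta> * int N + d) * z))"
    unfolding spectrum_def by (subst sum.reindex[OF spectrum_inj[OF assms(2)]]) (simp add: case_prod_unfold o_def)
  also have "\<dots> = (\<Sum>(\<beta>, d)\<in>{0..<int L} \<times> freqs N D. chi L (\<beta> * z) * chi ?M (d * z))"
  proof (intro sum.cong refl, clarify)
    fix \<beta> d
    have "chi ?M ((\<beta> * int N + d) * z) = chi ?M (int N * (\<beta> * z)) * chi ?M (d * z)"
      by (simp flip: chi_add add: algebra_simps)
    then show "chi ?M ((\<beta> * int N + d) * z) = chi L (\<beta> * z) * chi ?M (d * z)"
      using chi_scale[OF assms(2), of L "\<beta> * z"] by (simp add: mult.commute)
  qed
  also have "\<dots> = (\<Sum>\<beta>\<in>{0..<0 + int L}. chi L (\<beta> * z)) * (\<Sum>d\<in>freqs N D. chi ?M (d * z))"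
    by (simp add: sum_product sum.cartesian_product)
  also have "(\<Sum>\<beta>\<in>{0..<0 + int L}. chi L (\<beta> * z)) = (if int L dvd z then of_nat L else 0)"
    by (rule sum_chi_interval[OF assms(1)])
  finally have sum: "(\<Sum>a\<in>spectrum L N D. chi ?M (a * z))
      = (if int L dvd z then of_nat L else 0) * (\<Sum>d\<in>freqs N D. chi ?M (d * z))" .
  show ?thesis
  proof (cases "int L dvd z")
    case True
    then obtain w where z: "z = int L * w" by blast
    have "chi ?M (d * z) = chi N (d * w)" for d
      using chi_scale[OF assms(1), of N "d * w"] by (simp add: z mult_ac)
    then show ?thesis
      using True assms unfolding band_kernel_def sum by (simp add: z)
  qed (simp add: band_kernel_def sum)
qed

text \<open>A Dirichlet kernel divided by its period.\<close>

definition low_pass :: "nat \<Rightarrow> nat \<Rightarrow> int \<Rightarrow> real" where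
  "low_pass h D w = (\<Sum>d\<in>freqs h D. cos (2 * pi * of_int (d * w) / real h)) / real h"

lemma est_kernel_eq:
  assumes "L > 0" "N > 0"
  shows "est_kernel L N D x y
    = (if int L dvd int y - int x then low_pass N D ((int y - int x) div int L) else 0)"
  unfolding est_kernel_def band_kernel_spectrum[OF assms] low_pass_def
  by (auto simp: chi_def Re_divide_of_nat)

lemma abs_cos_diff_le: "\<bar>cos a - cos b\<bar> \<le> \<bar>a - b\<bar>" for a b :: real
proof -
  have "cos a - cos b = 2 * sin ((a + b) / 2) * sin ((b - a) / 2)" by (rule cos_diff_cos)
  then have "\<bar>cos a - cos b\<bar> = 2 * (\<bar>sin ((a + b) / 2)\<bar> * \<bar>sin ((b - a) / 2)\<bar>)"
    by (simp add: abs_mult)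
  also have "\<dots> \<le> 2 * (1 * \<bar>(b - a) / 2\<bar>)"
    by (intro mult_left_mono mult_mono abs_sin_le_one abs_sin_x_le_abs_x) auto
  finally show ?thesis by simp
qed

text \<open>For \<open>2 * D < h\<close> both frequency sets are \<open>{- D..D}\<close>, and a
  cosine of period \<open>g * h\<close> at a multiple of g is a cosine of period h. So the values at
  block ends depend on g only through a factor and can be tabulated before the window is
  known.\<close>

lemma low_pass_rescale:
  assumes "g > 0" "h > 0" "g = 1 \<or> 2 * D < h"
  shows "low_pass (g * h) D (int g * w) = low_pass h D w / real g"
proof -
  have "freqs (g * h) D = freqs h D"
  proof (cases "g = 1")
    case False
    then have h: "2 * D < h" using assms by simp
    have "h \<le> g * h" using assms by simp
    then have "2 * D < g * h" using h by linarith
    then have "min (int D) (int (g * h) - int D - 1) = int D" "min (int D) (int h - int D - 1) = int D"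
      using h by (auto simp del: of_nat_mult)
    then show ?thesis unfolding freqs_def by (simp only:)
  qed simp
  moreover have "2 * pi * of_int (d * (int g * w)) / real (g * h) = 2 * pi * of_int (d * w) / real h" for d
    using assms by simp
  ultimately show ?thesis unfolding low_pass_def by (simp only:) (simp add: mult.commute)
qed

text \<open>Each cosine has slope at most \<open>2 * pi * D / N\<close>, and there are at most
  \<open>2 * D + 1\<close> of them.\<close>

lemma low_pass_lipschitz:
  assumes "N > 0"
  shows "\<bar>low_pass N D w - low_pass N D w'\<bar> \<le> real (2 * D + 1) * (2 * pi * real D * \<bar>of_int (w - w')\<bar> / real N) / real N"
proof -
  have "\<bar>low_pass N D w - low_pass N D w'\<bar>
      = \<bar>\<Sum>d\<in>freqs N D. cos (2 * pi * of_int (d * w) / real N) - cos (2 * pi * of_int (d * w') / real N)\<bar> / real N"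
    by (simp add: low_pass_def sum_subtractf flip: diff_divide_distrib)
  also have "\<dots> \<le> (\<Sum>d\<in>freqs N D. 2 * pi * real D * \<bar>of_int (w - w')\<bar> / real N) / real N"
  proof (intro divide_right_mono order.trans[OF sum_abs] sum_mono)
    fix d assume d: "d \<in> freqs N D"
    have "\<bar>cos (2 * pi * of_int (d * w) / real N) - cos (2 * pi * of_int (d * w') / real N)\<bar>
        \<le> \<bar>2 * pi * of_int (d * w) / real N - 2 * pi * of_int (d * w') / real N\<bar>"
      by (rule abs_cos_diff_le)
    also have "2 * pi * of_int (d * w) / real N - 2 * pi * of_int (d * w') / real N
        = 2 * pi * of_int d * of_int (w - w') / real N"
      by (simp add: diff_divide_distrib algebra_simps)
    also have "\<bar>\<dots>\<bar> = 2 * pi * \<bar>of_int d\<bar> * \<bar>of_int (w - w')\<bar> / real N"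
      by (simp add: abs_mult)
    also have "\<dots> \<le> 2 * pi * real D * \<bar>of_int (w - w')\<bar> / real N"
      using d by (intro divide_right_mono mult_right_mono mult_left_mono) (auto simp: freqs_def)
    finally show "\<bar>cos (2 * pi * of_int (d * w) / real N) - cos (2 * pi * of_int (d * w') / real N)\<bar>
        \<le> 2 * pi * real D * \<bar>of_int (w - w')\<bar> / real N" .
  qed simp
  also have "\<dots> = real (card (freqs N D)) * (2 * pi * real D * \<bar>of_int (w - w')\<bar> / real N) / real N"
    by simp
  also have "\<dots> \<le> real (2 * D + 1) * (2 * pi * real D * \<bar>of_int (w - w')\<bar> / real N) / real N"
    by (intro divide_right_mono mult_right_mono of_nat_mono card_freqs_le) auto
  finally show ?thesis .
qed

text \<open>With \<open>z = L * t + r\<close> reduced modulo the full period, t enumerates the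
  residue class of r; its blocks consist of g consecutive values of t.\<close>

definition block_index :: "nat \<Rightarrow> nat \<Rightarrow> nat \<Rightarrow> nat \<Rightarrow> nat" where
  "block_index L g h z = (z mod (L * (g * h))) div L div g"

text \<open>Both points are replaced by the first points of their blocks; the factor
  \<open>1 / g\<close> is that of \<open>low_pass_rescale\<close>.\<close>

definition block_kernel :: "nat \<Rightarrow> nat \<Rightarrow> nat \<Rightarrow> nat \<Rightarrow> nat \<Rightarrow> nat \<Rightarrow> real" where
  "block_kernel L g h D x y =
    (if x mod L = y mod L then low_pass h D (int (block_index L g h y) - int (block_index L g h x)) / real g else 0)"

lemma block_kernel_error:
  assumes L: "L > 0" and g: "g > 0" and h: "h > 0" and gh: "g = 1 \<or> 2 * D < h" and x: "x < L * (g * h)"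
  shows "\<bar>est_kernel L (g * h) D x y - block_kernel L g h D x y\<bar>
    \<le> (if x mod L = y mod L then real (2 * D + 1) * (2 * pi * real D * real (g - 1) / real (g * h)) / real (g * h) else 0)"
proof -
  define N where "N = g * h"
  define M where "M = L * N"
  define y' where "y' = y mod M"
  have N: "N > 0" and M: "M > 0" using assms by (auto simp: N_def M_def)
  have dvd_iff: "int L dvd int y - int x \<longleftrightarrow> x mod L = y mod L"
    by (metis mod_eq_dvd_iff of_nat_eq_iff of_nat_mod)
  have est': "est_kernel L N D x y = est_kernel L N D x y'"
    unfolding est_kernel_def M_def[symmetric]
    by (intro arg_cong[where f = Re] band_kernel_cong M) (simp add: y'_def of_nat_mod flip: mod_eq_dvd_iff)
  have y'L: "y' mod L = y mod L" by (simp add: y'_def M_def mod_mult_eq mod_mod_cancel)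
  have dvd_iff': "int L dvd int y' - int x \<longleftrightarrow> x mod L = y' mod L"
    by (metis mod_eq_dvd_iff of_nat_eq_iff of_nat_mod)
  show ?thesis
  proof (cases "x mod L = y mod L")
    case False
    then show ?thesis using L N by (simp add: est_kernel_eq block_kernel_def dvd_iff flip: N_def)
  next
    case True
    define w where "w = int (y' div L) - int (x div L)"
    define w' where "w' = int (y' div L div g) - int (x div L div g)"
    have "int y' = int L * int (y' div L) + int (y' mod L)" "int x = int L * int (x div L) + int (x mod L)"
      by (metis mult_div_mod_eq of_nat_add of_nat_mult)+
    then have "int y' - int x = int L * w" using True y'L by (simp add: w_def right_diff_distrib)
    then have est: "est_kernel L N D x y = low_pass N D w"
      using L by (subst est', subst est_kernel_eq[OF L N]) simp
    have "block_index L g h y = y' div L div g" "block_index L g h x = x div L div g"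
      using x by (simp_all add: block_index_def y'_def M_def N_def)
    then have blk: "block_kernel L g h D x y = low_pass N D (int g * w')"
      using True low_pass_rescale[OF g h gh] by (simp add: block_kernel_def w'_def N_def)
    \<comment> \<open>Both offsets within the blocks lie between 0 and \<open>g - 1\<close>, so the
      argument changes by at most \<open>g - 1\<close> and not by twice as much.\<close>
    have "\<bar>w - int g * w'\<bar> \<le> int (g - 1)"
    proof -
      have "int (t div g) * int g + int (t mod g) = int t" for t
        by (metis div_mult_mod_eq of_nat_add of_nat_mult)
      from this[of "y' div L"] this[of "x div L"]
      have "w - int g * w' = int (y' div L mod g) - int (x div L mod g)"
        by (simp add: w_def w'_def algebra_simps)
      moreover have "y' div L mod g \<le> g - 1" "x div L mod g \<le> g - 1"
        using g by (simp_all add: less_Suc_eq_le[symmetric])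
      ultimately show ?thesis by linarith
    qed
    then have "\<bar>real_of_int (w - int g * w')\<bar> \<le> real (g - 1)" by linarith
    then have "real (2 * D + 1) * (2 * pi * real D * \<bar>of_int (w - int g * w')\<bar> / real N) / real N
      \<le> real (2 * D + 1) * (2 * pi * real D * real (g - 1) / real N) / real N"
      by (intro divide_right_mono mult_left_mono) auto
    then show ?thesis
      using low_pass_lipschitz[OF N, of D w "int g * w'"] True est blk by (simp flip: N_def)
  qed
qed

section \<open>Total error of the block estimator\<close>

lemma card_residue_class_le: "card {x. x < L * N \<and> x mod L = r} \<le> N"
proof -
  have "{x. x < L * N \<and> x mod L = r} \<subseteq> (\<lambda>t. L * t + r) ` {..<N}"
  proof clarify
    fix x assume "x < L * N"
    then have "x div L < N" by (simp add: less_mult_imp_div_less mult.commute)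
    then show "x \<in> (\<lambda>t. L * t + x mod L) ` {..<N}" by (intro image_eqI[of _ _ "x div L"]) auto
  qed
  then show ?thesis using surj_card_le[of "{..<N}" _ "\<lambda>t. L * t + r"] by simp
qed

text \<open>The Cauchy-Schwarz inequality; the factor M in the hypothesis is the one that Plancherel
  supplies.\<close>

lemma sum_abs_le_sqrt:
  fixes a :: "nat \<Rightarrow> real"
  assumes "real M * (\<Sum>x<M. (a x)\<^sup>2) \<le> b"
  shows "(\<Sum>x<M. \<bar>a x\<bar>) \<le> sqrt b"
proof (rule real_le_rsqrt)
  have "(\<Sum>x<M. \<bar>a x\<bar>)\<^sup>2 \<le> (\<Sum>x<M. \<bar>a x\<bar>\<^sup>2) * real (card {..<M})"
    by (rule sum_squared_le_sum_of_squares)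
  then show "(\<Sum>x<M. \<bar>a x\<bar>)\<^sup>2 \<le> b" using assms by (simp add: mult.commute)
qed

lemma sum_list_average_diff_le:
  fixes a b :: "nat \<Rightarrow> 'a \<Rightarrow> real"
  assumes "\<And>y. y \<in> set ys \<Longrightarrow> (\<Sum>x<M. \<bar>a x y - b x y\<bar>) \<le> e" "ys \<noteq> []"
  shows "(\<Sum>x<M. \<bar>(\<Sum>y\<leftarrow>ys. a x y) / real (length ys) - (\<Sum>y\<leftarrow>ys. b x y) / real (length ys)\<bar>) \<le> e"
proof -
  have "(\<Sum>x<M. \<bar>(\<Sum>y\<leftarrow>zs. a x y) - (\<Sum>y\<leftarrow>zs. b x y)\<bar>) \<le> real (length zs) * e" if "set zs \<subseteq> set ys" for zs
    using that
  proof (induction zs)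
    case (Cons z zs)
    have "(\<Sum>x<M. \<bar>(\<Sum>y\<leftarrow>z # zs. a x y) - (\<Sum>y\<leftarrow>z # zs. b x y)\<bar>)
        \<le> (\<Sum>x<M. \<bar>a x z - b x z\<bar> + \<bar>(\<Sum>y\<leftarrow>zs. a x y) - (\<Sum>y\<leftarrow>zs. b x y)\<bar>)"
      by (intro sum_mono) simp
    also have "\<dots> \<le> e + real (length zs) * e"
      unfolding sum.distrib using Cons assms(1) by (intro add_mono) auto
    finally show ?case by (simp add: distrib_right)
  qed simp
  from this[of ys] have "(\<Sum>x<M. \<bar>(\<Sum>y\<leftarrow>ys. a x y) - (\<Sum>y\<leftarrow>ys. b x y)\<bar>) / real (length ys) \<le> e"
    using assms(2) by (simp add: field_simps)
  then show ?thesis by (simp add: sum_divide_distrib diff_divide_distrib[symmetric])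
qed

text \<open>The three terms are the bias from the frequencies cut off, the sampling error and the
  blocking error. Although the sum runs over a whole period, g and h enter the bound only through
  the ratio \<open>(g - 1) / (g * h)\<close>.\<close>

theorem block_estimate:
  fixes P :: "nat pmf"
  assumes fin: "finite (set_pmf P)" and L: "L > 0" and g: "g > 0" and h: "h > 0" and gh: "g = 1 \<or> 2 * D < h"
    and decay: "\<And>\<beta> d. D < d \<Longrightarrow> d < g * h - D \<Longrightarrow>
      (norm (expect P (\<lambda>x. chi (L * (g * h)) ((\<beta> * int (g * h) + int d) * int x))))\<^sup>2
        \<le> c * (exp (- 4 * real d) + exp (- 4 * real (g * h - d)))"
    and c: "c \<ge> 0" and m: "m > 0"
  shows "prob (replicate_pmf m P)
    {ys. \<not> (\<Sum>x<L * (g * h). \<bar>pmf (map_pmf (\<lambda>x. x mod (L * (g * h))) P) x - (\<Sum>y\<leftarrow>ys. block_kernel L g h D x y) / real m\<bar>)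
      \<le> sqrt (real L * (2 * c * exp (- 4 * real D))) + sqrt (20 * real (L * (2 * D + 1)) / real m)
        + real (2 * D + 1) * (2 * pi * real D * real (g - 1) / real (g * h))} \<le> 1 / 20"
proof -
  define N where "N = g * h"
  define M where "M = L * N"
  have N: "N > 0" and M: "M > 0" using L g h by (auto simp: N_def M_def)
  let ?p = "pmf (map_pmf (\<lambda>x. x mod M) P)"
  define f where "f = (\<lambda>x. expect P (est_kernel L N D x))"
  define est where "est = (\<lambda>ys x. (\<Sum>y\<leftarrow>ys. est_kernel L N D x y) / real m)"
  define blk where "blk = (\<lambda>ys x. (\<Sum>y\<leftarrow>ys. block_kernel L g h D x y) / real m)"
  define V where "V = real (L * (2 * D + 1)) / real M"
  \<comment> \<open>Chosen so that \<open>V / (m * t)\<close> is 1/20. The product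
    \<open>M * t\<close>, which enters the Cauchy-Schwarz inequality, is then free of N.\<close>
  define t where "t = 20 * V / real m"
  have V: "V > 0" unfolding V_def using L M by (intro divide_pos_pos; simp only: of_nat_0_less_iff; simp)
  then have t: "t > 0" using m by (simp add: t_def)
  have bias: "(\<Sum>x<M. \<bar>?p x - f x\<bar>) \<le> sqrt (real L * (2 * c * exp (- 4 * real D)))"
    unfolding M_def f_def using decay c
    by (intro sum_abs_le_sqrt est_kernel_bias[OF fin L N]) (simp_all add: N_def)
  have dev: "prob (replicate_pmf m P) {ys. (\<Sum>x<M. (est ys x - f x)\<^sup>2) \<ge> t} \<le> 1 / 20"
  proof -
    have "prob (replicate_pmf m P) {ys. (\<Sum>x<M. (est ys x - f x)\<^sup>2) \<ge> t} \<le> V / (real m * t)"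
      unfolding est_def f_def V_def M_def
      by (intro iid_vector_deviation[OF fin _ _ m] est_kernel_energy[OF L N])
         (use t in \<open>auto simp: V_def M_def\<close>)
    also have "\<dots> = 1 / 20" using V m by (simp add: t_def)
    finally show ?thesis .
  qed
  have lip: "(\<Sum>x<M. \<bar>est_kernel L N D x y - block_kernel L g h D x y\<bar>)
      \<le> real (2 * D + 1) * (2 * pi * real D * real (g - 1) / real N)" for y
  proof -
    let ?e = "real (2 * D + 1) * (2 * pi * real D * real (g - 1) / real N) / real N"
    have "(\<Sum>x<M. \<bar>est_kernel L N D x y - block_kernel L g h D x y\<bar>) \<le> (\<Sum>x<M. if x mod L = y mod L then ?e else 0)"
      unfolding M_def N_def by (intro sum_mono block_kernel_error[OF L g h gh]) simp
    also have "\<dots> = real (card {x. x < L * N \<and> x mod L = y mod L}) * ?e"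
      by (simp add: sum.If_cases M_def Int_def)
    also have "\<dots> \<le> real N * ?e"
      by (intro mult_right_mono of_nat_mono card_residue_class_le) auto
    also have "\<dots> = real (2 * D + 1) * (2 * pi * real D * real (g - 1) / real N)" using N by simp
    finally show ?thesis .
  qed
  have "prob (replicate_pmf m P)
    {ys. \<not> (\<Sum>x<M. \<bar>?p x - blk ys x\<bar>)
      \<le> sqrt (real L * (2 * c * exp (- 4 * real D))) + sqrt (20 * real (L * (2 * D + 1)) / real m)
        + real (2 * D + 1) * (2 * pi * real D * real (g - 1) / real N)}
    \<le> prob (replicate_pmf m P) {ys. (\<Sum>x<M. (est ys x - f x)\<^sup>2) \<ge> t}"
  proof (rule prob_mono_supp, rule ccontr)
    fix ys assume ys: "ys \<in> set_pmf (replicate_pmf m P)"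
      and bad: "ys \<in> {ys. \<not> (\<Sum>x<M. \<bar>?p x - blk ys x\<bar>)
      \<le> sqrt (real L * (2 * c * exp (- 4 * real D))) + sqrt (20 * real (L * (2 * D + 1)) / real m)
        + real (2 * D + 1) * (2 * pi * real D * real (g - 1) / real N)}"
      and good: "ys \<notin> {ys. (\<Sum>x<M. (est ys x - f x)\<^sup>2) \<ge> t}"
    have len: "length ys = m" using ys by (simp add: set_replicate_pmf)
    have "real M * (\<Sum>x<M. (est ys x - f x)\<^sup>2) \<le> real M * t" using good by (intro mult_left_mono) auto
    also have "real M * t = 20 * real (L * (2 * D + 1)) / real m" using M by (simp add: t_def V_def)
    finally have 2: "(\<Sum>x<M. \<bar>est ys x - f x\<bar>) \<le> sqrt (20 * real (L * (2 * D + 1)) / real m)"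
      by (rule sum_abs_le_sqrt)
    have "ys \<noteq> []" using len m by auto
    then have 3: "(\<Sum>x<M. \<bar>est ys x - blk ys x\<bar>) \<le> real (2 * D + 1) * (2 * pi * real D * real (g - 1) / real N)"
      using sum_list_average_diff_le[where ys = ys and M = M and a = "est_kernel L N D" and b = "block_kernel L g h D"] lip
      by (simp add: est_def blk_def len)
    have "(\<Sum>x<M. \<bar>?p x - blk ys x\<bar>) \<le> (\<Sum>x<M. \<bar>?p x - f x\<bar> + \<bar>est ys x - f x\<bar> + \<bar>est ys x - blk ys x\<bar>)"
      by (intro sum_mono) linarith
    also have "\<dots> \<le> sqrt (real L * (2 * c * exp (- 4 * real D))) + sqrt (20 * real (L * (2 * D + 1)) / real m)
        + real (2 * D + 1) * (2 * pi * real D * real (g - 1) / real N)"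
      unfolding sum.distrib by (intro add_mono bias 2 3)
    finally show False using bad by simp
  qed
  also note dev
  finally show ?thesis by (simp only: blk_def N_def M_def)
qed

section \<open>Decay constants and total variation distance\<close>

text \<open>\<open>D = (k! * Q)^2\<close> is the distance beyond which a quadratic exponent
  dominates a linear one: at distance \<open>\<mu>\<close> the exponent is at least
  \<open>4 * \<mu>^2 / D\<close> up to a constant, and \<open>\<mu> > D\<close> makes this at least
  \<open>4 * \<mu>\<close>. The constant is the 4 of \<open>exp 4\<close>, the price for the scale
  \<open>s + k\<close>.\<close>

lemma char_decay:
  fixes P :: "nat pmf" and s :: real and k Q :: nat
  assumes bound: "\<And>\<theta>. (norm (expect P (\<lambda>x. cis (\<theta> * real x))))\<^sup>2
      \<le> exp (- (4 * s\<^sup>2 * (sin (fact k * (\<theta> / 2)))\<^sup>2 / (fact k)\<^sup>2))"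
    and s: "s \<ge> 0" and k: "k > 0" and Q: "Q > 0" and N: "real N \<le> (s + real k) * real Q"
    and D: "D = (fact k * Q)\<^sup>2" and d: "D < d" "d < N - D"
  shows "(norm (expect P (\<lambda>x. chi (fact k * N) ((\<beta> * int N + int d) * int x))))\<^sup>2
      \<le> exp 4 * (exp (- 4 * real d) + exp (- 4 * real (N - d)))"
proof -
  define L :: nat where "L = fact k"
  define \<theta> where "\<theta> = 2 * pi * of_int (\<beta> * int N + int d) / real (L * N)"
  define \<tau> where "\<tau> = s + real k"
  define y where "y = (sin (real L * (\<theta> / 2)))\<^sup>2"
  define \<mu> where "\<mu> = min d (N - d)"
  have N0: "N > 0" and L0: "L > 0" using d by (auto simp: L_def)
  have Lk: "k \<le> L" unfolding L_def by (rule fact_ge_self)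
  have mu: "\<mu> > D" using d by (auto simp: \<mu>_def)
  have "real L * (\<theta> / 2) = pi * of_int \<beta> + pi * real d / real N"
    using N0 L0 by (simp add: \<theta>_def field_simps)
  then have ang: "2 * (real L * (\<theta> / 2)) = 2 * (pi * real d / real N) + 2 * pi * of_int \<beta>"
    by simp
  \<comment> \<open>Squared sines are compared through the double angle, where
    \<open>pi * \<beta>\<close> becomes a multiple of \<open>2 * pi\<close> and drops out for either
    parity of \<open>\<beta>\<close>.\<close>
  have "cos (2 * (real L * (\<theta> / 2))) = cos (2 * (pi * real d / real N))"
    unfolding ang cos_add cos_int_2pin sin_int_2pin by simp
  then have yd: "y = (sin (pi * real d / real N))\<^sup>2"
    unfolding y_def cos_double_sin by simp
  have y1: "y \<le> 1" "y \<ge> 0" by (simp_all add: y_def abs_square_le_1)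
  have y2: "2 * (real \<mu> / real N)\<^sup>2 \<le> y"
    unfolding yd \<mu>_def using d by (intro sin_sq_ge) auto
  \<comment> \<open>The excess of \<open>\<tau>^2\<close> over \<open>2 * s^2\<close> is at most
    \<open>2 * k^2\<close>, and because of \<open>k \<le> L\<close> the division by
    \<open>L^2\<close> turns it into a constant.\<close>
  have "\<tau>\<^sup>2 \<le> 2 * s\<^sup>2 + 2 * (real k)\<^sup>2"
    using zero_le_power2[of "s - real k"] by (simp add: \<tau>_def power2_eq_square algebra_simps)
  then have "2 * \<tau>\<^sup>2 * y \<le> (4 * s\<^sup>2 + 4 * (real k)\<^sup>2) * y"
    using y1 by (intro mult_right_mono) auto
  moreover have "(real k)\<^sup>2 * y \<le> (real L)\<^sup>2 * 1"
    using Lk y1 by (intro mult_mono power_mono) auto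
  ultimately have "2 * \<tau>\<^sup>2 * y \<le> 4 * s\<^sup>2 * y + 4 * (real L)\<^sup>2"
    by (simp add: distrib_right)
  then have "2 * \<tau>\<^sup>2 * y / (real L)\<^sup>2 \<le> (4 * s\<^sup>2 * y + 4 * (real L)\<^sup>2) / (real L)\<^sup>2"
    by (rule divide_right_mono) simp
  then have e1: "- (4 * s\<^sup>2 * y / (real L)\<^sup>2) \<le> 4 - 2 * \<tau>\<^sup>2 * y / (real L)\<^sup>2"
    using L0 by (simp add: add_divide_distrib)
  have "4 * real \<mu> \<le> 2 * \<tau>\<^sup>2 * y / (real L)\<^sup>2"
  proof -
    have tau: "\<tau> > 0" using s k by (simp add: \<tau>_def)
    have "real \<mu> * real D \<le> real \<mu> * real \<mu>" using mu by (intro mult_left_mono) auto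
    then have "real \<mu> \<le> (real \<mu>)\<^sup>2 / real D"
      using Q L0 D mu by (simp add: field_simps power2_eq_square L_def)
    also have "\<dots> = (real \<mu>)\<^sup>2 / (real Q)\<^sup>2 / (real L)\<^sup>2"
      by (simp add: D L_def power_mult_distrib mult.commute)
    also have "(real \<mu>)\<^sup>2 / (real Q)\<^sup>2 \<le> \<tau>\<^sup>2 * (real \<mu> / real N)\<^sup>2"
    proof -
      have "real \<mu> / real Q \<le> \<tau> * (real \<mu> / real N)"
      proof -
        have "real \<mu> * real N \<le> real \<mu> * (\<tau> * real Q)"
          using N by (intro mult_left_mono) (simp_all add: \<tau>_def)
        then show ?thesis using N0 Q by (simp add: field_simps)
      qed
      then have "(real \<mu> / real Q)\<^sup>2 \<le> (\<tau> * (real \<mu> / real N))\<^sup>2" by (intro power_mono) auto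
      then show ?thesis by (simp add: power_divide power_mult_distrib)
    qed
    finally have "real \<mu> \<le> \<tau>\<^sup>2 * (real \<mu> / real N)\<^sup>2 / (real L)\<^sup>2" by (simp add: divide_right_mono)
    also have "\<dots> \<le> \<tau>\<^sup>2 * (y / 2) / (real L)\<^sup>2"
      using y2 by (intro divide_right_mono mult_left_mono) auto
    finally show ?thesis by simp
  qed
  then have "- (4 * s\<^sup>2 * y / (real L)\<^sup>2) \<le> 4 + (- 4 * real \<mu>)" using e1 by linarith
  then have "exp (- (4 * s\<^sup>2 * y / (real L)\<^sup>2)) \<le> exp 4 * exp (- 4 * real \<mu>)"
    by (simp add: exp_add[symmetric])
  also have "exp (- 4 * real \<mu>) \<le> exp (- 4 * real d) + exp (- 4 * real (N - d))"
    by (cases "d \<le> N - d") (simp_all add: \<mu>_def min_def del: mult_minus_left)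
  finally have "exp (- (4 * s\<^sup>2 * y / (real L)\<^sup>2)) \<le> exp 4 * (exp (- 4 * real d) + exp (- 4 * real (N - d)))"
    by simp
  moreover have "chi (fact k * N) ((\<beta> * int N + int d) * int x) = cis (\<theta> * real x)" for x
    by (simp add: chi_def \<theta>_def L_def mult_ac)
  ultimately show ?thesis
    using bound[of \<theta>] by (simp add: y_def L_def)
qed

section \<open>Total variation under maps, products and reduction of random words\<close>

lemma tv_dist_finite:
  assumes "finite A" "set_pmf P \<subseteq> A" "set_pmf Q \<subseteq> A"
  shows "tv_dist P Q = (\<Sum>x\<in>A. \<bar>pmf P x - pmf Q x\<bar>) / 2"
proof -
  have "(\<Sum>\<^sub>\<infinity>x. \<bar>pmf P x - pmf Q x\<bar>) = (\<Sum>\<^sub>\<infinity>x\<in>A. \<bar>pmf P x - pmf Q x\<bar>)"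
  proof (rule infsum_cong_neutral)
    fix x assume "x \<in> UNIV - A"
    then have "pmf P x = 0" "pmf Q x = 0" using assms by (auto simp: pmf_eq_0_set_pmf)
    then show "\<bar>pmf P x - pmf Q x\<bar> = 0" by simp
  qed auto
  then show ?thesis using assms(1) by (simp add: tv_dist_def)
qed

lemma tv_dist_le_1:
  assumes "finite (set_pmf P)" "finite (set_pmf Q)"
  shows "tv_dist P Q \<le> 1"
proof -
  let ?A = "set_pmf P \<union> set_pmf Q"
  have A: "finite ?A" using assms by simp
  have "(\<Sum>x\<in>?A. \<bar>pmf P x - pmf Q x\<bar>) \<le> (\<Sum>x\<in>?A. pmf P x + pmf Q x)"
    by (intro sum_mono) (smt (verit) pmf_nonneg)
  also have "\<dots> = 2" using A by (simp add: sum.distrib sum_pmf_eq_1)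
  finally show ?thesis using A by (subst tv_dist_finite[of ?A]) auto
qed

lemma tv_dist_triangle:
  assumes "finite (set_pmf P)" "finite (set_pmf Q)" "finite (set_pmf R)"
  shows "tv_dist P R \<le> tv_dist P Q + tv_dist Q R"
proof -
  let ?A = "set_pmf P \<union> set_pmf Q \<union> set_pmf R"
  have A: "finite ?A" using assms by simp
  have "(\<Sum>x\<in>?A. \<bar>pmf P x - pmf R x\<bar>) \<le> (\<Sum>x\<in>?A. \<bar>pmf P x - pmf Q x\<bar> + \<bar>pmf Q x - pmf R x\<bar>)"
    by (intro sum_mono) simp
  then show ?thesis
    using A by (subst (1 2 3) tv_dist_finite[of ?A]) (auto simp: sum.distrib)
qed

lemma pmf_map_finite:
  assumes "finite A" "set_pmf P \<subseteq> A"
  shows "pmf (map_pmf f P) z = (\<Sum>x | x \<in> A \<and> f x = z. pmf P x)"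
proof -
  have "pmf (map_pmf f P) z = prob P (f -` {z})" by (rule pmf_map)
  also have "\<dots> = prob P {x. x \<in> A \<and> f x = z}"
    using assms(2) by (intro antisym prob_mono_supp) auto
  also have "\<dots> = (\<Sum>x | x \<in> A \<and> f x = z. pmf P x)"
    using assms(1) by (intro measure_measure_pmf_finite) simp
  finally show ?thesis .
qed

lemma tv_dist_map_le:
  assumes "finite (set_pmf P)" "finite (set_pmf Q)"
  shows "tv_dist (map_pmf f P) (map_pmf f Q) \<le> tv_dist P Q"
proof -
  let ?A = "set_pmf P \<union> set_pmf Q"
  have A: "finite ?A" using assms by simp
  have "(\<Sum>z\<in>f ` ?A. \<bar>pmf (map_pmf f P) z - pmf (map_pmf f Q) z\<bar>)
      \<le> (\<Sum>z\<in>f ` ?A. \<Sum>x | x \<in> ?A \<and> f x = z. \<bar>pmf P x - pmf Q x\<bar>)"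
  proof (intro sum_mono)
    fix z
    have "pmf (map_pmf f P) z - pmf (map_pmf f Q) z = (\<Sum>x | x \<in> ?A \<and> f x = z. pmf P x - pmf Q x)"
      using A by (simp add: pmf_map_finite[of ?A] sum_subtractf)
    then show "\<bar>pmf (map_pmf f P) z - pmf (map_pmf f Q) z\<bar> \<le> (\<Sum>x | x \<in> ?A \<and> f x = z. \<bar>pmf P x - pmf Q x\<bar>)"
      by (simp only: sum_abs)
  qed
  also have "\<dots> = (\<Sum>x\<in>?A. \<bar>pmf P x - pmf Q x\<bar>)"
    by (rule sum.image_gen[OF A, symmetric])
  finally show ?thesis
    using A tv_dist_finite[of "f ` ?A" "map_pmf f P" "map_pmf f Q"] tv_dist_finite[of ?A P Q]
    by (simp add: image_Un)
qed

text \<open>The coupling of x with \<open>f x\<close>. It will bound the loss caused by the mass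
  outside the window.\<close>

lemma tv_dist_map_self:
  assumes "finite (set_pmf P)"
  shows "tv_dist P (map_pmf f P) \<le> prob P {x. f x \<noteq> x}"
proof -
  let ?S = "set_pmf P"
  let ?A = "?S \<union> f ` ?S"
  have A: "finite ?A" using assms by simp
  have "(\<Sum>z\<in>?A. \<bar>pmf P z - pmf (map_pmf f P) z\<bar>)
      \<le> (\<Sum>z\<in>?A. \<Sum>x\<in>?S. pmf P x * \<bar>of_bool (x = z) - of_bool (f x = z)\<bar>)"
  proof (intro sum_mono)
    fix z
    have "pmf P z = (\<Sum>x\<in>?S. pmf P x * of_bool (x = z))"
      using assms by (simp add: of_bool_def if_distrib[of "\<lambda>a. _ * a"] pmf_eq_0_set_pmf cong: if_cong)
    moreover have "pmf (map_pmf f P) z = (\<Sum>x\<in>?S. pmf P x * of_bool (f x = z))"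
      using assms by (simp add: pmf_map_finite[of ?S] of_bool_def if_distrib[of "\<lambda>a. _ * a"] sum.inter_filter cong: if_cong)
    ultimately have "pmf P z - pmf (map_pmf f P) z = (\<Sum>x\<in>?S. pmf P x * (of_bool (x = z) - of_bool (f x = z)))"
      by (simp add: sum_subtractf right_diff_distrib)
    also have "\<bar>\<dots>\<bar> \<le> (\<Sum>x\<in>?S. \<bar>pmf P x * (of_bool (x = z) - of_bool (f x = z))\<bar>)" by (rule sum_abs)
    finally show "\<bar>pmf P z - pmf (map_pmf f P) z\<bar> \<le> (\<Sum>x\<in>?S. pmf P x * \<bar>of_bool (x = z) - of_bool (f x = z)\<bar>)"
      by (simp add: abs_mult)
  qed
  also have "\<dots> = (\<Sum>x\<in>?S. pmf P x * (\<Sum>z\<in>?A. \<bar>of_bool (x = z) - of_bool (f x = z)\<bar>))"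
    unfolding sum_distrib_left by (rule sum.swap)
  also have "\<dots> \<le> (\<Sum>x\<in>?S. pmf P x * (2 * of_bool (f x \<noteq> x)))"
  proof (intro sum_mono mult_left_mono)
    fix x
    have "(\<Sum>z\<in>?A. \<bar>of_bool (x = z) - of_bool (f x = z) :: real\<bar>) \<le> (\<Sum>z\<in>?A. (if z = x then of_bool (f x \<noteq> x) else 0) + (if z = f x then of_bool (f x \<noteq> x) else 0))"
      by (intro sum_mono) auto
    also have "\<dots> \<le> 2 * of_bool (f x \<noteq> x)"
      using A by (simp add: sum.distrib)
    finally show "(\<Sum>z\<in>?A. \<bar>of_bool (x = z) - of_bool (f x = z) :: real\<bar>) \<le> 2 * of_bool (f x \<noteq> x)" .
  qed simp
  also have "\<dots> = 2 * expect P (\<lambda>x. indicator {x. f x \<noteq> x} x)"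
    unfolding expectation_finite[OF assms] by (simp add: sum_distrib_left indicator_def of_bool_def mult_ac cong: if_cong)
  also have "\<dots> = 2 * prob P {x. f x \<noteq> x}" by simp
  finally show ?thesis using A by (subst tv_dist_finite[of ?A]) auto
qed

text \<open>One factor is changed at a time, through the intermediate product of \<open>A'\<close>
  and B.\<close>

lemma tv_dist_pair_le:
  assumes "finite (set_pmf A)" "finite (set_pmf B)" "finite (set_pmf A')" "finite (set_pmf B')"
  shows "tv_dist (pair_pmf A B) (pair_pmf A' B') \<le> tv_dist A A' + tv_dist B B'"
proof -
  let ?S = "set_pmf A \<union> set_pmf A'" and ?T = "set_pmf B \<union> set_pmf B'"
  have fin: "finite ?S" "finite ?T" using assms by auto
  have "(\<Sum>z\<in>?S \<times> ?T. \<bar>pmf (pair_pmf A B) z - pmf (pair_pmf A' B') z\<bar>)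
      \<le> (\<Sum>x\<in>?S. \<Sum>y\<in>?T. \<bar>pmf A x - pmf A' x\<bar> * pmf B y + pmf A' x * \<bar>pmf B y - pmf B' y\<bar>)"
    unfolding sum.cartesian_product
  proof (intro sum_mono, clarify)
    fix x y
    have "pmf A x * pmf B y - pmf A' x * pmf B' y = (pmf A x - pmf A' x) * pmf B y + pmf A' x * (pmf B y - pmf B' y)"
      by (simp add: algebra_simps)
    then have "\<bar>pmf A x * pmf B y - pmf A' x * pmf B' y\<bar> \<le> \<bar>(pmf A x - pmf A' x) * pmf B y\<bar> + \<bar>pmf A' x * (pmf B y - pmf B' y)\<bar>"
      by (simp only: abs_triangle_ineq)
    then show "\<bar>pmf (pair_pmf A B) (x, y) - pmf (pair_pmf A' B') (x, y)\<bar>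
        \<le> \<bar>pmf A x - pmf A' x\<bar> * pmf B y + pmf A' x * \<bar>pmf B y - pmf B' y\<bar>"
      by (simp add: pmf_pair abs_mult)
  qed
  also have "\<dots> = (\<Sum>x\<in>?S. \<bar>pmf A x - pmf A' x\<bar>) * (\<Sum>y\<in>?T. pmf B y) + (\<Sum>x\<in>?S. pmf A' x) * (\<Sum>y\<in>?T. \<bar>pmf B y - pmf B' y\<bar>)"
    by (simp only: sum_product sum.distrib)
  also have "\<dots> = 2 * tv_dist A A' + 2 * tv_dist B B'"
    using fin by (simp add: sum_pmf_eq_1 tv_dist_finite[of ?S] tv_dist_finite[of ?T])
  finally show ?thesis using fin by (subst tv_dist_finite[of "?S \<times> ?T"]) auto
qed

text \<open>Each residue has between \<open>B div a\<close> and \<open>B div a + 1\<close>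
  preimages, so every point mass is off by at most \<open>1 / B\<close>. This is the price of a draw
  from an arbitrary range by a single random word.\<close>

lemma tv_dist_mod_uniform:
  assumes a: "a > 0" and B: "B > 0"
  shows "tv_dist (map_pmf (\<lambda>x. x mod a) (pmf_of_set {..<B})) (pmf_of_set {..<a}) \<le> real a / real B"
proof -
  have ne: "{..<B} \<noteq> {}" "{..<a} \<noteq> {}" using a B by auto
  have each: "\<bar>pmf (map_pmf (\<lambda>x. x mod a) (pmf_of_set {..<B})) v - pmf (pmf_of_set {..<a}) v\<bar> \<le> 1 / real B"
    if v: "v < a" for v
  proof -
    define C where "C = {x \<in> {..<B}. x mod a = v}"
    have "inj_on (\<lambda>x. x div a) C"
      by (intro inj_onI) (auto simp: C_def, metis div_mult_mod_eq)
    moreover have "(\<lambda>x. x div a) ` C \<subseteq> {..B div a}" by (auto simp: C_def div_le_mono)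
    ultimately have "card C \<le> card {..B div a}" by (rule card_inj_on_le) simp
    then have up: "card C \<le> B div a + 1" by simp
    have "(\<lambda>q. q * a + v) ` {..<B div a} \<subseteq> C"
    proof clarify
      fix q assume "q < B div a"
      then have "(q + 1) * a \<le> B div a * a" by (intro mult_right_mono) auto
      also have "\<dots> \<le> B" by simp
      finally show "q * a + v \<in> C" using v by (simp add: C_def)
    qed
    moreover have "inj_on (\<lambda>q. q * a + v) {..<B div a}" using a by (auto intro: inj_onI)
    ultimately have lo: "B div a \<le> card C"
      using card_inj_on_le[of "\<lambda>q. q * a + v" "{..<B div a}" C] by (auto simp: C_def)
    have "real B = real (B div a) * real a + real (B mod a)"
      by (metis div_mult_mod_eq of_nat_add of_nat_mult)
    moreover have "real (B mod a) < real a" using a by simp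
    ultimately have "real (B div a) \<le> real B / real a" "real B / real a - 1 \<le> real (B div a)"
      using a by (simp_all add: field_simps)
    then have "\<bar>real (card C) - real B / real a\<bar> \<le> 1" using up lo by linarith
    then have "\<bar>real (card C) - real B / real a\<bar> / real B \<le> 1 / real B" by (intro divide_right_mono) auto
    also have "\<bar>real (card C) - real B / real a\<bar> / real B = \<bar>real (card C) / real B - 1 / real a\<bar>"
    proof -
      have "real (card C) / real B - 1 / real a = (real (card C) - real B / real a) / real B"
        using a B by (simp add: field_simps)
      then show ?thesis using B by (simp add: abs_divide)
    qed
    finally have "\<bar>real (card C) / real B - 1 / real a\<bar> \<le> 1 / real B" .
    moreover have "pmf (map_pmf (\<lambda>x. x mod a) (pmf_of_set {..<B})) v = real (card C) / real B"
      using ne B by (subst pmf_map_finite[of "{..<B}"]) (auto simp: C_def)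
    ultimately show ?thesis using v ne by simp
  qed
  have "(\<Sum>v<a. \<bar>pmf (map_pmf (\<lambda>x. x mod a) (pmf_of_set {..<B})) v - pmf (pmf_of_set {..<a}) v\<bar>)
      \<le> (\<Sum>v<a. 1 / real B)"
    by (intro sum_mono each) auto
  also have "\<dots> = real a / real B" by simp
  finally have "tv_dist (map_pmf (\<lambda>x. x mod a) (pmf_of_set {..<B})) (pmf_of_set {..<a}) \<le> real a / real B / 2"
    using a ne by (subst tv_dist_finite[of "{..<a}"]) auto
  moreover have "x / 2 \<le> x" if "0 \<le> x" for x :: real using that by simp
  ultimately show ?thesis by (meson divide_nonneg_nonneg of_nat_0_le_iff order.trans)
qed

section \<open>From kernel weights to a distribution\<close>

text \<open>The pair of block index and residue, written as one number below \<open>h * L\<close> in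
  base L.\<close>

definition cell :: "nat \<Rightarrow> nat \<Rightarrow> nat \<Rightarrow> nat \<Rightarrow> nat" where
  "cell L g h z = block_index L g h z * L + z mod L"

lemma block_index_less:
  assumes "L > 0" "g > 0" "h > 0"
  shows "block_index L g h z < h"
proof -
  have "z mod (L * (g * h)) < L * (g * h)" using assms by simp
  then have "z mod (L * (g * h)) div L < g * h" by (simp add: less_mult_imp_div_less mult_ac)
  then show ?thesis unfolding block_index_def by (simp add: less_mult_imp_div_less mult_ac)
qed

lemma cell_less:
  assumes "L > 0" "g > 0" "h > 0"
  shows "cell L g h z < h * L"
proof -
  have "block_index L g h z * L + z mod L < (block_index L g h z + 1) * L"
    using assms by simp
  also have "\<dots> \<le> h * L" using block_index_less[OF assms, of z] by (intro mult_le_mono1) (simp add: Suc_leI)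
  finally show ?thesis by (simp add: cell_def)
qed

lemma cell_div: "L > 0 \<Longrightarrow> cell L g h z div L = block_index L g h z"
  and cell_mod: "cell L g h z mod L = z mod L"
  by (simp_all add: cell_def)

text \<open>The block kernel without its factor \<open>1 / g\<close>. For fixed L and D it depends
  on h and two cells alone, so it amounts to finitely many numbers for each h.\<close>

definition cell_kernel :: "nat \<Rightarrow> nat \<Rightarrow> nat \<Rightarrow> nat \<Rightarrow> nat \<Rightarrow> real" where
  "cell_kernel L D h y' y = (if y mod L = y' mod L then low_pass h D (int (y' div L) - int (y div L)) else 0)"

lemma block_kernel_cell:
  "L > 0 \<Longrightarrow> block_kernel L g h D x z = cell_kernel L D h (cell L g h z) (cell L g h x) / real g"
  by (simp add: block_kernel_def cell_kernel_def cell_div cell_mod)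

lemma abs_low_pass_le: 
  assumes "h > 0"
  shows "\<bar>low_pass h D w\<bar> \<le> 1"
proof -
  have "card (freqs h D) \<le> card {- int D..<- int D + int h}"
    by (rule card_mono) (auto simp: freqs_def)
  then have c: "card (freqs h D) \<le> h" by simp
  have "\<bar>\<Sum>d\<in>freqs h D. cos (2 * pi * of_int (d * w) / real h)\<bar> \<le> (\<Sum>d\<in>freqs h D. 1)"
    by (intro order.trans[OF sum_abs] sum_mono) simp
  also have "\<dots> \<le> real h" using c by simp
  finally show ?thesis using assms by (simp add: low_pass_def)
qed

text \<open>The kernel is shifted by 1 to make the table entries natural numbers.\<close>

definition table :: "nat \<Rightarrow> nat \<Rightarrow> nat \<Rightarrow> nat \<Rightarrow> nat \<Rightarrow> nat \<Rightarrow> nat" where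
  "table L D R h y' y = (if y < h * L then nat \<lfloor>real R * (1 + cell_kernel L D h y' y)\<rfloor> else 0)"

lemma table_le: "h > 0 \<Longrightarrow> table L D R h y' y \<le> 2 * R"
proof -
  assume h: "h > 0"
  have "cell_kernel L D h y' y \<le> 1"
    using abs_low_pass_le[OF h] by (auto simp: cell_kernel_def abs_le_iff)
  then have "real R * (1 + cell_kernel L D h y' y) \<le> real R * 2" by (intro mult_left_mono) auto
  then have "\<lfloor>real R * (1 + cell_kernel L D h y' y)\<rfloor> \<le> \<lfloor>real R * 2\<rfloor>" by (rule floor_mono)
  also have "\<dots> = 2 * int R" by (metis floor_of_nat of_nat_mult of_nat_numeral mult.commute)
  finally show ?thesis by (simp add: table_def nat_le_iff)
qed

lemma table_approx:
  assumes h: "h > 0" and y: "y < h * L"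
  shows "real (table L D R h y' y) \<le> real R * (1 + cell_kernel L D h y' y)"
    and "real R * (1 + cell_kernel L D h y' y) - 1 \<le> real (table L D R h y' y)"
proof -
  have "- 1 \<le> cell_kernel L D h y' y"
    using abs_low_pass_le[OF h] by (auto simp: cell_kernel_def abs_le_iff minus_le_iff)
  then have "0 \<le> real R * (1 + cell_kernel L D h y' y)" by simp
  then have "real (table L D R h y' y) = of_int \<lfloor>real R * (1 + cell_kernel L D h y' y)\<rfloor>"
    using y by (simp add: table_def)
  then show "real (table L D R h y' y) \<le> real R * (1 + cell_kernel L D h y' y)"
    "real R * (1 + cell_kernel L D h y' y) - 1 \<le> real (table L D R h y' y)" by linarith+
qed

text \<open>The shift by 1 adds R to the sum for each sample. Natural subtraction removes this and
  at the same time replaces negative totals by 0.\<close>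

definition weight :: "nat \<Rightarrow> nat \<Rightarrow> nat \<Rightarrow> nat \<Rightarrow> nat \<Rightarrow> nat list \<Rightarrow> nat \<Rightarrow> nat" where
  "weight L D R g h zs y = (\<Sum>z\<leftarrow>zs. table L D R h (cell L g h z) y) - length zs * R"

text \<open>Rounding down loses at most 1 per entry, hence at most \<open>1 / (R * g)\<close> after
  normalisation, and cutting off at 0 cannot move a value away from
  \<open>p \<ge> 0\<close>.\<close>

lemma weight_approx:
  assumes L: "L > 0" and g: "g > 0" and h: "h > 0" and R: "R > 0" and zs: "zs \<noteq> []"
    and p: "p \<ge> 0"
  shows "\<bar>p - real (weight L D R g h zs (cell L g h x)) / (real (length zs) * real R * real g)\<bar>
    \<le> \<bar>p - (\<Sum>z\<leftarrow>zs. block_kernel L g h D x z) / real (length zs)\<bar> + 1 / (real R * real g)"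
proof -
  define y where "y = cell L g h x"
  define m where "m = real (length zs)"
  define K where "K = (\<Sum>z\<leftarrow>zs. cell_kernel L D h (cell L g h z) y)"
  define T where "T = real (\<Sum>z\<leftarrow>zs. table L D R h (cell L g h z) y)"
  have y: "y < h * L" unfolding y_def by (rule cell_less[OF L g h])
  have m: "m > 0" using zs by (simp add: m_def)
  have "real (\<Sum>z\<leftarrow>ws. table L D R h (cell L g h z) y) \<le> real R * (real (length ws) + (\<Sum>z\<leftarrow>ws. cell_kernel L D h (cell L g h z) y))
     \<and> real R * (real (length ws) + (\<Sum>z\<leftarrow>ws. cell_kernel L D h (cell L g h z) y)) - real (length ws) \<le> real (\<Sum>z\<leftarrow>ws. table L D R h (cell L g h z) y)" for ws
  proof (induction ws)
    case (Cons w ws)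
    then show ?case
      using table_approx[OF h y, where D = D and R = R and y' = "cell L g h w"] by (simp add: algebra_simps)
  qed simp
  from this[of zs] have T: "T \<le> real R * (m + K)" "real R * (m + K) - m \<le> T"
    by (simp_all add: T_def m_def K_def)
  define b where "b = K / (m * real g)"
  define c where "c = (T - m * real R) / (m * real R * real g)"
  have den: "m * real R * real g > 0" using m R g by simp
  have "c \<le> real R * K / (m * real R * real g)"
    unfolding c_def using T(1) den by (intro divide_right_mono) (simp_all add: algebra_simps)
  also have "\<dots> = b" using R by (simp add: b_def)
  finally have cb: "c \<le> b" .
  have "(real R * K - m) / (m * real R * real g) \<le> c"
    unfolding c_def using T(2) den by (intro divide_right_mono) (simp_all add: algebra_simps)
  moreover have "(real R * K - m) / (m * real R * real g) = b - 1 / (real R * real g)"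
    using R m g by (simp add: b_def field_simps)
  ultimately have bc: "b - 1 / (real R * real g) \<le> c" by simp
  have "real (weight L D R g h zs y) = max 0 (T - m * real R)"
    unfolding weight_def T_def m_def max_def by (simp add: of_nat_diff del: of_nat_mult flip: of_nat_mult)
  then have w: "real (weight L D R g h zs y) / (m * real R * real g) = max 0 c"
    using den by (simp add: c_def max_def zero_le_divide_iff)
  have "(\<Sum>z\<leftarrow>zs. block_kernel L g h D x z) / m = b"
  proof -
    have "(\<Sum>z\<leftarrow>ws. block_kernel L g h D x z) = (\<Sum>z\<leftarrow>ws. cell_kernel L D h (cell L g h z) y) / real g" for ws
      by (induction ws) (simp_all add: block_kernel_cell[OF L] y_def add_divide_distrib)
    then show ?thesis by (simp add: b_def K_def mult.commute)
  qed
  moreover have "\<bar>p - max 0 c\<bar> \<le> \<bar>p - b\<bar> + 1 / (real R * real g)"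
  proof -
    have "1 / (real R * real g) \<ge> 0" by simp
    then show ?thesis using p cb bc by (auto simp: max_def)
  qed
  ultimately show ?thesis using w by (simp add: y_def m_def)
qed

section \<open>Inverse transform sampling from integer weights\<close>

definition cum :: "(nat \<Rightarrow> nat) \<Rightarrow> nat \<Rightarrow> nat" where
  "cum w y = (\<Sum>i\<le>y. w i)"

text \<open>The quantile of v under the cumulated weights. Its form as a count lets a sum of
  comparison bits over all cells compute it, where a search for the first large value would have to
  branch.\<close>

definition draw :: "(nat \<Rightarrow> nat) \<Rightarrow> nat \<Rightarrow> nat \<Rightarrow> nat" where
  "draw w Y v = card {y. y < Y \<and> cum w y \<le> v}"

lemma cum_mono: "y \<le> y' \<Longrightarrow> cum w y \<le> cum w y'"
  unfolding cum_def by (intro sum_mono2) auto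

lemma draw_eq_iff:
  assumes v: "v < (\<Sum>i<Y. w i)" and y: "y < Y"
  shows "draw w Y v = y \<longleftrightarrow> (\<Sum>i<y. w i) \<le> v \<and> v < cum w y"
proof -
  define j where "j = (LEAST j. v < cum w j)"
  obtain Y' where Y': "Y = Suc Y'" using y by (cases Y) auto
  have "v < cum w Y'" using v by (simp add: cum_def Y' lessThan_Suc_atMost)
  then have j: "v < cum w j" "j \<le> Y'" unfolding j_def by (rule LeastI, rule Least_le)
  have below: "cum w i \<le> v" if "i < j" for i using not_less_Least[of i "\<lambda>j. v < cum w j"] that by (simp add: j_def)
  have "{y. y < Y \<and> cum w y \<le> v} = {..<j}"
    using below j Y' cum_mono[of j _ w] by (auto, meson le_less_trans not_less)
  then have draw: "draw w Y v = j" by (simp add: draw_def)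
  have lt: "(\<Sum>i<Suc y. w i) = cum w y" for y by (simp add: cum_def lessThan_Suc_atMost)
  show ?thesis
  proof
    assume "draw w Y v = y"
    then have "y = j" using draw by simp
    then show "(\<Sum>i<y. w i) \<le> v \<and> v < cum w y"
      using j below lt by (cases j) auto
  next
    assume a: "(\<Sum>i<y. w i) \<le> v \<and> v < cum w y"
    have "j \<le> y" unfolding j_def using a by (intro Least_le) simp
    moreover have "\<not> j < y"
    proof
      assume "j < y"
      then have "cum w j \<le> (\<Sum>i<y. w i)" unfolding cum_def by (intro sum_mono2) auto
      then show False using a j by simp
    qed
    ultimately show "draw w Y v = y" using draw by simp
  qed
qed

lemma card_draw:
  assumes y: "y < Y"
  shows "card {v. v < (\<Sum>i<Y. w i) \<and> draw w Y v = y} = w y"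
proof -
  have "cum w y \<le> (\<Sum>i<Y. w i)" unfolding cum_def using y by (intro sum_mono2) auto
  moreover have "v < (\<Sum>i<Y. w i) \<Longrightarrow> draw w Y v = y \<longleftrightarrow> (\<Sum>i<y. w i) \<le> v \<and> v < cum w y" for v
    by (rule draw_eq_iff[OF _ y])
  ultimately have "v < (\<Sum>i<Y. w i) \<and> draw w Y v = y \<longleftrightarrow> (\<Sum>i<y. w i) \<le> v \<and> v < cum w y" for v
    by (cases "v < (\<Sum>i<Y. w i)") auto
  then have "{v. v < (\<Sum>i<Y. w i) \<and> draw w Y v = y} = {(\<Sum>i<y. w i)..<cum w y}"
    unfolding atLeastLessThan_def atLeast_def lessThan_def Collect_conj_eq[symmetric] by simp
  moreover have "cum w y = (\<Sum>i<y. w i) + w y" by (simp add: cum_def flip: lessThan_Suc_atMost)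
  ultimately show ?thesis by simp
qed

lemma draw_less:
  assumes v: "v < (\<Sum>i<Y. w i)"
  shows "draw w Y v < Y" "w (draw w Y v) > 0"
proof -
  obtain Y' where Y': "Y = Suc Y'" using v by (cases Y) auto
  have "v < cum w Y'" using v by (simp add: cum_def Y' lessThan_Suc_atMost)
  then have "{y. y < Y \<and> cum w y \<le> v} \<subseteq> {..<Y'}" by (auto simp: Y' less_Suc_eq)
  then have "card {y. y < Y \<and> cum w y \<le> v} \<le> card {..<Y'}" by (intro card_mono) auto
  then show "draw w Y v < Y" by (simp add: draw_def Y')
  from draw_eq_iff[OF v this] have "(\<Sum>i<draw w Y v. w i) \<le> v \<and> v < cum w (draw w Y v)" by simp
  moreover have "cum w y = (\<Sum>i<y. w i) + w y" for y by (simp add: cum_def flip: lessThan_Suc_atMost)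
  ultimately show "w (draw w Y v) > 0" by (metis add_0_right bot_nat_0.not_eq_extremum leD)
qed

section \<open>The hypothesis given by weights on blocks\<close>

lemma pair_pmf_of_set:
  assumes "finite A" "A \<noteq> {}" "finite B" "B \<noteq> {}"
  shows "pair_pmf (pmf_of_set A) (pmf_of_set B) = pmf_of_set (A \<times> B)"
proof (rule pmf_eqI)
  fix z show "pmf (pair_pmf (pmf_of_set A) (pmf_of_set B)) z = pmf (pmf_of_set (A \<times> B)) z"
    using assms by (cases z) (simp add: pmf_pair indicator_def card_cartesian_product)
qed

text \<open>The point at offset v in the block coded by y; the inverse of taking the cell of x and
  the offset \<open>x div L mod g\<close>.\<close>

definition spread :: "nat \<Rightarrow> nat \<Rightarrow> nat \<Rightarrow> nat \<Rightarrow> nat" where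
  "spread L g y v = L * (g * (y div L) + v) + y mod L"

definition hyp_law :: "nat \<Rightarrow> nat \<Rightarrow> nat \<Rightarrow> (nat \<Rightarrow> nat) \<Rightarrow> nat pmf" where
  "hyp_law L g Y w = map_pmf (\<lambda>(r, v). spread L g (draw w Y r) v)
     (pair_pmf (pmf_of_set {..<(\<Sum>i<Y. w i)}) (pmf_of_set {..<g}))"

lemma spread_eq_iff:
  assumes L: "L > 0" and g: "g > 0" and v: "v < g"
  shows "spread L g y v = x \<longleftrightarrow> y = (x div L div g) * L + x mod L \<and> v = x div L mod g"
proof
  assume x: "spread L g y v = x"
  have "x mod L = y mod L" using L by (auto simp: spread_def simp flip: x)
  moreover have xd: "x div L = g * (y div L) + v" using L by (auto simp: spread_def simp flip: x)
  moreover have "x div L div g = y div L" "x div L mod g = v" unfolding xd using v by simp_all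
  ultimately show "y = (x div L div g) * L + x mod L \<and> v = x div L mod g" by simp
next
  assume "y = (x div L div g) * L + x mod L \<and> v = x div L mod g"
  then show "spread L g y v = x" using L by (simp add: spread_def)
qed

text \<open>The weights are close to p after division by T, but sampling divides by their actual
  total W. Summing the pointwise errors gives \<open>\<bar>1 - W / T\<bar> \<le> \<delta>\<close>,
  so renormalising adds at most another \<open>\<delta>\<close> to the L1 error, and the factor 1/2
  in total variation brings the result back to \<open>\<delta>\<close>.\<close>

lemma hyp_law_bound:
  fixes p :: "nat pmf"
  assumes L: "L > 0" and g: "g > 0" and h: "h > 0" and Y: "h * L \<le> Y" and T: "T > 0"
    and w0: "\<And>y. y \<ge> h * L \<Longrightarrow> w y = 0"
    and p: "set_pmf p \<subseteq> {..<L * (g * h)}"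
    and close: "(\<Sum>x<L * (g * h). \<bar>pmf p x - real (w (cell L g h x)) / (T * real g)\<bar>) \<le> \<delta>" and d: "\<delta> < 1"
  shows "(\<Sum>i<Y. w i) > 0" and "tv_dist p (hyp_law L g Y w) \<le> \<delta>"
    and "real (\<Sum>i<Y. w i) \<le> (1 + \<delta>) * T"
proof -
  define M where "M = L * (g * h)"
  define W where "W = (\<Sum>i<Y. w i)"
  have p': "set_pmf p \<subseteq> {..<M}" using p by (simp add: M_def)
  have cell: "cell L g h x = (x div L div g) * L + x mod L" if "x < M" for x
    using that by (simp add: cell_def block_index_def M_def)
  \<comment> \<open>Points below M correspond bijectively to pairs of a cell and an offset, so each
    cell is counted g times.\<close>
  have sumw: "(\<Sum>x<M. w (cell L g h x)) = g * W"
  proof -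
    have "(\<Sum>x<M. w (cell L g h x)) = (\<Sum>(y, v)\<in>{..<h * L} \<times> {..<g}. w y)"
    proof (rule sum.reindex_bij_witness[of _ "\<lambda>(y, v). spread L g y v" "\<lambda>x. (cell L g h x, x div L mod g)"])
      fix x assume "x \<in> {..<M}"
      then show "(case (cell L g h x, x div L mod g) of (y, v) \<Rightarrow> spread L g y v) = x"
        using spread_eq_iff[OF L g, of "x div L mod g" "cell L g h x" x] g cell by simp
    next
      fix x assume "x \<in> {..<M}"
      then show "(cell L g h x, x div L mod g) \<in> {..<h * L} \<times> {..<g}"
        using cell_less[OF L g h] g by simp
    next
      fix a assume "a \<in> {..<h * L} \<times> {..<g}"
      then obtain y v where a: "a = (y, v)" "y < h * L" "v < g" by auto
      define x where "x = spread L g y v"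
      have xe: "y = (x div L div g) * L + x mod L" "v = x div L mod g"
        using spread_eq_iff[OF L g a(3), of y x] by (auto simp: x_def)
      have "y div L < h" using a(2) by (simp add: less_mult_imp_div_less)
      then have "x div L div g < h" using xe(1) L by simp
      then have "x div L < g * h" using g by (simp add: div_less_iff_less_mult mult.commute)
      then have xM: "x < M" using L by (simp add: M_def div_less_iff_less_mult mult.commute)
      show "(case a of (y, v) \<Rightarrow> spread L g y v) \<in> {..<M}" using xM by (simp add: a x_def)
      show "(cell L g h (case a of (y, v) \<Rightarrow> spread L g y v), (case a of (y, v) \<Rightarrow> spread L g y v) div L mod g) = a"
      proof -
        have "cell L g h x = y" by (rule trans[OF cell[OF xM] xe(1)[symmetric]])
        then show ?thesis by (simp add: a(1) xe(2)[symmetric] flip: x_def)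
      qed
    qed auto
    also have "\<dots> = (\<Sum>y<h * L. \<Sum>v<g. w y)" by (simp only: sum.cartesian_product)
    also have "\<dots> = g * (\<Sum>y<h * L. w y)" by (simp add: sum_distrib_left)
    also have "(\<Sum>y<h * L. w y) = W"
      unfolding W_def using Y w0 by (intro sum.mono_neutral_left) auto
    finally show ?thesis .
  qed
  have psum: "(\<Sum>x<M. pmf p x) = 1" using p' by (intro sum_pmf_eq_1) auto
  have wsum: "(\<Sum>x<M. real (w (cell L g h x)) / (T * real g)) = real W / T"
  proof -
    have "(\<Sum>x<M. real (w (cell L g h x)) / (T * real g)) = real (\<Sum>x<M. w (cell L g h x)) / (T * real g)"
      by (simp add: sum_divide_distrib)
    then show ?thesis using g by (simp add: sumw)
  qed
  have "\<bar>1 - real W / T\<bar> = \<bar>\<Sum>x<M. pmf p x - real (w (cell L g h x)) / (T * real g)\<bar>"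
    by (simp only: sum_subtractf psum wsum)
  also have "\<dots> \<le> \<delta>" using close unfolding M_def by (intro order.trans[OF sum_abs])
  finally have W1: "\<bar>1 - real W / T\<bar> \<le> \<delta>" .
  then have "real W / T > 0" using d by linarith
  then have W: "W > 0" using T by (simp add: zero_less_divide_iff)
  then show "(\<Sum>i<Y. w i) > 0" by (simp add: W_def)
  have "real W / T \<le> 1 + \<delta>" using W1 by linarith
  then show "real (\<Sum>i<Y. w i) \<le> (1 + \<delta>) * T" using T by (simp add: W_def field_simps)
  let ?H = "hyp_law L g Y w"
  have ne: "{..<W} \<noteq> {}" "{..<g} \<noteq> {}" using W g by auto
  have H: "?H = map_pmf (\<lambda>(r, v). spread L g (draw w Y r) v) (pmf_of_set ({..<W} \<times> {..<g}))"
    unfolding hyp_law_def W_def[symmetric] using ne by (simp add: pair_pmf_of_set)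
  have pmfH: "pmf ?H x = real (w (cell L g h x)) / (real W * real g)" if x: "x < M" for x
  proof -
    have cY: "cell L g h x < Y" using cell_less[OF L g h, of x] Y by linarith
    have "pmf ?H x = (\<Sum>z | z \<in> {..<W} \<times> {..<g} \<and> (\<lambda>(r, v). spread L g (draw w Y r) v) z = x. pmf (pmf_of_set ({..<W} \<times> {..<g})) z)"
      unfolding H using ne by (intro pmf_map_finite) (auto simp: set_pmf_of_set)
    also have "\<dots> = (\<Sum>z | z \<in> {..<W} \<times> {..<g} \<and> (\<lambda>(r, v). spread L g (draw w Y r) v) z = x. 1 / (real W * real g))"
      using ne by (intro sum.cong refl) (auto simp: card_cartesian_product)
    also have "{z. z \<in> {..<W} \<times> {..<g} \<and> (\<lambda>(r, v). spread L g (draw w Y r) v) z = x}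
        = {r. r < W \<and> draw w Y r = cell L g h x} \<times> {x div L mod g}"
      using spread_eq_iff[OF L g] g by (auto simp: cell[OF x])
    finally show ?thesis
      using card_draw[OF cY, of w] by (simp add: card_cartesian_product W_def)
  qed
  have setH: "set_pmf ?H \<subseteq> {..<M}"
  proof -
    have "spread L g (draw w Y r) v < M" if "r < W" "v < g" for r v
    proof -
      have "\<not> draw w Y r \<ge> h * L" using draw_less(2)[of r w Y] w0[of "draw w Y r"] that by (auto simp: W_def)
      then have "draw w Y r div L < h" by (simp add: less_mult_imp_div_less)
      then have "(draw w Y r div L + 1) * g \<le> h * g" by (intro mult_right_mono) auto
      then have "g * (draw w Y r div L) + v + 1 \<le> g * h" using that(2) by (simp add: algebra_simps)
      then have "L * (g * (draw w Y r div L) + v + 1) \<le> L * (g * h)" by (intro mult_left_mono) auto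
      moreover have "draw w Y r mod L < L" using L by simp
      ultimately show ?thesis by (simp add: spread_def M_def algebra_simps)
    qed
    then show ?thesis unfolding H using ne by (auto simp: set_pmf_of_set)
  qed
  have "(\<Sum>x<M. \<bar>pmf p x - pmf ?H x\<bar>)
      \<le> (\<Sum>x<M. \<bar>pmf p x - real (w (cell L g h x)) / (T * real g)\<bar> + real (w (cell L g h x)) / (T * real g) * \<bar>1 - T / real W\<bar>)"
  proof (intro sum_mono)
    fix x assume "x \<in> {..<M}"
    then have "real (w (cell L g h x)) / (T * real g) - pmf ?H x = real (w (cell L g h x)) / (T * real g) * (1 - T / real W)"
      using T W g by (simp add: pmfH field_simps)
    then have "\<bar>real (w (cell L g h x)) / (T * real g) - pmf ?H x\<bar> = real (w (cell L g h x)) / (T * real g) * \<bar>1 - T / real W\<bar>"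
      using T by (simp add: abs_mult)
    then show "\<bar>pmf p x - pmf ?H x\<bar> \<le> \<bar>pmf p x - real (w (cell L g h x)) / (T * real g)\<bar> + real (w (cell L g h x)) / (T * real g) * \<bar>1 - T / real W\<bar>"
      by linarith
  qed
  also have "\<dots> = (\<Sum>x<M. \<bar>pmf p x - real (w (cell L g h x)) / (T * real g)\<bar>) + real W / T * \<bar>1 - T / real W\<bar>"
    by (simp only: sum.distrib wsum sum_distrib_right[symmetric])
  also have "real W / T * \<bar>1 - T / real W\<bar> = \<bar>real W / T * (1 - T / real W)\<bar>"
    using T by (simp add: abs_mult)
  also have "real W / T * (1 - T / real W) = real W / T - 1" using T W by (simp add: field_simps)
  also have "(\<Sum>x<M. \<bar>pmf p x - real (w (cell L g h x)) / (T * real g)\<bar>) + \<bar>real W / T - 1\<bar> \<le> \<delta> + \<delta>"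
    using close W1 by (simp add: M_def abs_minus_commute)
  finally show "tv_dist p ?H \<le> \<delta>"
    using p' setH by (subst tv_dist_finite[of "{..<M}"]) auto
qed

section \<open>Straight-line programs on the word RAM\<close>

datatype expr = Num nat | Var nat | Bin operation expr expr

text \<open>Straight-line code: the value of an expression is left in cell \<open>t\<close>, and cells above \<open>t\<close> serve as a stack.\<close>

fun compile :: "expr \<Rightarrow> nat \<Rightarrow> instr list" where
  "compile (Num c) t = [SetConst t c]"
| "compile (Var a) t = [Compute BitOr t a a]"
| "compile (Bin f e1 e2) t = compile e1 t @ compile e2 (Suc t) @ [Compute f t t (Suc t)]"

fun eval :: "nat \<Rightarrow> expr \<Rightarrow> (nat \<Rightarrow> nat) \<Rightarrow> nat" where
  "eval w (Num c) s = c mod 2 ^ w"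
| "eval w (Var a) s = s a mod 2 ^ w"
| "eval w (Bin f e1 e2) s = apply_operation w f (eval w e1 s) (eval w e2 s) mod 2 ^ w"

fun depth :: "expr \<Rightarrow> nat" where
  "depth (Num c) = 0"
| "depth (Var a) = 0"
| "depth (Bin f e1 e2) = max (depth e1) (Suc (depth e2))"

fun vars :: "expr \<Rightarrow> nat set" where
  "vars (Num c) = {}"
| "vars (Var a) = {a}"
| "vars (Bin f e1 e2) = vars e1 \<union> vars e2"

datatype stmt = Assign nat expr | Draw nat | Toss nat

text \<open>The bitwise disjunction of a word with itself serves as a move instruction. Cell 1 is
  the bottom of the evaluation stack.\<close>

fun compile_stmt :: "stmt \<Rightarrow> instr list" where
  "compile_stmt (Assign a e) = compile e 1 @ [Compute BitOr a 1 1]"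
| "compile_stmt (Draw a) = [Sample a]"
| "compile_stmt (Toss a) = [Random a]"

definition compile_prog :: "stmt list \<Rightarrow> instr list" where
  "compile_prog ps = concat (map compile_stmt ps)"

section \<open>Execution of code without jumps\<close>

fun jump_free :: "instr \<Rightarrow> bool" where
  "jump_free (Jump l) = False"
| "jump_free (JumpLess a b l) = False"
| "jump_free _ = True"

fun is_sample :: "instr \<Rightarrow> bool" where
  "is_sample (Sample a) = True"
| "is_sample _ = False"

text \<open>Without jumps, the change of memory depends neither on the program counter nor on the
  number of samples, so both are set to 0.\<close>

definition mem_step :: "nat \<Rightarrow> nat pmf \<Rightarrow> instr \<Rightarrow> (nat \<Rightarrow> nat) \<Rightarrow> (nat \<Rightarrow> nat) pmf" where
  "mem_step w P i m = map_pmf mem (exec_instr w P i \<lparr>pc = 0, mem = m, samples_used = 0\<rparr>)"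

primrec mem_run :: "nat \<Rightarrow> nat pmf \<Rightarrow> instr list \<Rightarrow> (nat \<Rightarrow> nat) \<Rightarrow> (nat \<Rightarrow> nat) pmf" where
  "mem_run w P [] m = return_pmf m"
| "mem_run w P (i # is) m = bind_pmf (mem_step w P i m) (mem_run w P is)"

lemma exec_instr_mem_step:
  assumes "jump_free i"
  shows "exec_instr w P i \<lparr>pc = p, mem = m, samples_used = u\<rparr>
    = map_pmf (\<lambda>m'. \<lparr>pc = Suc p, mem = m', samples_used = u + of_bool (is_sample i)\<rparr>) (mem_step w P i m)"
  using assms by (cases i) (simp_all add: mem_step_def put_def fetch_def pmf.map_comp o_def)

lemma run_halted: "halted prog \<sigma> \<Longrightarrow> run w P prog t \<sigma> = return_pmf \<sigma>"
  by (induction t) (simp_all add: ram_step_def bind_return_pmf)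

text \<open>The program is split at the program counter to allow induction on the rest; the j
  surplus steps are spent in the halted state.\<close>

lemma run_jump_free_from:
  assumes "\<forall>i\<in>set post. jump_free i"
  shows "run w P (pre @ post) (length post + j) \<lparr>pc = length pre, mem = m, samples_used = u\<rparr>
    = map_pmf (\<lambda>m'. \<lparr>pc = length pre + length post, mem = m', samples_used = u + length (filter is_sample post)\<rparr>) (mem_run w P post m)"
  using assms
proof (induction post arbitrary: pre m u)
  case Nil
  then show ?case by (simp add: run_halted halted_def)
next
  case (Cons i post)
  have "run w P (pre @ i # post) (length (i # post) + j) \<lparr>pc = length pre, mem = m, samples_used = u\<rparr>
      = bind_pmf (exec_instr w P i \<lparr>pc = length pre, mem = m, samples_used = u\<rparr>) (run w P (pre @ i # post) (length post + j))"
    by (simp add: ram_step_def halted_def nth_append)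
  also have "\<dots> = bind_pmf (mem_step w P i m) (\<lambda>m'. run w P ((pre @ [i]) @ post) (length post + j)
      \<lparr>pc = length (pre @ [i]), mem = m', samples_used = u + of_bool (is_sample i)\<rparr>)"
    using Cons.prems by (simp add: exec_instr_mem_step bind_map_pmf)
  also have "\<dots> = bind_pmf (mem_step w P i m) (\<lambda>m'. map_pmf (\<lambda>m''. \<lparr>pc = length (pre @ [i]) + length post, mem = m'',
      samples_used = u + of_bool (is_sample i) + length (filter is_sample post)\<rparr>) (mem_run w P post m'))"
    using Cons.prems by (subst Cons.IH) auto
  finally show ?case by (simp add: map_bind_pmf add.assoc)
qed

lemma run_jump_free:
  assumes "\<forall>i\<in>set prog. jump_free i" "length prog \<le> T"
  shows "run w P prog T \<lparr>pc = 0, mem = m, samples_used = u\<rparr>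
    = map_pmf (\<lambda>m'. \<lparr>pc = length prog, mem = m', samples_used = u + length (filter is_sample prog)\<rparr>) (mem_run w P prog m)"
  using run_jump_free_from[OF assms(1), of w P "[]" "T - length prog" m u] assms(2) by simp

lemma jump_free_compile: "i \<in> set (compile e t) \<Longrightarrow> jump_free i \<and> \<not> is_sample i"
  by (induction e t rule: compile.induct) auto

lemma jump_free_compile_prog: "\<forall>i\<in>set (compile_prog ps). jump_free i"
proof -
  have "jump_free i" if "i \<in> set (compile_stmt p)" for i p
    using that jump_free_compile by (cases p) auto
  then show ?thesis by (auto simp: compile_prog_def)
qed

fun is_draw :: "stmt \<Rightarrow> bool" where
  "is_draw (Draw a) = True"
| "is_draw _ = False"

lemma samples_compile_prog: "length (filter is_sample (compile_prog ps)) = length (filter is_draw ps)"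
proof -
  have "filter is_sample (compile e t) = []" for e t
    using jump_free_compile by (auto simp: filter_empty_conv)
  then have "length (filter is_sample (compile_stmt p)) = of_bool (is_draw p)" for p
    by (cases p) auto
  then show ?thesis by (induction ps) (auto simp: compile_prog_def)
qed

lemma mem_run_append: "mem_run w P (is @ js) m = bind_pmf (mem_run w P is m) (mem_run w P js)"
proof (induction "is" arbitrary: m)
  case (Cons i "is")
  have "mem_run w P (is @ js) = (\<lambda>m. bind_pmf (mem_run w P is m) (mem_run w P js))"
    by (rule ext) (rule Cons)
  then show ?case by (simp add: bind_assoc_pmf)
qed (simp add: bind_return_pmf)

text \<open>Cells 1 to 63 are reserved for the evaluation stack.\<close>

definition user_cell :: "nat \<Rightarrow> nat \<Rightarrow> bool" where
  "user_cell w a \<longleftrightarrow> a < 2 ^ w \<and> (a = 0 \<or> 64 \<le> a)"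

lemma eval_cong: "(\<And>a. a \<in> vars e \<Longrightarrow> s a = s' a) \<Longrightarrow> eval w e s = eval w e s'"
  by (induction e) auto

lemma eval_less: "eval w e s < 2 ^ w"
  by (cases e) auto

text \<open>Evaluation at height t writes only to cells from t to 63. Variables are user cells, so
  evaluating the first operand does not disturb the second, and the second is evaluated above the
  cell that holds the first result.\<close>

lemma mem_run_compile:
  assumes "\<forall>a\<in>vars e. user_cell w a" "0 < t" "t + depth e < 64" "64 \<le> (2 :: nat) ^ w"
  shows "\<exists>m'. mem_run w P (compile e t) m = return_pmf m' \<and> m' t = eval w e m
    \<and> (\<forall>a. a < t \<or> 64 \<le> a \<longrightarrow> m' a = m a)"
  using assms
proof (induction e t arbitrary: m rule: compile.induct)
  case (1 c t)
  then have "t mod 2 ^ w = t" by simp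
  then show ?case using 1 by (auto simp: mem_step_def put_def bind_return_pmf)
next
  case (2 a t)
  then have "t mod 2 ^ w = t" "a mod 2 ^ w = a" by (auto simp: user_cell_def)
  then show ?case using 2 by (auto simp: mem_step_def put_def fetch_def bind_return_pmf)
next
  case (3 f e1 e2 t)
  have d: "t + depth e1 < 64" "Suc t + depth e2 < 64" using 3(5) by auto
  have v: "\<forall>a\<in>vars e1. user_cell w a" "\<forall>a\<in>vars e2. user_cell w a" using 3(3) by auto
  obtain m1 where m1: "mem_run w P (compile e1 t) m = return_pmf m1" "m1 t = eval w e1 m"
    "\<And>a. a < t \<or> 64 \<le> a \<Longrightarrow> m1 a = m a"
    using 3(1)[OF v(1) 3(4) d(1) 3(6), of m] by auto
  obtain m2 where m2: "mem_run w P (compile e2 (Suc t)) m1 = return_pmf m2" "m2 (Suc t) = eval w e2 m1"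
    "\<And>a. a < Suc t \<or> 64 \<le> a \<Longrightarrow> m2 a = m1 a"
    using 3(2)[OF v(2) _ d(2) 3(6), of m1] by auto
  have e2: "eval w e2 m1 = eval w e2 m"
    using v(2) 3(4) by (intro eval_cong m1(3)) (auto simp: user_cell_def)
  have "t mod 2 ^ w = t" "Suc t mod 2 ^ w = Suc t" using 3(5,6) by auto
  moreover have "m2 t = eval w e1 m" using m1 m2 by simp
  ultimately have "mem_run w P (compile (Bin f e1 e2) t) m = return_pmf (m2(t := eval w (Bin f e1 e2) m))"
    using m2(2) e2 by (simp add: mem_run_append bind_return_pmf m1(1) m2(1) mem_step_def put_def fetch_def)
  moreover define m3 where "m3 = m2(t := eval w (Bin f e1 e2) m)"
  moreover have "\<forall>a. a < t \<or> 64 \<le> a \<longrightarrow> m3 a = m a"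
    using m1(3) m2(3) 3(5) by (auto simp: m3_def)
  moreover have "m3 t = eval w (Bin f e1 e2) m" by (simp add: m3_def)
  ultimately show ?case by metis
qed

text \<open>The semantics of statements has no evaluation stack. Resetting the stack cells to 0
  makes both semantics agree as distributions on memories.\<close>

definition strip :: "(nat \<Rightarrow> nat) \<Rightarrow> nat \<Rightarrow> nat" where
  "strip m = (\<lambda>a. if a \<in> {1..63} then 0 else m a)"

fun srun :: "nat \<Rightarrow> nat pmf \<Rightarrow> stmt list \<Rightarrow> (nat \<Rightarrow> nat) \<Rightarrow> (nat \<Rightarrow> nat) pmf" where
  "srun w P [] s = return_pmf s"
| "srun w P (Assign a e # ps) s = srun w P ps (s(a := eval w e s))"
| "srun w P (Draw a # ps) s = bind_pmf P (\<lambda>x. srun w P ps (s(a := x mod 2 ^ w)))"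
| "srun w P (Toss a # ps) s = bind_pmf (pmf_of_set {..<2 ^ w}) (\<lambda>x. srun w P ps (s(a := x mod 2 ^ w)))"

lemma srun_simps:
  "srun w P (Assign a e # ps) s = srun w P ps (s(a := eval w e s))"
  "srun w P (Draw a # ps) s = bind_pmf P (\<lambda>x. srun w P ps (s(a := x mod 2 ^ w)))"
  "srun w P (Toss a # ps) s = bind_pmf (pmf_of_set {..<2 ^ w}) (\<lambda>x. srun w P ps (s(a := x mod 2 ^ w)))"
  by (simp_all add: fun_upd_def)

declare srun.simps(2-4) [simp del] srun_simps [simp]

fun wf_stmt :: "nat \<Rightarrow> stmt \<Rightarrow> bool" where
  "wf_stmt w (Assign a e) \<longleftrightarrow> user_cell w a \<and> (\<forall>b\<in>vars e. user_cell w b) \<and> depth e < 60"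
| "wf_stmt w (Draw a) \<longleftrightarrow> user_cell w a"
| "wf_stmt w (Toss a) \<longleftrightarrow> user_cell w a"

lemma strip_update: "user_cell w a \<Longrightarrow> strip (m(a := x)) = (strip m)(a := x)"
  by (auto simp: strip_def user_cell_def fun_eq_iff)

lemma mem_run_compile_prog:
  assumes "\<forall>p\<in>set ps. wf_stmt w p" "64 \<le> (2 :: nat) ^ w"
  shows "map_pmf strip (mem_run w P (compile_prog ps) m) = srun w P ps (strip m)"
  using assms(1)
proof (induction ps arbitrary: m)
  case (Cons p ps)
  have split: "compile_prog (p # ps) = compile_stmt p @ compile_prog ps" by (simp add: compile_prog_def)
  have IH: "map_pmf strip (mem_run w P (compile_prog ps) m) = srun w P ps (strip m)" for m
    using Cons by auto
  show ?case
  proof (cases p)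
    case (Assign a e)
    have wf: "user_cell w a" "\<forall>b\<in>vars e. user_cell w b" "depth e < 60" using Cons.prems Assign by auto
    obtain m' where m': "mem_run w P (compile e 1) m = return_pmf m'" "m' 1 = eval w e m"
      "\<And>b. b < 1 \<or> 64 \<le> b \<Longrightarrow> m' b = m b"
      using mem_run_compile[OF wf(2), of 1 P m] wf(3) assms(2) by auto
    have "1 < (2 :: nat) ^ w" using assms(2) by linarith
    then have a: "a mod 2 ^ w = a" "1 mod (2 :: nat) ^ w = 1"
      using wf(1) by (simp_all only: user_cell_def mod_less)
    have ev: "eval w e m = eval w e (strip m)"
      using wf(2) by (intro eval_cong) (auto simp: strip_def user_cell_def)
    have "mem_run w P (compile_stmt p) m = return_pmf (m'(a := eval w e m))"
      using m' a eval_less[of w e m]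
      by (simp add: Assign mem_run_append bind_return_pmf mem_step_def put_def fetch_def del: One_nat_def)
    moreover have "strip m' = strip m"
      using m'(3) by (auto simp: strip_def fun_eq_iff)
    then have "strip (m'(a := eval w e m)) = (strip m)(a := eval w e (strip m))"
      using ev by (simp add: strip_update[OF wf(1)])
    ultimately have "map_pmf strip (mem_run w P (compile_prog (p # ps)) m)
        = srun w P ps ((strip m)(a := eval w e (strip m)))"
      unfolding split mem_run_append by (simp only: bind_return_pmf IH)
    then show ?thesis by (simp add: Assign)
  next
    case (Draw a)
    then have wf: "user_cell w a" using Cons.prems by auto
    then have "a mod 2 ^ w = a" by (simp add: user_cell_def)
    moreover have "compile_prog (Draw a # ps) = Sample a # compile_prog ps" by (simp add: compile_prog_def)
    ultimately show ?thesis
      by (simp add: Draw mem_step_def put_def map_bind_pmf bind_map_pmf pmf.map_comp o_def IH strip_update[OF wf])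
  next
    case (Toss a)
    then have wf: "user_cell w a" using Cons.prems by auto
    then have "a mod 2 ^ w = a" by (simp add: user_cell_def)
    moreover have "compile_prog (Toss a # ps) = Random a # compile_prog ps" by (simp add: compile_prog_def)
    ultimately show ?thesis
      by (simp add: Toss mem_step_def put_def map_bind_pmf bind_map_pmf pmf.map_comp o_def IH strip_update[OF wf])
  qed
qed (simp add: compile_prog_def)

text \<open>The deterministic part of the semantics, meant for lists of assignments; randomness
  enters only by draws and tosses between such lists.\<close>

fun dexec :: "nat \<Rightarrow> stmt list \<Rightarrow> (nat \<Rightarrow> nat) \<Rightarrow> nat \<Rightarrow> nat" where
  "dexec w [] s = s"
| "dexec w (Assign a e # ps) s = dexec w ps (s(a := eval w e s))"
| "dexec w (p # ps) s = dexec w ps s"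

lemma dexec_Assign: "dexec w (Assign a e # ps) s = dexec w ps (s(a := eval w e s))"
  by (simp add: fun_upd_def)

declare dexec.simps(2) [simp del] dexec_Assign [simp]

fun is_assign :: "stmt \<Rightarrow> bool" where
  "is_assign (Assign a e) = True"
| "is_assign _ = False"

lemma srun_append: "srun w P (ps @ qs) s = bind_pmf (srun w P ps s) (srun w P qs)"
proof (induction ps arbitrary: s)
  case (Cons p ps)
  then show ?case by (cases p) (simp_all add: bind_assoc_pmf fun_upd_def)
qed (simp add: bind_return_pmf)

lemma srun_assigns: "\<forall>p\<in>set ps. is_assign p \<Longrightarrow> srun w P ps s = return_pmf (dexec w ps s)"
proof (induction ps arbitrary: s)
  case (Cons p ps)
  then show ?case by (cases p) simp_all
qed simp

lemma dexec_append: "dexec w (ps @ qs) s = dexec w qs (dexec w ps s)"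
proof (induction ps arbitrary: s)
  case (Cons p ps)
  then show ?case by (cases p) (simp_all add: fun_upd_def)
qed simp

text \<open>The body after each draw is deterministic, so all randomness can be drawn in advance as
  a list of independent samples. The learner thereby becomes a function of sample lists, to which
  the estimates for \<open>replicate_pmf\<close> apply.\<close>

lemma srun_draw_loop:
  assumes "\<forall>p\<in>set blk. is_assign p"
  shows "srun w P (concat (replicate m (Draw a # blk))) s
    = map_pmf (foldl (\<lambda>s x. dexec w blk (s(a := x mod 2 ^ w))) s) (replicate_pmf m P)"
proof (induction m arbitrary: s)
  case (Suc m)
  then show ?case
    using assms
    by (simp add: srun_append srun_assigns bind_assoc_pmf bind_return_pmf map_pmf_def fun_upd_def)
qed simp

section \<open>The learner and the generator as programs\<close>

lemma eval_Num: "c < 2 ^ w \<Longrightarrow> eval w (Num c) s = c"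
  by simp

lemma eval_Var: "s a = x \<Longrightarrow> x < 2 ^ w \<Longrightarrow> eval w (Var a) s = x"
  by simp

lemma eval_Add: "eval w e1 s = x \<Longrightarrow> eval w e2 s = y \<Longrightarrow> x + y < 2 ^ w \<Longrightarrow> eval w (Bin Add e1 e2) s = x + y"
  by simp

lemma eval_Mult: "eval w e1 s = x \<Longrightarrow> eval w e2 s = y \<Longrightarrow> x * y < 2 ^ w \<Longrightarrow> eval w (Bin Mult e1 e2) s = x * y"
  by simp

lemma eval_Sub:
  assumes "eval w e1 s = x" "eval w e2 s = y" "y \<le> x"
  shows "eval w (Bin Sub e1 e2) s = x - y"
proof -
  have "x < 2 ^ w" using eval_less[of w e1 s] assms by simp
  then have "(x + 2 ^ w - y) mod 2 ^ w = (x - y) mod 2 ^ w" using assms(3)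
    by (metis Nat.add_diff_assoc2 mod_add_self2)
  also have "\<dots> = x - y" using \<open>x < 2 ^ w\<close> by simp
  finally show ?thesis using assms by simp
qed

lemma eval_Divide:
  assumes "eval w e1 s = x" "eval w e2 s = y"
  shows "eval w (Bin Divide e1 e2) s = x div y"
proof -
  have "x div y < 2 ^ w" using eval_less[of w e1 s] assms div_le_dividend[of x y] by linarith
  then show ?thesis using assms by simp
qed

lemma eval_Modulo:
  assumes "eval w e1 s = x" "eval w e2 s = y"
  shows "eval w (Bin Modulo e1 e2) s = x mod y"
proof -
  have "x mod y < 2 ^ w" using eval_less[of w e1 s] assms mod_less_eq_dividend[of x y] by linarith
  then show ?thesis using assms by simp
qed

text \<open>Comparison without jumps: \<open>q = (y + 1) div (x + 1)\<close> is positive iff \<open>x \<le> y\<close>, and \<open>q div q\<close> is 1 or 0 accordingly,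
  as \<open>0 div 0 = 0\<close>.\<close>

definition Leq :: "expr \<Rightarrow> expr \<Rightarrow> expr" where
  "Leq e1 e2 = (let q = Bin Divide (Bin Add e2 (Num 1)) (Bin Add e1 (Num 1)) in Bin Divide q q)"

definition Eq :: "expr \<Rightarrow> expr \<Rightarrow> expr" where
  "Eq e1 e2 = Bin Mult (Leq e1 e2) (Leq e2 e1)"

text \<open>Machine subtraction wraps around where the true result would be negative; there the
  comparison bit multiplies it by 0.\<close>

definition Monus :: "expr \<Rightarrow> expr \<Rightarrow> expr" where
  "Monus e1 e2 = Bin Mult (Bin Sub e1 e2) (Leq e2 e1)"

lemma eval_Leq:
  assumes "eval w e1 s = x" "eval w e2 s = y" "x + 1 < 2 ^ w" "y + 1 < 2 ^ w"
  shows "eval w (Leq e1 e2) s = of_bool (x \<le> y)"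
proof -
  have "1 < (2 :: nat) ^ w" using assms(3) by linarith
  then have "eval w (Num 1) s = 1" by (rule eval_Num)
  then have q: "eval w (Bin Divide (Bin Add e2 (Num 1)) (Bin Add e1 (Num 1))) s = (y + 1) div (x + 1)"
    using assms by (intro eval_Divide eval_Add)
  have "eval w (Leq e1 e2) s = (y + 1) div (x + 1) div ((y + 1) div (x + 1))"
    unfolding Leq_def Let_def by (rule eval_Divide[OF q q])
  also have "\<dots> = of_bool (x \<le> y)"
  proof (cases "x \<le> y")
    case True
    then have "(y + 1) div (x + 1) > 0" by (simp add: div_greater_zero_iff)
    then show ?thesis using True by simp
  qed simp
  finally show ?thesis .
qed

lemma eval_Eq:
  assumes "eval w e1 s = x" "eval w e2 s = y" "x + 1 < 2 ^ w" "y + 1 < 2 ^ w"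
  shows "eval w (Eq e1 e2) s = of_bool (x = y)"
proof -
  have "eval w (Eq e1 e2) s = of_bool (x \<le> y) * of_bool (y \<le> x)"
    unfolding Eq_def using assms by (intro eval_Mult eval_Leq) auto
  then show ?thesis by auto
qed

lemma eval_Monus:
  assumes "eval w e1 s = x" "eval w e2 s = y" "x + 1 < 2 ^ w" "y + 1 < 2 ^ w"
  shows "eval w (Monus e1 e2) s = x - y"
proof (cases "y \<le> x")
  case True
  have "eval w (Monus e1 e2) s = (x - y) * of_bool (y \<le> x)"
    unfolding Monus_def using assms True by (intro eval_Mult eval_Leq eval_Sub) auto
  then show ?thesis using True by simp
next
  case False
  have "eval w (Leq e2 e1) s = of_bool (y \<le> x)" using assms by (intro eval_Leq)
  then show ?thesis using False by (simp add: Monus_def)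
qed

section \<open>Memory layout and program text\<close>

abbreviation (input) "cOut \<equiv> (0 :: nat)"
abbreviation (input) "cLo \<equiv> (64 :: nat)"
abbreviation (input) "cHi \<equiv> (65 :: nat)"
abbreviation (input) "cG \<equiv> (66 :: nat)"
abbreviation (input) "cH \<equiv> (67 :: nat)"
abbreviation (input) "cM \<equiv> (68 :: nat)"
abbreviation (input) "cX \<equiv> (69 :: nat)"
abbreviation (input) "cKey \<equiv> (70 :: nat)"
abbreviation (input) "cTot \<equiv> (71 :: nat)"
abbreviation (input) "cR \<equiv> (72 :: nat)"
abbreviation (input) "cV \<equiv> (73 :: nat)"
abbreviation (input) "cIdx \<equiv> (74 :: nat)"
abbreviation (input) "cAcc y \<equiv> (80 :: nat) + y"

text \<open>Minimum and maximum without branches: with truncated subtraction they are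
  \<open>lo - (lo - x)\<close> and \<open>hi + (x - hi)\<close>.\<close>

definition scan_step :: "stmt list" where
  "scan_step = [Assign cLo (Bin Sub (Var cLo) (Monus (Var cLo) (Var cX))),
                Assign cHi (Bin Add (Var cHi) (Monus (Var cX) (Var cHi)))]"

text \<open>The width of the window is known only at run time, so the machine computes the block
  length and the number of blocks; only the bound G is a constant of the program.\<close>

definition setup_grid :: "nat \<Rightarrow> nat \<Rightarrow> stmt list" where
  "setup_grid L G =
    [Assign cG (Bin Add (Num 1) (Bin Divide (Bin Sub (Var cHi) (Var cLo)) (Num G))),
     Assign cH (Bin Add (Num 1) (Bin Divide (Bin Sub (Var cHi) (Var cLo)) (Var cG))),
     Assign cM (Bin Mult (Num L) (Bin Mult (Var cG) (Var cH)))]"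

text \<open>The pair of h and the cell of the sample, coded in base Y. The kernel depends on h, and
  h varies with the outcome of the first round, so it has to be part of the key.\<close>

definition key_expr :: "nat \<Rightarrow> nat \<Rightarrow> expr" where
  "key_expr L Y = Bin Add (Bin Mult (Var cH) (Num Y))
     (Bin Add (Bin Mult (Bin Divide (Bin Divide (Bin Modulo (Var cX) (Var cM)) (Num L)) (Var cG)) (Num L))
       (Bin Modulo (Var cX) (Num L)))"

text \<open>A table lookup as a sum over all keys, in which the equality test selects a single
  summand. The table exists only as constants in the code.\<close>

definition tally_cell :: "(nat \<Rightarrow> nat \<Rightarrow> nat) \<Rightarrow> nat \<Rightarrow> nat \<Rightarrow> stmt list" where
  "tally_cell tab K y = map (\<lambda>c. Assign (cAcc y)
     (Bin Add (Var (cAcc y)) (Bin Mult (Eq (Var cKey) (Num c)) (Num (tab c y))))) [0..<K]"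

definition tally_step :: "nat \<Rightarrow> nat \<Rightarrow> nat \<Rightarrow> (nat \<Rightarrow> nat \<Rightarrow> nat) \<Rightarrow> stmt list" where
  "tally_step L Y K tab = Assign cKey (key_expr L Y) # concat (map (tally_cell tab K) [0..<Y])"

text \<open>Each accumulator is overwritten by the running total of the clipped weights, the values
  with which \<open>search\<close> compares.\<close>

definition accumulate :: "nat \<Rightarrow> nat \<Rightarrow> stmt list" where
  "accumulate T Y = concat (map (\<lambda>y.
     [Assign cTot (Bin Add (Var cTot) (Monus (Var (cAcc y)) (Num T))), Assign (cAcc y) (Var cTot)]) [0..<Y])"

definition search :: "nat \<Rightarrow> stmt list" where
  "search Y = map (\<lambda>y. Assign cIdx (Bin Add (Var cIdx) (Leq (Var (cAcc y)) (Var cR)))) [0..<Y]"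

definition emit :: "nat \<Rightarrow> stmt list" where
  "emit L =
    [Assign cX (Bin Add (Bin Mult (Num L) (Bin Add (Bin Mult (Var cG) (Bin Divide (Var cIdx) (Num L))) (Var cV)))
                 (Bin Modulo (Var cIdx) (Num L))),
     Assign cOut (Bin Add (Var cLo)
       (Bin Modulo (Bin Sub (Bin Add (Var cX) (Var cM)) (Bin Modulo (Var cLo) (Var cM))) (Var cM)))]"

section \<open>Effect of the program segments on memory\<close>

lemma dexec_scan_step:
  assumes "s cLo = lo" "s cHi = hi" "s cX = x" "lo + 1 < 2 ^ w" "hi + 1 < 2 ^ w" "x + 1 < 2 ^ w"
  shows "dexec w scan_step s = s(cLo := min lo x, cHi := max hi x)"
proof -
  have 1: "eval w (Bin Sub (Var cLo) (Monus (Var cLo) (Var cX))) s = lo - (lo - x)"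
    using assms by (intro eval_Sub eval_Monus eval_Var) auto
  have 2: "eval w (Bin Add (Var cHi) (Monus (Var cX) (Var cHi))) (s(cLo := v)) = hi + (x - hi)" for v
    using assms by (intro eval_Add eval_Monus eval_Var) auto
  have "lo - (lo - x) = min lo x" "hi + (x - hi) = max hi x" by auto
  then show ?thesis by (simp add: scan_step_def 1 2 del: eval.simps)
qed

lemma scan_loop:
  assumes "\<forall>x\<in>set xs. x + 1 < 2 ^ w" "s cLo + 1 < 2 ^ w" "s cHi + 1 < 2 ^ w"
  shows "\<exists>z. foldl (\<lambda>s x. dexec w scan_step (s(cX := x mod 2 ^ w))) s xs
    = s(cX := z, cLo := fold min xs (s cLo), cHi := fold max xs (s cHi))"
  using assms
proof (induction xs arbitrary: s)
  case Nil
  have "s(cX := s cX, cLo := s cLo, cHi := s cHi) = s" by (simp add: fun_eq_iff)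
  then show ?case by (intro exI[of _ "s cX"]) (simp only: foldl.simps fold.simps id_apply)
next
  case (Cons x xs)
  let ?s = "s(cX := x, cLo := min (s cLo) x, cHi := max (s cHi) x)"
  have x: "x + 1 < 2 ^ w" "x mod 2 ^ w = x" using Cons.prems by auto
  have "dexec w scan_step (s(cX := x)) = ?s"
    using Cons.prems x by (subst dexec_scan_step[of _ "s cLo" "s cHi" x]) auto
  moreover obtain z where "foldl (\<lambda>s x. dexec w scan_step (s(cX := x mod 2 ^ w))) ?s xs
      = ?s(cX := z, cLo := fold min xs (?s cLo), cHi := fold max xs (?s cHi))"
  proof -
    have "\<exists>z. foldl (\<lambda>s x. dexec w scan_step (s(cX := x mod 2 ^ w))) ?s xs
      = ?s(cX := z, cLo := fold min xs (?s cLo), cHi := fold max xs (?s cHi))"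
      by (rule Cons.IH) (use Cons.prems x in auto)
    then show ?thesis using that by blast
  qed
  moreover have "?s(cX := z, cLo := fold min xs (?s cLo), cHi := fold max xs (?s cHi))
      = s(cX := z, cLo := fold min (x # xs) (s cLo), cHi := fold max (x # xs) (s cHi))"
    by (auto simp: fun_eq_iff min.commute max.commute)
  ultimately have "foldl (\<lambda>s x. dexec w scan_step (s(cX := x mod 2 ^ w))) s (x # xs)
      = s(cX := z, cLo := fold min (x # xs) (s cLo), cHi := fold max (x # xs) (s cHi))"
    by (simp only: foldl.simps x(2))
  then show ?case by blast
qed

lemma dexec_setup_grid:
  assumes "s cLo = lo" "s cHi = hi" "lo \<le> hi" "hi < 2 ^ w" "G < 2 ^ w" "L < 2 ^ w"
    and g: "g = 1 + (hi - lo) div G" and h: "h = 1 + (hi - lo) div g"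
    and "g < 2 ^ w" "h < 2 ^ w" "g * h < 2 ^ w" "L * (g * h) < 2 ^ w" "1 < (2 :: nat) ^ w"
  shows "dexec w (setup_grid L G) s = s(cG := g, cH := h, cM := L * (g * h))"
proof -
  have one: "eval w (Num 1) s' = 1" for s' using assms(13) by (rule eval_Num)
  have d: "eval w (Bin Sub (Var cHi) (Var cLo)) s' = hi - lo" if "s' cLo = lo" "s' cHi = hi" for s'
    by (rule eval_Sub[OF eval_Var eval_Var]) (use that assms(3,4) in auto)
  have 1: "eval w (Bin Add (Num 1) (Bin Divide (Bin Sub (Var cHi) (Var cLo)) (Num G))) s = g"
    unfolding g by (rule eval_Add[OF one eval_Divide[OF d eval_Num]]) (use assms(1,2,5,9) in \<open>simp_all only: g\<close>)
  have 2: "eval w (Bin Add (Num 1) (Bin Divide (Bin Sub (Var cHi) (Var cLo)) (Var cG))) (s(cG := g)) = h"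
    unfolding h by (rule eval_Add[OF one eval_Divide[OF d eval_Var]]) (use assms(1,2,9,10) h in simp_all)
  have 3: "eval w (Bin Mult (Num L) (Bin Mult (Var cG) (Var cH))) (s(cG := g, cH := h)) = L * (g * h)"
    by (rule eval_Mult[OF eval_Num eval_Mult[OF eval_Var eval_Var]]) (use assms(6,9-12) in simp_all)
  show ?thesis by (simp only: setup_grid_def dexec_Assign dexec.simps(1) 1 2 3)
qed

lemma eval_key_expr:
  assumes L: "L > 0" and g: "g > 0" and h: "h > 0"
    and s: "s cX = x" "s cH = h" "s cG = g" "s cM = L * (g * h)"
    and b: "h * Y + Y < 2 ^ w" "h * L \<le> Y" "x < 2 ^ w" "h < 2 ^ w" "g < 2 ^ w" "L * (g * h) < 2 ^ w"
  shows "eval w (key_expr L Y) s = h * Y + cell L g h x"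
proof -
  have c: "cell L g h x < Y" using cell_less[OF L g h, of x] b(2) by linarith
  have LY: "L \<le> Y" using h b(2) by (metis Suc_leI le_trans mult_le_mono1 nat_mult_1 One_nat_def)
  have "block_index L g h x * L \<le> cell L g h x" by (simp add: cell_def)
  then show ?thesis
    unfolding key_expr_def cell_def block_index_def using s b c LY
    by (intro eval_Add eval_Mult eval_Divide eval_Modulo eval_Var eval_Num) (auto simp: cell_def block_index_def)
qed

lemma dexec_tally_cell:
  assumes "s cKey = c" "c + 1 < 2 ^ w" "K < 2 ^ w" "\<And>c. tab c y \<le> C" "s (cAcc y) + C < 2 ^ w"
  shows "dexec w (tally_cell tab K y) s = s(cAcc y := s (cAcc y) + (if c < K then tab c y else 0))"
  using assms(3)
proof (induction K)
  case 0
  then show ?case by (simp add: tally_cell_def)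
next
  case (Suc K)
  let ?s = "s(cAcc y := s (cAcc y) + (if c < K then tab c y else 0))"
  have tab: "tab c' y < 2 ^ w" "tab c' y + s (cAcc y) < 2 ^ w" for c' using assms(4)[of c'] assms(5) by linarith+
  have "eval w (Bin Add (Var (cAcc y)) (Bin Mult (Eq (Var cKey) (Num K)) (Num (tab K y)))) ?s
      = (s (cAcc y) + (if c < K then tab c y else 0)) + of_bool (c = K) * tab K y"
    using assms(1,2) Suc.prems tab[of K] tab[of c]
    by (intro eval_Add eval_Mult eval_Eq eval_Var eval_Num) (auto simp: add.commute)
  then have "dexec w [Assign (cAcc y) (Bin Add (Var (cAcc y)) (Bin Mult (Eq (Var cKey) (Num K)) (Num (tab K y))))] ?s
      = s(cAcc y := s (cAcc y) + (if c < Suc K then tab c y else 0))"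
    by (auto simp: less_Suc_eq simp del: eval.simps)
  moreover have "tally_cell tab (Suc K) y = tally_cell tab K y @ [Assign (cAcc y) (Bin Add (Var (cAcc y)) (Bin Mult (Eq (Var cKey) (Num K)) (Num (tab K y))))]"
    by (simp add: tally_cell_def)
  ultimately show ?case using Suc by (simp only: dexec_append)
qed

lemma dexec_tally_cells:
  assumes "s cKey = c" "c < K" "K < 2 ^ w" "\<And>c y. tab c y \<le> C" "\<And>y. y < Y \<Longrightarrow> s (cAcc y) + C < 2 ^ w"
  shows "dexec w (concat (map (tally_cell tab K) [0..<Y])) s
    = (\<lambda>a. if 80 \<le> a \<and> a < 80 + Y then s a + tab c (a - 80) else s a)"
  using assms(5)
proof (induction Y)
  case (Suc Y)
  let ?s = "\<lambda>a. if 80 \<le> a \<and> a < 80 + Y then s a + tab c (a - 80) else s a"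
  have "dexec w (tally_cell tab K Y) ?s = ?s(cAcc Y := ?s (cAcc Y) + (if c < K then tab c Y else 0))"
    using assms(1-4) Suc.prems[of Y] by (intro dexec_tally_cell[where C = C]) auto
  also have "\<dots> = (\<lambda>a. if 80 \<le> a \<and> a < 80 + Suc Y then s a + tab c (a - 80) else s a)"
    using assms(2) by (auto simp: fun_eq_iff)
  finally show ?case using Suc by (simp add: dexec_append)
qed (auto simp: fun_eq_iff)

lemma dexec_tally_step:
  assumes L: "L > 0" and g: "g > 0" and h: "h > 0"
    and s: "s cX = x" "s cH = h" "s cG = g" "s cM = L * (g * h)"
    and b: "h * L \<le> Y" "x < 2 ^ w" "g < 2 ^ w" "L * (g * h) < 2 ^ w" "h < H" "H * Y + 1 < 2 ^ w" "H < 2 ^ w"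
    and C: "\<And>c y. tab c y \<le> C" "\<And>y. y < Y \<Longrightarrow> s (cAcc y) + C < 2 ^ w"
  shows "dexec w (tally_step L Y (H * Y) tab) s
    = (\<lambda>a. if 80 \<le> a \<and> a < 80 + Y then s a + tab (h * Y + cell L g h x) (a - 80)
        else if a = cKey then h * Y + cell L g h x else s a)"
proof -
  have c: "cell L g h x < Y" using cell_less[OF L g h, of x] b(1) by linarith
  have "(h + 1) * Y \<le> H * Y" using b(5) by (intro mult_le_mono1) simp
  then have hY: "h * Y + Y \<le> H * Y" by simp
  then have key: "eval w (key_expr L Y) s = h * Y + cell L g h x"
    using b by (intro eval_key_expr[OF L g h s]) auto
  show ?thesis
    unfolding tally_step_def dexec_Assign key
    using c hY b C
    by (subst dexec_tally_cells[where C = C and c = "h * Y + cell L g h x"]) (auto simp: fun_eq_iff)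
qed

lemma tally_loop:
  assumes L: "L > 0" and g: "g > 0" and h: "h > 0"
    and s: "s cH = h" "s cG = g" "s cM = L * (g * h)"
    and b: "h * L \<le> Y" "g < 2 ^ w" "L * (g * h) < 2 ^ w" "h < H" "H * Y + 1 < 2 ^ w" "H < 2 ^ w"
    and C: "\<And>c y. tab c y \<le> C" "\<And>y. y < Y \<Longrightarrow> s (cAcc y) + length zs * C < 2 ^ w"
    and zs: "\<forall>x\<in>set zs. x < 2 ^ w"
  shows "\<exists>v u. foldl (\<lambda>s x. dexec w (tally_step L Y (H * Y) tab) (s(cX := x mod 2 ^ w))) s zs
    = (\<lambda>a. if 80 \<le> a \<and> a < 80 + Y then s a + (\<Sum>x\<leftarrow>zs. tab (h * Y + cell L g h x) (a - 80))
        else if a = cKey then v else if a = cX then u else s a)"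
  using s C(2) zs
proof (induction zs arbitrary: s)
  case Nil
  then show ?case by (intro exI[of _ "s cKey"] exI[of _ "s cX"]) (auto simp: fun_eq_iff)
next
  case (Cons x zs)
  let ?f = "foldl (\<lambda>s x. dexec w (tally_step L Y (H * Y) tab) (s(cX := x mod 2 ^ w)))"
  have x: "x mod 2 ^ w = x" "x < 2 ^ w" using Cons.prems by auto
  define s' where "s' = (\<lambda>a. if 80 \<le> a \<and> a < 80 + Y then s a + tab (h * Y + cell L g h x) (a - 80)
        else if a = cKey then h * Y + cell L g h x else (s(cX := x)) a)"
  have "dexec w (tally_step L Y (H * Y) tab) (s(cX := x)) = s'"
  proof -
    have "(s(cX := x)) (cAcc y) + C < 2 ^ w" if "y < Y" for y
      using Cons.prems(4)[OF that] by simp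
    then show ?thesis
      unfolding s'_def using Cons.prems x b C(1)
      by (subst dexec_tally_step[OF L g h, where x = x and C = C]) (auto simp: fun_eq_iff)
  qed
  then have eq1: "?f s (x # zs) = ?f s' zs" by (simp only: foldl.simps x(1))
  obtain v u where eq2: "?f s' zs = (\<lambda>a. if 80 \<le> a \<and> a < 80 + Y then s' a + (\<Sum>x\<leftarrow>zs. tab (h * Y + cell L g h x) (a - 80))
        else if a = cKey then v else if a = cX then u else s' a)"
  proof -
    have "s' (cAcc y) + length zs * C < 2 ^ w" if "y < Y" for y
      using Cons.prems(4)[OF that] C(1)[of "h * Y + cell L g h x" y] that by (simp add: s'_def)
    then have "\<exists>v u. ?f s' zs = (\<lambda>a. if 80 \<le> a \<and> a < 80 + Y then s' a + (\<Sum>x\<leftarrow>zs. tab (h * Y + cell L g h x) (a - 80))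
        else if a = cKey then v else if a = cX then u else s' a)"
      by (intro Cons.IH) (use Cons.prems in \<open>auto simp: s'_def\<close>)
    then show ?thesis using that by blast
  qed
  have eq3: "\<dots> = (\<lambda>a. if 80 \<le> a \<and> a < 80 + Y then s a + (\<Sum>x\<leftarrow>x # zs. tab (h * Y + cell L g h x) (a - 80))
        else if a = cKey then v else if a = cX then u else s a)"
    by (auto simp: s'_def fun_eq_iff)
  show ?case by (intro exI[of _ v] exI[of _ u]) (simp only: eq1 eq2 eq3)
qed

lemma dexec_accumulate:
  assumes "\<And>y. y < Y \<Longrightarrow> s (cAcc y) = A y" "s cTot = 0" "\<And>y. A y + 1 < 2 ^ w" "T + 1 < 2 ^ w"
    and "(\<Sum>y<Y. A y - T) < 2 ^ w"
  shows "dexec w (accumulate T Y) s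
    = (\<lambda>a. if 80 \<le> a \<and> a < 80 + Y then cum (\<lambda>y. A y - T) (a - 80)
        else if a = cTot then (\<Sum>y<Y. A y - T) else s a)"
  using assms(1,5)
proof (induction Y)
  case 0
  then show ?case using assms(2) by (auto simp: accumulate_def fun_eq_iff)
next
  case (Suc Y)
  let ?s = "\<lambda>a. if 80 \<le> a \<and> a < 80 + Y then cum (\<lambda>y. A y - T) (a - 80)
        else if a = cTot then (\<Sum>y<Y. A y - T) else s a"
  have IH: "dexec w (accumulate T Y) s = ?s" by (rule Suc.IH) (use Suc.prems in auto)
  have A: "?s (cAcc Y) = A Y" using Suc.prems by simp
  have e1: "eval w (Bin Add (Var cTot) (Monus (Var (cAcc Y)) (Num T))) ?s = (\<Sum>y<Y. A y - T) + (A Y - T)"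
    using Suc.prems(2) A assms(3)[of Y] assms(4)
    by (intro eval_Add eval_Monus eval_Var eval_Num) auto
  let ?t = "\<Sum>y<Suc Y. A y - T"
  have e2: "eval w (Var cTot) (?s(cTot := ?t)) = ?t"
    using Suc.prems(2) by (intro eval_Var) auto
  have "accumulate T (Suc Y) = accumulate T Y @
      [Assign cTot (Bin Add (Var cTot) (Monus (Var (cAcc Y)) (Num T))), Assign (cAcc Y) (Var cTot)]"
    by (simp add: accumulate_def)
  then have "dexec w (accumulate T (Suc Y)) s = ?s(cTot := ?t, cAcc Y := ?t)"
    using e1 e2 by (simp add: dexec_append IH del: eval.simps)
  moreover have "?t = cum (\<lambda>y. A y - T) Y" by (simp add: cum_def flip: lessThan_Suc_atMost)
  ultimately show ?case by (auto simp: fun_eq_iff)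
qed

lemma dexec_search:
  assumes "\<And>y. y < Y \<Longrightarrow> s (cAcc y) = cum q y" "s cIdx = 0" "s cR = r" "r + 1 < 2 ^ w" "Y < 2 ^ w"
    and "\<And>y. y < Y \<Longrightarrow> cum q y + 1 < 2 ^ w"
  shows "dexec w (search Y) s = s(cIdx := draw q Y r)"
  using assms(1,5,6)
proof (induction Y)
  case 0
  have "s(cIdx := 0) = s" using assms(2) by auto
  then show ?case by (simp add: search_def draw_def)
next
  case (Suc Y)
  let ?s = "s(cIdx := draw q Y r)"
  have IH: "dexec w (search Y) s = ?s" by (rule Suc.IH) (use Suc.prems in auto)
  have "draw q Y r \<le> card {..<Y}" unfolding draw_def by (intro card_mono) auto
  then have dY: "draw q Y r \<le> Y" by simp
  have "cum q Y + 1 < 2 ^ w" "s (cAcc Y) = cum q Y" using Suc.prems by simp_all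
  then have "eval w (Bin Add (Var cIdx) (Leq (Var (cAcc Y)) (Var cR))) ?s = draw q Y r + of_bool (cum q Y \<le> r)"
    using Suc.prems(2) assms(3,4) dY
    by (intro eval_Add eval_Leq eval_Var) (auto simp: of_bool_def)
  moreover have "draw q Y r + of_bool (cum q Y \<le> r) = draw q (Suc Y) r"
  proof (cases "cum q Y \<le> r")
    case True
    then have "{y. y < Suc Y \<and> cum q y \<le> r} = insert Y {y. y < Y \<and> cum q y \<le> r}" by (auto simp: less_Suc_eq)
    then show ?thesis using True by (simp add: draw_def)
  next
    case False
    then have "{y. y < Suc Y \<and> cum q y \<le> r} = {y. y < Y \<and> cum q y \<le> r}" by (auto simp: less_Suc_eq)
    then show ?thesis using False by (simp add: draw_def)
  qed
  moreover have "search (Suc Y) = search Y @ [Assign cIdx (Bin Add (Var cIdx) (Leq (Var (cAcc Y)) (Var cR)))]"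
    by (simp add: search_def)
  ultimately show ?case by (simp only: dexec_append IH dexec_Assign dexec.simps(1) fun_upd_upd)
qed

lemma dexec_emit:
  assumes L: "L > 0" and s: "s cLo = lo" "s cM = M" "s cG = g" "s cIdx = y" "s cV = v"
    and b: "spread L g y v < M" "lo + 2 * M < 2 ^ w" "L \<le> M" "g < 2 ^ w" "y < 2 ^ w" "v < 2 ^ w"
  shows "dexec w (emit L) s cOut = lo + (spread L g y v + M - lo mod M) mod M"
proof -
  have M: "M > 0" "M < 2 ^ w" "lo < 2 ^ w" "L < 2 ^ w" using b(1,2,3) by auto
  define q where "q = g * (y div L) + v"
  have sp: "q \<le> L * q" "L * q + y mod L = spread L g y v"
    using L by (simp_all add: spread_def q_def)
  have "g * (y div L) \<le> q" by (simp add: q_def)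
  then have bd: "q < 2 ^ w" "L * q < 2 ^ w" "g * (y div L) < 2 ^ w" "spread L g y v < 2 ^ w"
    using b(1) M(2) sp by linarith+
  have a1: "eval w (Bin Divide (Var cIdx) (Num L)) s = y div L"
    using s b(5) M(4) by (intro eval_Divide eval_Var eval_Num) auto
  have a2: "eval w (Bin Mult (Var cG) (Bin Divide (Var cIdx) (Num L))) s = g * (y div L)"
    by (rule eval_Mult[OF eval_Var a1]) (use s(3) b(4) bd(3) in auto)
  have a3: "eval w (Bin Add (Bin Mult (Var cG) (Bin Divide (Var cIdx) (Num L))) (Var cV)) s = q"
    unfolding q_def by (rule eval_Add[OF a2 eval_Var]) (use s(5) b(6) bd(1) q_def in auto)
  have a4: "eval w (Bin Modulo (Var cIdx) (Num L)) s = y mod L"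
    using s b(5) M(4) by (intro eval_Modulo eval_Var eval_Num) auto
  have e1: "eval w (Bin Add (Bin Mult (Num L) (Bin Add (Bin Mult (Var cG) (Bin Divide (Var cIdx) (Num L))) (Var cV)))
                 (Bin Modulo (Var cIdx) (Num L))) s = spread L g y v"
    unfolding sp(2)[symmetric]
    by (rule eval_Add[OF eval_Mult[OF eval_Num a3] a4]) (use M(4) bd(2,4) sp(2) in auto)
  have lm: "lo mod M < M" using M by simp
  have r: "(spread L g y v + M - lo mod M) mod M < M" using M by simp
  have e2: "eval w (Bin Add (Var cLo)
       (Bin Modulo (Bin Sub (Bin Add (Var cX) (Var cM)) (Bin Modulo (Var cLo) (Var cM))) (Var cM))) (s(cX := spread L g y v))
     = lo + (spread L g y v + M - lo mod M) mod M"
  proof -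
    let ?s = "s(cX := spread L g y v)"
    have b1: "eval w (Bin Add (Var cX) (Var cM)) ?s = spread L g y v + M"
      using s(2) b(1,2) M(2) bd(4) by (intro eval_Add eval_Var) auto
    have b2: "eval w (Bin Modulo (Var cLo) (Var cM)) ?s = lo mod M"
      using s(1,2) M by (intro eval_Modulo eval_Var) auto
    have b3: "eval w (Bin Sub (Bin Add (Var cX) (Var cM)) (Bin Modulo (Var cLo) (Var cM))) ?s = spread L g y v + M - lo mod M"
      by (rule eval_Sub[OF b1 b2]) (use lm in linarith)
    have b4: "eval w (Var cM) ?s = M" "eval w (Var cLo) ?s = lo"
      using s(1,2) M by (intro eval_Var; simp)+
    show ?thesis
      by (rule eval_Add[OF b4(2) eval_Modulo[OF b3 b4(1)]]) (use r b(2) in linarith)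
  qed
  show ?thesis by (simp add: emit_def e1 e2 del: eval.simps)
qed

section \<open>Learner and generator with the laws of their results\<close>

definition learner_prog ::
    "nat \<Rightarrow> nat \<Rightarrow> nat \<Rightarrow> nat \<Rightarrow> nat \<Rightarrow> nat \<Rightarrow> nat \<Rightarrow> stmt list" where
  "learner_prog b n1 L G D R m =
    Assign cLo (Num b) # concat (replicate n1 (Draw cX # scan_step)) @ setup_grid L G
    @ concat (replicate m (Draw cX # tally_step L (G * L) ((G + 1) * (G * L))
        (\<lambda>c y. table L D R (c div (G * L)) (c mod (G * L)) y)))
    @ accumulate (m * R) (G * L)"

text \<open>A random word modulo the total weight selects a cell, another one modulo g a point in
  its block. Neither reduction need be exactly uniform; the word size keeps the defect
  small.\<close>

definition generator_prog :: "nat \<Rightarrow> nat \<Rightarrow> stmt list" where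
  "generator_prog L Y =
    [Toss cR, Toss cV, Assign cR (Bin Modulo (Var cR) (Var cTot)), Assign cV (Bin Modulo (Var cV) (Var cG)),
     Assign cIdx (Num 0)] @ search Y @ emit L"

text \<open>The part of the memory through which the learner hands its hypothesis to the
  generator.\<close>

definition learned :: "nat \<Rightarrow> nat \<Rightarrow> nat \<Rightarrow> nat \<Rightarrow> nat \<Rightarrow> (nat \<Rightarrow> nat) \<Rightarrow> (nat \<Rightarrow> nat) \<Rightarrow> bool" where
  "learned L Y lo g h q s \<longleftrightarrow> s cLo = lo \<and> s cG = g \<and> s cM = L * (g * h)
    \<and> s cTot = (\<Sum>y<Y. q y) \<and> (\<forall>y<Y. s (cAcc y) = cum q y)"

text \<open>Adding 1 to the quotient keeps the block length positive and ensures that G blocks per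
  residue class suffice for the window.\<close>

definition grid_step :: "nat \<Rightarrow> nat \<Rightarrow> nat" where
  "grid_step G S = 1 + S div G"

definition grid_size :: "nat \<Rightarrow> nat \<Rightarrow> nat" where
  "grid_size G S = 1 + S div grid_step G S"

lemma grid_bounds:
  assumes G: "G > 0"
  shows "grid_step G S > 0" "0 < grid_size G S" "grid_size G S \<le> G"
    "S < grid_step G S * grid_size G S" "grid_step G S * grid_size G S \<le> 2 * S + 1"
    "grid_step G S \<le> S + 1"
proof -
  let ?g = "grid_step G S"
  show g: "?g > 0" "0 < grid_size G S" by (simp_all add: grid_step_def grid_size_def)
  have "S < ?g * G" unfolding grid_step_def using G by (simp add: dividend_less_div_times add.commute)
  then have "S div ?g < G" using g by (simp add: div_less_iff_less_mult mult.commute)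
  then show "grid_size G S \<le> G" by (simp add: grid_size_def)
  show "S < ?g * grid_size G S"
    unfolding grid_size_def using g(1) by (simp add: dividend_less_times_div)
  show gS: "?g \<le> S + 1" unfolding grid_step_def using div_le_dividend[of S G] by simp
  have "?g * (S div ?g) \<le> S" by (rule times_div_less_eq_dividend)
  then show "?g * grid_size G S \<le> 2 * S + 1" using gS unfolding grid_size_def distrib_left by linarith
qed

lemma is_assign_parts:
  "\<forall>p\<in>set scan_step. is_assign p" "\<forall>p\<in>set (setup_grid L G). is_assign p"
  "\<forall>p\<in>set (tally_step L Y K tab). is_assign p" "\<forall>p\<in>set (accumulate T Y). is_assign p"
  "\<forall>p\<in>set (search Y). is_assign p" "\<forall>p\<in>set (emit L). is_assign p"
  by (auto simp: scan_step_def setup_grid_def tally_step_def tally_cell_def accumulate_def search_def emit_def)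

lemma srun_assigns_append:
  "\<forall>p\<in>set ps. is_assign p \<Longrightarrow> srun w P (ps @ qs) s = srun w P qs (dexec w ps s)"
  by (simp add: srun_append srun_assigns bind_return_pmf)

text \<open>Reduces the learner to a deterministic function F of two independent sample lists.
  \<open>B1\<close> to \<open>B3\<close> exclude overflow: of samples and modulus, of the weights
  and their total, and of the keys.\<close>

lemma srun_learner:
  assumes L: "L > 0" and G: "G > 0" and R: "R > 0" and n1: "n1 > 0" and m: "m > 0"
    and supp: "set_pmf P \<subseteq> {..b}"
    and B1: "8 * L * (b + 1) < 2 ^ w" and B2: "(4 * (m * R) + 4) * (G * L + 1) < 2 ^ w"
    and B3: "(G + 2) * (G * L + 90) < (2 :: nat) ^ w"
  obtains F where
    "srun w P (learner_prog b n1 L G D R m) (\<lambda>_. 0)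
      = bind_pmf (replicate_pmf n1 P) (\<lambda>xs. map_pmf (F xs) (replicate_pmf m P))"
    "\<And>S xs zs. xs \<in> set_pmf (replicate_pmf n1 P) \<Longrightarrow> zs \<in> set_pmf (replicate_pmf m P) \<Longrightarrow>
      range_lo b xs \<le> range_hi xs \<Longrightarrow> range_hi xs - range_lo b xs = S \<Longrightarrow>
      learned L (G * L) (range_lo b xs) (grid_step G S) (grid_size G S)
        (weight L D R (grid_step G S) (grid_size G S) zs) (F xs zs)"
proof -
  define Y where "Y = G * L"
  define tab where "tab = (\<lambda>c y. table L D R (c div Y) (c mod Y) y)"
  let ?scan = "\<lambda>s x. dexec w scan_step (s(cX := x mod 2 ^ w))"
  let ?tally = "\<lambda>s x. dexec w (tally_step L Y ((G + 1) * Y) tab) (s(cX := x mod 2 ^ w))"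
  define s0 where "s0 = (\<lambda>_. 0 :: nat)(cLo := eval w (Num b) (\<lambda>_. 0))"
  define F where "F = (\<lambda>xs zs. dexec w (accumulate (m * R) Y)
      (foldl ?tally (dexec w (setup_grid L G) (foldl ?scan s0 xs)) zs))"
  have Y0: "Y > 0" using L G by (simp add: Y_def)
  have bw: "b + 1 < 2 ^ w" "1 < (2 :: nat) ^ w"
  proof -
    have "1 * (b + 1) \<le> 8 * L * (b + 1)" using L by (intro mult_right_mono) auto
    from le_less_trans[OF this B1] show "b + 1 < 2 ^ w" by (simp only: mult_1)
    show "1 < (2 :: nat) ^ w" by (rule le_less_trans[OF _ B3]) simp
  qed
  show ?thesis
  proof (rule that[of F])
    let ?acc = "accumulate (m * R) Y" and ?loop = "concat (replicate m (Draw cX # tally_step L Y ((G + 1) * Y) tab))"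
    have tail1: "srun w P ?acc = (\<lambda>s. return_pmf (dexec w ?acc s))"
      by (rule ext) (rule srun_assigns[OF is_assign_parts(4)])
    have tail2: "srun w P (setup_grid L G @ ?loop @ ?acc) = (\<lambda>s. bind_pmf
        (map_pmf (foldl ?tally (dexec w (setup_grid L G) s)) (replicate_pmf m P)) (\<lambda>s. return_pmf (dexec w ?acc s)))"
      by (rule ext, subst srun_assigns_append[OF is_assign_parts(2)], subst srun_append,
          subst srun_draw_loop[OF is_assign_parts(3)], subst tail1, rule refl)
    have "srun w P (learner_prog b n1 L G D R m) (\<lambda>_. 0)
       = bind_pmf (map_pmf (foldl ?scan s0) (replicate_pmf n1 P)) (\<lambda>s.
           bind_pmf (map_pmf (foldl ?tally (dexec w (setup_grid L G) s)) (replicate_pmf m P)) (\<lambda>s.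
             return_pmf (dexec w (accumulate (m * R) Y) s)))"
      unfolding learner_prog_def srun_simps s0_def[symmetric] Y_def[symmetric] tab_def[symmetric]
      by (subst srun_append, subst srun_draw_loop[OF is_assign_parts(1)], subst tail2, rule refl)
    also have "\<dots> = bind_pmf (replicate_pmf n1 P) (\<lambda>xs. map_pmf (F xs) (replicate_pmf m P))"
      by (simp add: bind_map_pmf map_pmf_def bind_assoc_pmf bind_return_pmf F_def)
    finally show "srun w P (learner_prog b n1 L G D R m) (\<lambda>_. 0)
      = bind_pmf (replicate_pmf n1 P) (\<lambda>xs. map_pmf (F xs) (replicate_pmf m P))" .
  next
    fix S xs zs
    assume xs: "xs \<in> set_pmf (replicate_pmf n1 P)" and zs: "zs \<in> set_pmf (replicate_pmf m P)"
      and lohi: "range_lo b xs \<le> range_hi xs" and S: "range_hi xs - range_lo b xs = S"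
    define lo where "lo = range_lo b xs"
    define hi where "hi = range_hi xs"
    define g where "g = grid_step G S"
    define h where "h = grid_size G S"
    define M where "M = L * (g * h)"
    have xb: "x \<le> b" if "x \<in> set xs \<union> set zs" for x
      using that xs zs supp by (auto simp: set_replicate_pmf)
    have hib: "hi \<le> b" unfolding hi_def range_hi_eq using xb by (intro Max.boundedI) auto
    then have Sb: "S \<le> b" using S by (simp add: hi_def)
    note gb = grid_bounds[OF G, of S, folded g_def h_def]
    have M: "M \<le> L * (2 * b + 1)" unfolding M_def using gb(5) Sb by (intro mult_left_mono) auto
    have MB: "M < 2 ^ w" "g * h < 2 ^ w" "L < 2 ^ w" "g < 2 ^ w" "h < 2 ^ w"
    proof -
      have "L * (2 * b + 1) \<le> 8 * L * (b + 1)" by (simp add: algebra_simps)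
      then show M': "M < 2 ^ w" using M B1 by linarith
      have "g * h \<le> M" unfolding M_def using L by simp
      then show "g * h < 2 ^ w" using M' by linarith
      have "L * 1 \<le> M" unfolding M_def using gb(1,2) by (intro mult_left_mono) (auto simp: Suc_le_eq)
      then show "L < 2 ^ w" using M' by linarith
      have "g * 1 \<le> g * h" "1 * h \<le> g * h" using gb(1,2) by (intro mult_mono; simp add: Suc_le_eq)+
      then show "g < 2 ^ w" "h < 2 ^ w" using \<open>g * h < 2 ^ w\<close> by linarith+
    qed
    have GB: "G + 1 < 2 ^ w" "(G + 1) * Y + 1 < 2 ^ w"
    proof -
      have "(G + 2) * (Y + 90) = (G + 1) * Y + Y + 90 * G + 180" by (simp add: algebra_simps)
      then show "(G + 1) * Y + 1 < 2 ^ w" "G + 1 < 2 ^ w" using B3 unfolding Y_def[symmetric] by linarith+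
    qed
    have s0: "s0 = (\<lambda>_. 0)(cLo := b)" unfolding s0_def using bw by (subst eval_Num) auto
    obtain z1 where 1: "foldl ?scan s0 xs = s0(cX := z1, cLo := fold min xs (s0 cLo), cHi := fold max xs (s0 cHi))"
      using scan_loop[of xs w s0] xb bw by (force simp: s0)
    define s1 where "s1 = foldl ?scan s0 xs"
    have s1: "s1 = (\<lambda>_. 0)(cX := z1, cLo := lo, cHi := hi)"
      unfolding s1_def 1 by (auto simp: s0 lo_def hi_def range_lo_def range_hi_def fun_eq_iff)
    define s2 where "s2 = dexec w (setup_grid L G) s1"
    have s2: "s2 = s1(cG := g, cH := h, cM := M)"
      unfolding s2_def M_def
      by (rule dexec_setup_grid[of _ lo hi])
         (use lohi hib bw MB GB S in \<open>auto simp: s1 lo_def[symmetric] hi_def[symmetric] g_def h_def grid_size_def grid_step_def M_def\<close>)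
    \<comment> \<open>The keys in the code include some with \<open>h = 0\<close>, where
      \<open>table_le\<close> does not apply; their entries are 0.\<close>
    have tabC: "tab c y \<le> 2 * R" for c y
    proof (cases "y < (c div Y) * L")
      case True
      then have "c div Y > 0" by (cases "c div Y") auto
      then show ?thesis unfolding tab_def by (rule table_le)
    qed (simp add: tab_def table_def)
    have lenz: "length zs = m" using zs by (simp add: set_replicate_pmf)
    have mR: "m * (2 * R) + 4 < 2 ^ w" "m * R + 1 < 2 ^ w"
    proof -
      have "(4 * (m * R) + 4) * 1 \<le> (4 * (m * R) + 4) * (G * L + 1)" by (intro mult_left_mono) auto
      from le_less_trans[OF this B2] have "4 * (m * R) + 4 < 2 ^ w" by (simp only: mult_1_right)
      moreover have "m * (2 * R) = 2 * (m * R)" by simp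
      ultimately show "m * (2 * R) + 4 < 2 ^ w" "m * R + 1 < 2 ^ w" by linarith+
    qed
    obtain v u where 3: "foldl ?tally s2 zs
      = (\<lambda>a. if 80 \<le> a \<and> a < 80 + Y then s2 a + (\<Sum>x\<leftarrow>zs. tab (h * Y + cell L g h x) (a - 80))
        else if a = cKey then v else if a = cX then u else s2 a)"
    proof -
      have "\<exists>v u. foldl ?tally s2 zs
        = (\<lambda>a. if 80 \<le> a \<and> a < 80 + Y then s2 a + (\<Sum>x\<leftarrow>zs. tab (h * Y + cell L g h x) (a - 80))
          else if a = cKey then v else if a = cX then u else s2 a)"
      proof (rule tally_loop[OF L gb(1,2), where C = "2 * R"])
        show "h * L \<le> Y" unfolding Y_def using gb(3) by (intro mult_right_mono) auto
        show "h < G + 1" using gb(3) by simp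
        show "\<forall>x\<in>set zs. x < 2 ^ w" using xb bw by force
        show "s2 (cAcc y) + length zs * (2 * R) < 2 ^ w" if "y < Y" for y
          using mR lenz by (simp add: s2 s1)
      qed (use MB GB tabC in \<open>auto simp: s2 M_def\<close>)
      then show ?thesis using that by blast
    qed
    define A where "A = (\<lambda>y. \<Sum>x\<leftarrow>zs. tab (h * Y + cell L g h x) y)"
    define s3 where "s3 = foldl ?tally s2 zs"
    have s3: "s3 (cAcc y) = A y" if "y < Y" for y
      using that unfolding s3_def 3 by (simp add: A_def s2 s1)
    have s3': "s3 cTot = 0" "s3 cLo = lo" "s3 cG = g" "s3 cM = M"
      unfolding s3_def 3 by (simp_all add: s2 s1)
    \<comment> \<open>Cells are below Y, so \<open>div\<close> and \<open>mod\<close> recover h and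
      the cell from the key.\<close>
    have Aw: "A y = (\<Sum>x\<leftarrow>zs. table L D R h (cell L g h x) y)" for y
    proof -
      have "cell L g h x < Y" for x
      proof -
        have "h * L \<le> Y" unfolding Y_def using gb(3) by (intro mult_right_mono) auto
        then show ?thesis using cell_less[OF L gb(1,2), of x] by linarith
      qed
      then show ?thesis using Y0 by (simp add: A_def tab_def)
    qed
    have q: "A y - m * R = weight L D R g h zs y" for y
      by (simp add: weight_def Aw lenz)
    have Ale: "A y \<le> m * (2 * R)" for y
    proof -
      have "(\<Sum>x\<leftarrow>ws. tab (h * Y + cell L g h x) y) \<le> length ws * (2 * R)" for ws
      proof (induction ws)
        case (Cons x ws)
        then show ?case using tabC[of "h * Y + cell L g h x" y] by simp
      qed simp
      then show ?thesis using lenz by (metis A_def)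
    qed
    have tot: "(\<Sum>y<Y. A y - m * R) < 2 ^ w"
    proof -
      have "(\<Sum>y<Y. A y - m * R) \<le> (\<Sum>y<Y. m * (2 * R))"
        using Ale by (intro sum_mono) (meson diff_le_self le_trans)
      also have "\<dots> \<le> (4 * (m * R) + 4) * (G * L + 1)" by (simp add: Y_def algebra_simps)
      finally show ?thesis by (rule le_less_trans[OF _ B2])
    qed
    have F: "F xs zs = (\<lambda>a. if 80 \<le> a \<and> a < 80 + Y then cum (\<lambda>y. A y - m * R) (a - 80)
        else if a = cTot then (\<Sum>y<Y. A y - m * R) else s3 a)"
      unfolding F_def s1_def[symmetric] s2_def[symmetric] s3_def[symmetric]
    proof (rule dexec_accumulate)
      show "A y + 1 < 2 ^ w" for y using Ale[of y] mR by linarith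
    qed (use s3 s3' mR tot in auto)
    show "learned L (G * L) (range_lo b xs) (grid_step G S) (grid_size G S)
        (weight L D R (grid_step G S) (grid_size G S) zs) (F xs zs)"
      unfolding learned_def F q g_def[symmetric] h_def[symmetric] lo_def[symmetric] Y_def[symmetric]
      using s3' by (simp add: M_def)
  qed
qed

text \<open>The representative of z modulo M in \<open>[lo, lo + M)\<close>. The summand M keeps the
  subtraction from being truncated.\<close>

definition unwrap :: "nat \<Rightarrow> nat \<Rightarrow> nat \<Rightarrow> nat" where
  "unwrap lo M z = lo + (z + M - lo mod M) mod M"

lemma unwrap_mod:
  assumes "lo \<le> x" "x < lo + M"
  shows "unwrap lo M (x mod M) = x"
proof -
  have M: "M > 0" using assms by linarith
  have "lo mod M \<le> M" using M by (simp add: less_imp_le)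
  \<comment> \<open>The congruence is verified over the integers, where subtraction is
    exact.\<close>
  then have "int (x mod M + M - lo mod M) = int (x mod M) + int M - int (lo mod M)" by simp
  also have "\<dots> mod int M = (int x - int lo) mod int M"
  proof -
    have "int (x mod M) = int x - int M * (int x div int M)" "int (lo mod M) = int lo - int M * (int lo div int M)"
      by (simp_all add: of_nat_mod minus_mult_div_eq_mod)
    then have "int (x mod M) + int M - int (lo mod M) - (int x - int lo) = int M * (1 - int x div int M + int lo div int M)"
      by (simp add: algebra_simps)
    then show ?thesis by (simp only: mod_eq_dvd_iff dvd_triv_left)
  qed
  also have "(int x - int lo) mod int M = int x - int lo" using assms by simp
  finally have "int ((x mod M + M - lo mod M) mod M) = int x - int lo" by (simp only: of_nat_mod)
  then show ?thesis using assms by (simp add: unwrap_def)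
qed

lemma srun_generator:
  assumes L: "L > 0" and g: "g > 0" and h: "h > 0" "h * L \<le> Y" and W: "(\<Sum>y<Y. q y) > 0"
    and q0: "\<forall>y\<ge>h * L. q y = 0"
    and s: "learned L Y lo g h q s"
    and B: "lo + 2 * (L * (g * h)) < 2 ^ w" "Y < 2 ^ w" "(\<Sum>y<Y. q y) + 1 < 2 ^ w"
  shows "map_pmf (\<lambda>s. s cOut) (srun w P (generator_prog L Y) s)
    = map_pmf (\<lambda>z. unwrap lo (L * (g * h)) z) (map_pmf (\<lambda>(r, v). spread L g (draw q Y r) v)
        (pair_pmf (map_pmf (\<lambda>x. x mod (\<Sum>y<Y. q y)) (pmf_of_set {..<2 ^ w})) (map_pmf (\<lambda>x. x mod g) (pmf_of_set {..<2 ^ w}))))"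
proof -
  define W where "W = (\<Sum>y<Y. q y)"
  define M where "M = L * (g * h)"
  let ?U = "pmf_of_set {..<(2 :: nat) ^ w}"
  let ?ps = "[Assign cR (Bin Modulo (Var cR) (Var cTot)), Assign cV (Bin Modulo (Var cV) (Var cG)), Assign cIdx (Num 0)] @ search Y @ emit L"
  have W0: "W > 0" using W by (simp add: W_def)
  have gM: "g \<le> M" "L \<le> M" unfolding M_def using L g h(1) by simp_all
  have gB: "g < 2 ^ w" using gM B(1) unfolding M_def[symmetric] by linarith
  have det: "\<forall>p\<in>set ?ps. is_assign p" using is_assign_parts(5)[of Y] is_assign_parts(6)[of L] by auto
  have out: "dexec w ?ps (s(cR := r1, cV := r2)) cOut = unwrap lo M (spread L g (draw q Y (r1 mod W)) (r2 mod g))"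
    if "r1 < 2 ^ w" "r2 < 2 ^ w" for r1 r2
  proof -
    define s1 where "s1 = s(cR := r1, cV := r2)"
    have 1: "eval w (Bin Modulo (Var cR) (Var cTot)) s1 = r1 mod W"
      using that s B by (intro eval_Modulo eval_Var) (auto simp: s1_def learned_def W_def)
    have 2: "eval w (Bin Modulo (Var cV) (Var cG)) (s1(cR := r1 mod W)) = r2 mod g"
      using that s gB by (intro eval_Modulo eval_Var) (auto simp: s1_def learned_def)
    have 3: "eval w (Num 0) s' = 0" for s' by simp
    define s2 where "s2 = s1(cR := r1 mod W, cV := r2 mod g, cIdx := 0)"
    have r: "r1 mod W < W" using W0 by simp
    have cumW: "cum q y \<le> W" if "y < Y" for y
      unfolding cum_def W_def using that by (intro sum_mono2) auto
    have 4: "dexec w (search Y) s2 = s2(cIdx := draw q Y (r1 mod W))"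
    proof (rule dexec_search)
      show "cum q y + 1 < 2 ^ w" if "y < Y" for y
        using cumW[OF that] B(3) by (simp add: W_def)
    qed (use s r B in \<open>auto simp: s2_def s1_def learned_def W_def\<close>)
    have d: "draw q Y (r1 mod W) < Y" "q (draw q Y (r1 mod W)) > 0"
      using draw_less[of "r1 mod W" q Y] r by (simp_all add: W_def)
    \<comment> \<open>A drawn cell has positive weight, so it belongs to one of the h blocks in use,
      although the search runs over all Y cells.\<close>
    then have dh: "draw q Y (r1 mod W) < h * L" using q0 by (metis not_less less_numeral_extra(3))
    have sp: "spread L g (draw q Y (r1 mod W)) (r2 mod g) < M"
    proof -
      define y where "y = draw q Y (r1 mod W)"
      have "y div L < h" using dh by (simp add: y_def less_mult_imp_div_less)
      then have "(y div L + 1) * g \<le> h * g" by (intro mult_right_mono) auto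
      moreover have "r2 mod g < g" using g by simp
      ultimately have "g * (y div L) + r2 mod g + 1 \<le> g * h" by (simp add: algebra_simps)
      then have "L * (g * (y div L) + r2 mod g + 1) \<le> M" unfolding M_def by (intro mult_left_mono) auto
      moreover have "y mod L < L" using L by simp
      ultimately show ?thesis unfolding y_def[symmetric] spread_def by (simp add: algebra_simps)
    qed
    have "dexec w (emit L) (s2(cIdx := draw q Y (r1 mod W))) cOut
      = lo + (spread L g (draw q Y (r1 mod W)) (r2 mod g) + M - lo mod M) mod M"
    proof (rule dexec_emit[OF L])
      show "spread L g (draw q Y (r1 mod W)) (r2 mod g) < M" by (rule sp)
      show "lo + 2 * M < 2 ^ w" using B(1) by (simp add: M_def)
      have "r2 mod g < g" using g by simp
      then show "g < 2 ^ w" "r2 mod g < 2 ^ w" using gB by linarith+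
      show "draw q Y (r1 mod W) < 2 ^ w" using d(1) B(2) by linarith
    qed (use s gM in \<open>auto simp: s2_def s1_def learned_def M_def\<close>)
    then show ?thesis
      by (simp only: s1_def[symmetric] append_Cons append_Nil dexec_Assign 1 2 3 s2_def[symmetric] dexec_append 4 unwrap_def)
  qed
  have mod: "x mod 2 ^ w = x" if "x \<in> set_pmf ?U" for x :: nat
    using that by (simp add: set_pmf_of_set lessThan_empty_iff)
  have "srun w P (generator_prog L Y) s
      = bind_pmf ?U (\<lambda>r1. bind_pmf ?U (\<lambda>r2. return_pmf (dexec w ?ps (s(cR := r1 mod 2 ^ w, cV := r2 mod 2 ^ w)))))"
    unfolding generator_prog_def append_Cons append_Nil srun_simps(3)
    using srun_assigns[OF det, of w P] by (simp only: append_Cons append_Nil)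
  then have "map_pmf (\<lambda>s. s cOut) (srun w P (generator_prog L Y) s)
      = bind_pmf ?U (\<lambda>r1. bind_pmf ?U (\<lambda>r2. return_pmf (dexec w ?ps (s(cR := r1 mod 2 ^ w, cV := r2 mod 2 ^ w)) cOut)))"
    by (simp only: map_bind_pmf map_return_pmf)
  also have "\<dots> = bind_pmf ?U (\<lambda>r1. bind_pmf ?U (\<lambda>r2. return_pmf (unwrap lo M (spread L g (draw q Y (r1 mod W)) (r2 mod g)))))"
    by (intro bind_pmf_cong refl arg_cong[where f = return_pmf])
       (simp only: mod, rule out, auto simp: set_pmf_of_set lessThan_empty_iff)
  also have "\<dots> = map_pmf (\<lambda>z. unwrap lo M z) (map_pmf (\<lambda>(r, v). spread L g (draw q Y r) v)
        (pair_pmf (map_pmf (\<lambda>x. x mod W) ?U) (map_pmf (\<lambda>x. x mod g) ?U)))"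
    by (simp add: pair_pmf_def map_bind_pmf bind_map_pmf)
  finally show ?thesis by (simp only: W_def M_def)
qed

text \<open>A chain through two intermediate laws: P reduced modulo the period and unwrapped, which
  moves only mass outside the window, and the hypothesis with ideal uniform draws. Maps do not
  increase total variation, so each error can be bounded before unwrapping.\<close>

lemma unwrapped_tv:
  assumes P: "finite (set_pmf P)" and win: "prob P {lo..hi} \<ge> 1 - \<eta>" "hi < lo + L * (g * h)"
    and W: "(\<Sum>y<Y. q y) > 0" and g: "g > 0"
    and tv: "tv_dist (map_pmf (\<lambda>x. x mod (L * (g * h))) P) (hyp_law L g Y q) \<le> \<delta>"
  shows "tv_dist P (map_pmf (\<lambda>z. unwrap lo (L * (g * h)) z) (map_pmf (\<lambda>(r, v). spread L g (draw q Y r) v)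
        (pair_pmf (map_pmf (\<lambda>x. x mod (\<Sum>y<Y. q y)) (pmf_of_set {..<2 ^ w})) (map_pmf (\<lambda>x. x mod g) (pmf_of_set {..<2 ^ w})))))
    \<le> \<eta> + \<delta> + (real (\<Sum>y<Y. q y) / 2 ^ w + real g / 2 ^ w)"
proof -
  define W where "W = (\<Sum>y<Y. q y)"
  define M where "M = L * (g * h)"
  let ?U = "pmf_of_set {..<(2 :: nat) ^ w}"
  let ?A = "pair_pmf (map_pmf (\<lambda>x. x mod W) ?U) (map_pmf (\<lambda>x. x mod g) ?U)"
  let ?A' = "pair_pmf (pmf_of_set {..<W}) (pmf_of_set {..<g})"
  let ?f = "\<lambda>(r, v). spread L g (draw q Y r) v"
  have W0: "W > 0" using W by (simp add: W_def)
  have U: "finite (set_pmf ?U)" by (simp add: set_pmf_of_set lessThan_empty_iff)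
  have Wg: "finite (set_pmf (pmf_of_set {..<W}))" "finite (set_pmf (pmf_of_set {..<g}))"
    using W0 g by (simp_all add: set_pmf_of_set lessThan_empty_iff)
  have fin: "finite (set_pmf ?A)" "finite (set_pmf ?A')" using U Wg by simp_all
  let ?pm = "map_pmf (\<lambda>x. x mod M) P"
  have H: "hyp_law L g Y q = map_pmf ?f ?A'" by (simp add: hyp_law_def W_def)
  have "tv_dist P (map_pmf (unwrap lo M) ?pm) \<le> prob P {x. unwrap lo M (x mod M) \<noteq> x}"
    using tv_dist_map_self[OF P, of "\<lambda>x. unwrap lo M (x mod M)"] by (simp add: pmf.map_comp o_def)
  also have "\<dots> \<le> prob P (- {lo..hi})"
    using unwrap_mod[of lo _ M] win(2) by (intro prob_mono_supp) (force simp: M_def)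
  also have "\<dots> \<le> \<eta>" using win(1) measure_pmf.prob_compl[of "{lo..hi}" P] by (simp add: Compl_eq_Diff_UNIV)
  finally have 1: "tv_dist P (map_pmf (unwrap lo M) ?pm) \<le> \<eta>" .
  have 2: "tv_dist (map_pmf (unwrap lo M) ?pm) (map_pmf (unwrap lo M) (map_pmf ?f ?A')) \<le> \<delta>"
    using tv_dist_map_le[of ?pm "map_pmf ?f ?A'" "unwrap lo M"] P fin tv by (simp add: H M_def)
  have "tv_dist ?A ?A' \<le> tv_dist (map_pmf (\<lambda>x. x mod W) ?U) (pmf_of_set {..<W}) + tv_dist (map_pmf (\<lambda>x. x mod g) ?U) (pmf_of_set {..<g})"
    using U Wg by (intro tv_dist_pair_le) simp_all
  also have "\<dots> \<le> real W / real (2 ^ w) + real g / real (2 ^ w)"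
    using W0 g by (intro add_mono tv_dist_mod_uniform) simp_all
  finally have "tv_dist ?A' ?A \<le> real W / 2 ^ w + real g / 2 ^ w"
    by (simp add: tv_dist_def abs_minus_commute)
  then have 3: "tv_dist (map_pmf (unwrap lo M) (map_pmf ?f ?A')) (map_pmf (unwrap lo M) (map_pmf ?f ?A)) \<le> real W / 2 ^ w + real g / 2 ^ w"
    using tv_dist_map_le[of ?A' ?A ?f] tv_dist_map_le[of "map_pmf ?f ?A'" "map_pmf ?f ?A" "unwrap lo M"] fin by simp
  have "tv_dist P (map_pmf (unwrap lo M) (map_pmf ?f ?A))
    \<le> tv_dist P (map_pmf (unwrap lo M) ?pm) + tv_dist (map_pmf (unwrap lo M) ?pm) (map_pmf (unwrap lo M) (map_pmf ?f ?A))"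
    using P fin by (intro tv_dist_triangle) simp_all
  also have "tv_dist (map_pmf (unwrap lo M) ?pm) (map_pmf (unwrap lo M) (map_pmf ?f ?A))
    \<le> tv_dist (map_pmf (unwrap lo M) ?pm) (map_pmf (unwrap lo M) (map_pmf ?f ?A'))
      + tv_dist (map_pmf (unwrap lo M) (map_pmf ?f ?A')) (map_pmf (unwrap lo M) (map_pmf ?f ?A))"
    using P fin by (intro tv_dist_triangle) simp_all
  finally show ?thesis using 1 2 3 unfolding W_def[symmetric] M_def[symmetric] by linarith
qed

section \<open>Program length and execution\<close>

lemma compile_prog_Cons: "compile_prog (p # ps) = compile_stmt p @ compile_prog ps"
  and compile_prog_append: "compile_prog (ps @ qs) = compile_prog ps @ compile_prog qs"
  and compile_prog_Nil: "compile_prog [] = []"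
  by (simp_all add: compile_prog_def)

lemma length_compile_concat_map:
  assumes "\<And>x. x \<in> set xs \<Longrightarrow> length (compile_prog (f x)) \<le> c"
  shows "length (compile_prog (concat (map f xs))) \<le> length xs * c"
  using assms
proof (induction xs)
  case (Cons x xs)
  have "length (compile_prog (f x)) \<le> c" "length (compile_prog (concat (map f xs))) \<le> length xs * c"
    using Cons by auto
  then show ?case by (simp add: compile_prog_append)
qed (simp add: compile_prog_Nil)

lemma length_compile_map:
  assumes "\<And>x. x \<in> set xs \<Longrightarrow> length (compile_stmt (f x)) \<le> c"
  shows "length (compile_prog (map f xs)) \<le> length xs * c"
  using length_compile_concat_map[of xs "\<lambda>x. [f x]" c] assms
  by (simp add: compile_prog_Cons compile_prog_Nil)

lemma length_compile_replicate:
  "length (compile_prog (concat (replicate n blk))) = n * length (compile_prog blk)"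
  by (induction n) (simp_all add: compile_prog_append compile_prog_Nil)

lemmas length_simps = compile_prog_Cons compile_prog_Nil Monus_def Leq_def Eq_def Let_def

text \<open>200 instructions are a generous allowance per statement; what matters is the product of
  the Y accumulators and the K keys, paid once per sample.\<close>

lemma length_tally_step:
  "length (compile_prog (Draw cX # tally_step L Y K tab)) \<le> 200 * (1 + Y * K)"
proof -
  have "length (compile_prog (tally_cell tab K y)) \<le> K * 200" for y
  proof -
    have "length (compile_prog (tally_cell tab K y)) \<le> length [0..<K] * 200"
      unfolding tally_cell_def by (rule length_compile_map) (simp add: length_simps)
    then show ?thesis by simp
  qed
  then have "length (compile_prog (concat (map (tally_cell tab K) [0..<Y]))) \<le> length [0..<Y] * (K * 200)"
    by (intro length_compile_concat_map)
  then show ?thesis by (simp add: tally_step_def key_expr_def length_simps)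
qed

lemma length_learner:
  "length (compile_prog (learner_prog b n1 L G D R m))
    \<le> 200 * (2 + n1 + m * (1 + G * L * ((G + 1) * (G * L))) + G * L)"
proof -
  let ?Y = "G * L"
  let ?tab = "\<lambda>c y. table L D R (c div ?Y) (c mod ?Y) y"
  have 1: "length (compile_prog (Draw cX # scan_step)) \<le> 200"
    by (simp add: scan_step_def length_simps)
  have 2: "length (compile_prog (setup_grid L G)) \<le> 200"
    by (simp add: setup_grid_def length_simps)
  have "length (compile_prog (accumulate T ?Y)) \<le> length [0..<?Y] * 200" for T
    unfolding accumulate_def by (rule length_compile_concat_map) (simp add: length_simps)
  then have 3: "length (compile_prog (accumulate (m * R) ?Y)) \<le> ?Y * 200" by simp
  have 4: "n1 * length (compile_prog (Draw cX # scan_step)) \<le> n1 * 200"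
    using 1 by (rule mult_le_mono2)
  have 5: "m * length (compile_prog (Draw cX # tally_step L ?Y ((G + 1) * ?Y) ?tab)) \<le> m * (200 * (1 + ?Y * ((G + 1) * ?Y)))"
    by (intro mult_le_mono2 length_tally_step)
  have "length (compile_prog (learner_prog b n1 L G D R m))
    = 2 + (n1 * length (compile_prog (Draw cX # scan_step)) + (length (compile_prog (setup_grid L G))
      + (m * length (compile_prog (Draw cX # tally_step L ?Y ((G + 1) * ?Y) ?tab)) + length (compile_prog (accumulate (m * R) ?Y)))))"
    unfolding learner_prog_def
    by (subst compile_prog_Cons) (simp only: compile_prog_append length_append length_compile_replicate, simp)
  also have "\<dots> \<le> 2 + (n1 * 200 + (200 + (m * (200 * (1 + ?Y * ((G + 1) * ?Y))) + ?Y * 200)))"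
    using 2 3 4 5 by (intro add_mono) simp_all
  also have "\<dots> \<le> 200 * (2 + n1 + m * (1 + ?Y * ((G + 1) * ?Y)) + ?Y)"
    by (simp add: algebra_simps)
  finally show ?thesis .
qed

lemma length_generator: "length (compile_prog (generator_prog L Y)) \<le> 200 * (2 + Y)"
proof -
  have "length (compile_prog (search Y)) \<le> length [0..<Y] * 200"
    unfolding search_def by (rule length_compile_map) (simp add: length_simps)
  moreover have "length (compile_prog (emit L)) \<le> 200" by (simp add: emit_def length_simps)
  ultimately show ?thesis
    by (simp add: generator_prog_def compile_prog_append length_simps)
qed

lemma draws_learner: "length (filter is_draw (learner_prog b n1 L G D R m)) = n1 + m"
proof -
  have none: "filter is_draw ps = []" if "\<forall>p\<in>set ps. is_assign p" for ps
  proof -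
    have "\<not> is_draw p" if "is_assign p" for p using that by (cases p) auto
    then show ?thesis using that by (auto simp: filter_empty_conv)
  qed
  have rep: "length (filter is_draw (concat (replicate n blk))) = n * length (filter is_draw blk)" for n blk
    by (induction n) simp_all
  show ?thesis unfolding learner_prog_def
    by (simp add: rep none[OF is_assign_parts(1)] none[OF is_assign_parts(2)] none[OF is_assign_parts(3)] none[OF is_assign_parts(4)])
qed

section \<open>Transfer from statements to machine runs\<close>

lemma wf_learner:
  assumes "80 + G * L < 2 ^ w"
  shows "\<forall>p\<in>set (learner_prog b n1 L G D R m). wf_stmt w p"
proof -
  have c: "64 < (2 :: nat) ^ w" "65 < (2 :: nat) ^ w" "66 < (2 :: nat) ^ w" "67 < (2 :: nat) ^ w" "68 < (2 :: nat) ^ w"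
    "69 < (2 :: nat) ^ w" "70 < (2 :: nat) ^ w" "71 < (2 :: nat) ^ w" "72 < (2 :: nat) ^ w" "73 < (2 :: nat) ^ w" "74 < (2 :: nat) ^ w"
    using assms by linarith+
  have acc: "y < G * L \<Longrightarrow> 80 + y < 2 ^ w" for y using assms by linarith
  note defs = user_cell_def length_simps
  have "\<forall>p\<in>set scan_step. wf_stmt w p" "\<forall>p\<in>set (setup_grid L G). wf_stmt w p"
    "\<forall>p\<in>set (accumulate T (G * L)). wf_stmt w p" "\<forall>p\<in>set (tally_step L (G * L) K tab). wf_stmt w p" for T K tab
    using c acc by (auto simp: scan_step_def setup_grid_def accumulate_def tally_step_def tally_cell_def key_expr_def defs)
  then show ?thesis using c unfolding learner_prog_def by (auto simp: defs)
qed

lemma wf_generator: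
  assumes "80 + Y < 2 ^ w"
  shows "\<forall>p\<in>set (generator_prog L Y). wf_stmt w p"
proof -
  have c: "64 < (2 :: nat) ^ w" "65 < (2 :: nat) ^ w" "66 < (2 :: nat) ^ w" "67 < (2 :: nat) ^ w" "68 < (2 :: nat) ^ w"
    "69 < (2 :: nat) ^ w" "70 < (2 :: nat) ^ w" "71 < (2 :: nat) ^ w" "72 < (2 :: nat) ^ w" "73 < (2 :: nat) ^ w" "74 < (2 :: nat) ^ w"
    using assms by linarith+
  have acc: "y < Y \<Longrightarrow> 80 + y < 2 ^ w" for y using assms by linarith
  note defs = user_cell_def length_simps
  have "\<forall>p\<in>set (search Y). wf_stmt w p" "\<forall>p\<in>set (emit L). wf_stmt w p"
    using c acc by (auto simp: search_def emit_def defs)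
  then show ?thesis using c unfolding generator_prog_def by (auto simp: defs)
qed

lemma run_learner_straight:
  assumes "length (compile_prog ps) \<le> T"
  shows "run_learner w P (compile_prog ps) T
    = map_pmf (\<lambda>m. \<lparr>pc = length (compile_prog ps), mem = m, samples_used = length (filter is_draw ps)\<rparr>)
        (mem_run w P (compile_prog ps) (\<lambda>_. 0))"
  unfolding run_learner_def init_state_def
  by (subst run_jump_free[OF jump_free_compile_prog assms]) (simp add: samples_compile_prog)

lemma run_generator_straight:
  assumes "length (compile_prog ps) \<le> T"
  shows "run_generator w (compile_prog ps) T \<sigma>
    = map_pmf (\<lambda>m. \<lparr>pc = length (compile_prog ps), mem = m, samples_used = samples_used \<sigma> + length (filter is_draw ps)\<rparr>)
        (mem_run w (return_pmf 0) (compile_prog ps) (mem \<sigma>))"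
proof -
  have "\<sigma>\<lparr>pc := 0\<rparr> = \<lparr>pc = 0, mem = mem \<sigma>, samples_used = samples_used \<sigma>\<rparr>" by simp
  then show ?thesis
    unfolding run_generator_def
    by (simp only: run_jump_free[OF jump_free_compile_prog assms] samples_compile_prog)
qed

lemma output_rv_straight:
  assumes "length (compile_prog ps) \<le> T" "\<forall>p\<in>set ps. wf_stmt w p" "64 \<le> (2 :: nat) ^ w"
  shows "output_rv w (compile_prog ps) T \<sigma> = map_pmf (\<lambda>s. s 0) (srun w (return_pmf 0) ps (strip (mem \<sigma>)))"
proof -
  have "map_pmf (\<lambda>s. s 0) (srun w (return_pmf 0) ps (strip (mem \<sigma>)))
      = map_pmf (\<lambda>m. strip m 0) (mem_run w (return_pmf 0) (compile_prog ps) (mem \<sigma>))"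
    by (simp add: mem_run_compile_prog[OF assms(2,3), symmetric] pmf.map_comp o_def)
  then show ?thesis
    unfolding output_rv_def run_generator_straight[OF assms(1)]
    by (simp add: pmf.map_comp o_def strip_def)
qed

lemma straight_learner_properties:
  assumes T: "length (compile_prog ls) \<le> T" "length (compile_prog gs) \<le> T"
  shows "uses_samples w P (compile_prog ls) T (length (filter is_draw ls))"
    and "runs_in_time w P (compile_prog ls) (compile_prog gs) T"
  using T by (auto simp: uses_samples_def runs_in_time_def run_learner_straight run_generator_straight halted_def)

lemma straight_success_prob:
  assumes T: "length (compile_prog ls) \<le> T" "length (compile_prog gs) \<le> T"
    and wf: "\<forall>p\<in>set ls. wf_stmt w p" "\<forall>p\<in>set gs. wf_stmt w p" "64 \<le> (2 :: nat) ^ w"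
  shows "success_prob w P (compile_prog ls) (compile_prog gs) T \<epsilon>
    = prob (srun w P ls (\<lambda>_. 0)) {s. tv_dist P (map_pmf (\<lambda>s. s 0) (srun w (return_pmf 0) gs s)) \<le> \<epsilon>}"
proof -
  have "strip (\<lambda>_. 0) = (\<lambda>_. 0)" by (simp add: strip_def)
  then have "srun w P ls (\<lambda>_. 0) = map_pmf strip (mem_run w P (compile_prog ls) (\<lambda>_. 0))"
    using mem_run_compile_prog[OF wf(1,3), of P "\<lambda>_. 0"] by simp
  then show ?thesis
    unfolding success_prob_def run_learner_straight[OF T(1)]
    by (simp add: output_rv_straight[OF T(2) wf(2,3)] vimage_def)
qed

text \<open>A union bound over two rounds: either the first is bad, or the second fails given a good
  outcome of the first. The second round must be analysed conditionally, as its grid depends on the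
  first.\<close>

lemma prob_bind_le:
  assumes bad: "prob A B \<le> a" and c: "c \<ge> 0"
    and good: "\<And>x. x \<in> set_pmf A \<Longrightarrow> x \<notin> B \<Longrightarrow> prob (f x) S \<le> c"
  shows "prob (bind_pmf A f) S \<le> a + c"
proof -
  have "ennreal (prob (bind_pmf A f) S) = emeasure (measure_pmf (bind_pmf A f)) S"
    by (simp add: measure_pmf.emeasure_eq_measure)
  also have "\<dots> = (\<integral>\<^sup>+ x. emeasure (measure_pmf (f x)) S \<partial>measure_pmf A)"
    by (rule emeasure_bind_pmf)
  also have "\<dots> \<le> (\<integral>\<^sup>+ x. indicator B x + ennreal c \<partial>measure_pmf A)"
  proof (intro nn_integral_mono_AE AE_pmfI)
    fix x assume "x \<in> set_pmf A"
    then show "emeasure (measure_pmf (f x)) S \<le> indicator B x + ennreal c"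
      using good[of x] c
      by (cases "x \<in> B") (auto simp: measure_pmf.emeasure_eq_measure ennreal_leI intro: add_increasing2 order.trans[OF ennreal_leI[OF measure_pmf.prob_le_1]])
  qed
  also have "\<dots> = ennreal (prob A B) + ennreal c"
    by (simp add: nn_integral_add measure_pmf.emeasure_eq_measure)
  also have "\<dots> = ennreal (prob A B + c)" using c by (simp add: ennreal_plus)
  finally have "prob (bind_pmf A f) S \<le> prob A B + c"
    using c by (subst (asm) ennreal_le_iff) auto
  then show ?thesis using bad by simp
qed

section \<open>Error budget\<close>

text \<open>The factor \<open>exp (- 4 * D)\<close> has to absorb \<open>L\<close>,
  \<open>exp 4\<close> and the squared accuracy \<open>2 ^ (2 * l)\<close>. Since D is a large
  multiple of \<open>L^2 * l^2\<close>, it exceeds the logarithms of all of them.\<close>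

lemma bias_small:
  assumes L: "(L :: nat) > 0" and l: "(l :: nat) > 0" and D: "D = (L * (65 * l))\<^sup>2"
  shows "sqrt (real L * (2 * exp 4 * exp (- 4 * real D))) \<le> 1 / (16 * 2 ^ l)"
proof -
  \<comment> \<open>The exponent collects \<open>L \<le> 2 ^ L\<close>, the factor
    \<open>2 ^ (2 * l)\<close> and \<open>2 * exp 4 * 256 \<le> 2 ^ 16\<close>, with 1 to
    spare.\<close>
  have "L + 2 * l + 17 \<le> 4 * D"
  proof -
    have "L * 1 \<le> L * L" "l * 1 \<le> l * l" using L l by (intro mult_left_mono; simp)+
    moreover have "(L * L) * 1 \<le> (L * L) * (l * l)" "1 * (l * l) \<le> (L * L) * (l * l)"
      using L l by (intro mult_mono; simp)+
    moreover have "1 \<le> (L * L) * (l * l)" using L l by (simp add: Suc_le_eq)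
    moreover have "4 * D = 16900 * ((L * L) * (l * l))" by (simp add: D power2_eq_square)
    ultimately show ?thesis by linarith
  qed
  then have "(2 :: real) ^ (L + 2 * l + 17) \<le> 2 ^ (4 * D)" by (intro power_increasing) auto
  also have "\<dots> \<le> exp 1 ^ (4 * D)" using exp_ge_add_one_self[of 1] by (intro power_mono) auto
  also have "\<dots> = exp (4 * real D)" by (simp flip: exp_of_nat_mult)
  finally have big: "2 ^ (L + 2 * l + 17) \<le> exp (4 * real D)" .
  have "exp 4 = exp (1 :: real) ^ 4" by (simp flip: exp_of_nat_mult)
  also have "\<dots> \<le> 3 ^ 4" using exp_le by (intro power_mono) auto
  finally have e4: "exp (4 :: real) \<le> 2 ^ 7" by simp
  have "real L * (2 * exp 4) * (256 * 2 ^ (2 * l)) \<le> 2 ^ L * (2 * 2 ^ 7) * (256 * 2 ^ (2 * l))"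
    using e4 of_nat_less_two_power[of L, where 'a = real] by (intro mult_mono) (auto simp: less_imp_le)
  also have "\<dots> = 2 ^ (L + 2 * l + 16)" by (simp add: power_add)
  also have "\<dots> \<le> 2 ^ (L + 2 * l + 17)" by (intro power_increasing) auto
  also note big
  finally have "real L * (2 * exp 4) * (256 * 2 ^ (2 * l)) \<le> exp (4 * real D)" .
  then have "real L * (2 * exp 4 * exp (- 4 * real D)) \<le> 1 / (256 * 2 ^ (2 * l))"
    by (simp add: exp_minus field_simps)
  also have "\<dots> = (1 / (16 * 2 ^ l))\<^sup>2" by (simp add: power_divide power_mult_distrib power_mult[symmetric] mult.commute)
  finally show ?thesis by (intro real_le_lsqrt) auto
qed

text \<open>Up to constants, the sample size is the dimension \<open>L * D\<close> of the projection
  over the squared accuracy. The factor \<open>4096 = 64 * 64\<close> leaves a radicand of at most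
  \<open>1 / (8 * 2 ^ l)\<close> squared.\<close>

lemma deviation_small:
  assumes L: "(L :: nat) > 0" and D: "(D :: nat) > 0" and m: "m = 4096 * L * D * (2 ^ l)\<^sup>2"
  shows "sqrt (20 * real (L * (2 * D + 1)) / real m) \<le> 1 / (8 * 2 ^ l)"
proof -
  have "L * (2 * D + 1) \<le> 3 * (L * D)" using D by (simp add: distrib_left Suc_le_eq)
  then have "real (L * (2 * D + 1)) \<le> real (3 * (L * D))" by (rule of_nat_mono)
  then have "20 * real (L * (2 * D + 1)) / real m \<le> 60 * (real L * real D) / real m"
    by (intro divide_right_mono) auto
  also have "\<dots> = 60 / (4096 * (2 ^ l)\<^sup>2)" using L D by (simp add: m)
  also have "\<dots> \<le> 64 / (4096 * (2 ^ l)\<^sup>2)" by (intro divide_right_mono) auto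
  also have "\<dots> = (1 / (8 * 2 ^ l))\<^sup>2" by (simp add: power_divide power_mult_distrib)
  finally show ?thesis by (intro real_le_lsqrt) auto
qed

text \<open>From \<open>(g - 1) * G \<le> S < g * h\<close>, the relative block length is at most
  \<open>1 / G\<close>. The other factors are at most \<open>19.2 * D^2\<close>, and
  \<open>19.2 / 160 \<le> 1 / 8\<close> explains the 160.\<close>

lemma blocking_small:
  assumes D: "(D :: nat) > 0" and G: "G = 160 * D\<^sup>2 * 2 ^ l"
  shows "real (2 * D + 1) * (2 * pi * real D * real (grid_step G S - 1) / real (grid_step G S * grid_size G S)) \<le> 1 / (8 * 2 ^ l)"
proof -
  let ?N = "grid_step G S * grid_size G S"
  have G0: "G > 0" using D by (simp add: G)
  note gb = grid_bounds[OF G0, of S]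
  have N: "real ?N > 0" using gb(1,2) by simp
  have "(grid_step G S - 1) * G \<le> S" by (simp add: grid_step_def)
  then have "real ((grid_step G S - 1) * G) \<le> real ?N" using gb(4) by (intro of_nat_mono) linarith
  then have "real (grid_step G S - 1) * real G \<le> real ?N" by simp
  then have "real (grid_step G S - 1) / real ?N \<le> 1 / real G"
    using N G0 by (simp add: field_simps)
  then have "real (2 * D + 1) * (2 * pi * real D) * (real (grid_step G S - 1) / real ?N) \<le> (3 * real D) * (2 * 3.2 * real D) * (1 / real G)"
    using D pi_approx by (intro mult_mono) (auto simp: Suc_le_eq)
  also have "\<dots> = 19.2 / (160 * 2 ^ l)" using D by (simp add: G power2_eq_square)
  also have "\<dots> \<le> 1 / (8 * 2 ^ l)" by (simp add: field_simps)
  finally show ?thesis by (simp add: mult.assoc)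
qed

text \<open>As soon as blocks have at least 2 points, there are more than \<open>G / 2\<close> of
  them per residue class, hence more than \<open>2 * D\<close>. This is the alternative that
  \<open>low_pass_rescale\<close> asks for.\<close>

lemma grid_coarse_or_exact:
  assumes D: "D > 0" and G: "4 * D \<le> G"
  shows "grid_step G S = 1 \<or> 2 * D < grid_size G S"
proof (rule ccontr)
  assume "\<not> ?thesis"
  then have g: "grid_step G S \<noteq> 1" and h: "grid_size G S \<le> 2 * D" by auto
  have G0: "G > 0" using assms by linarith
  define q where "q = S div G"
  have q: "q > 0" using g by (simp add: grid_step_def q_def)
  have "G * q \<le> S" unfolding q_def by (rule times_div_less_eq_dividend)
  also have "S < grid_step G S * grid_size G S" by (rule grid_bounds(4)[OF G0])
  also have "\<dots> \<le> (1 + q) * (2 * D)" unfolding grid_step_def q_def[symmetric] using h by (intro mult_left_mono) auto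
  also have "\<dots> \<le> (q + q) * (2 * D)" using q by (intro mult_right_mono) auto
  also have "\<dots> = 4 * D * q" by simp
  also have "\<dots> \<le> G * q" using G by (rule mult_le_mono1)
  finally show False by simp
qed

text \<open>In units of \<open>1 / 2 ^ l\<close>, bias, sampling and blocking contribute 1/16, 1/8
  and 1/8. Rounding the table adds \<open>L * G / R\<close>, which is another 1/8 by the choice of
  R. The bound on the total weight is for the error of the reduced random words.\<close>

lemma stage_two:
  fixes P :: "nat pmf"
  assumes fin: "finite (set_pmf P)"
    and bound: "\<And>\<theta>. (norm (expect P (\<lambda>x. cis (\<theta> * real x))))\<^sup>2
      \<le> exp (- (4 * s\<^sup>2 * (sin (fact k * (\<theta> / 2)))\<^sup>2 / (fact k)\<^sup>2))"
    and s: "s \<ge> 0" and k: "k > 0" and l: "l > 0"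
    and L: "L = fact k" and D: "D = (L * (65 * l))\<^sup>2" and m: "m = 4096 * L * D * (2 ^ l)\<^sup>2"
    and G: "G = 160 * D\<^sup>2 * 2 ^ l" and R: "R = 8 * L * G * 2 ^ l"
    and width: "real (2 * S + 1) \<le> (s + real k) * real (65 * l)"
    and g: "g = grid_step G S" and h: "h = grid_size G S"
  shows "prob (replicate_pmf m P) {zs. \<not>
      ((\<Sum>y<G * L. weight L D R g h zs y) > 0 \<and> real (\<Sum>y<G * L. weight L D R g h zs y) \<le> 2 * (real m * real R) \<and>
       tv_dist (map_pmf (\<lambda>x. x mod (L * (g * h))) P) (hyp_law L g (G * L) (weight L D R g h zs)) \<le> 7 / (16 * 2 ^ l))} \<le> 1 / 20"
proof -
  have L0: "L > 0" by (simp add: L)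
  have D0: "D > 0" using L0 l by (simp add: D)
  have G0: "G > 0" using D0 by (simp add: G)
  have m0: "m > 0" using L0 D0 by (simp add: m)
  have R0: "R > 0" using L0 G0 by (simp add: R)
  note gb = grid_bounds[OF G0, of S, folded g h]
  have "4 * D \<le> G"
  proof -
    have "D * 1 \<le> D * D" using D0 by (intro mult_left_mono) auto
    then have "160 * D \<le> 160 * D\<^sup>2" by (simp add: power2_eq_square)
    also have "160 * D\<^sup>2 * 1 \<le> G" unfolding G by (intro mult_left_mono) auto
    finally show ?thesis by linarith
  qed
  then have gh: "g = 1 \<or> 2 * D < h" using grid_coarse_or_exact[OF D0] by (simp add: g h)
  have N: "real (g * h) \<le> (s + real k) * real (65 * l)"
    using gb(5) width by (meson of_nat_mono order.trans)
  let ?p = "map_pmf (\<lambda>x. x mod (L * (g * h))) P"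
  let ?err = "\<lambda>zs. \<Sum>x<L * (g * h). \<bar>pmf ?p x - (\<Sum>y\<leftarrow>zs. block_kernel L g h D x y) / real m\<bar>"
  let ?b = "sqrt (real L * (2 * exp 4 * exp (- 4 * real D))) + sqrt (20 * real (L * (2 * D + 1)) / real m)
        + real (2 * D + 1) * (2 * pi * real D * real (g - 1) / real (g * h))"
  have b: "?b \<le> 5 / (16 * 2 ^ l)"
  proof -
    have "?b \<le> 1 / (16 * 2 ^ l) + 1 / (8 * 2 ^ l) + 1 / (8 * 2 ^ l)"
      unfolding g h by (intro add_mono bias_small[OF L0 l D] deviation_small[OF L0 D0 m] blocking_small[OF D0 G])
    also have "\<dots> = 5 / (16 * 2 ^ l)" by (simp add: field_simps)
    finally show ?thesis .
  qed
  have "prob (replicate_pmf m P) {zs. \<not> ?err zs \<le> ?b} \<le> 1 / 20"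
  proof (rule block_estimate[OF fin L0 gb(1,2) gh _ _ m0])
    fix \<beta> d assume "D < d" "d < g * h - D"
    then show "(norm (expect P (\<lambda>x. chi (L * (g * h)) ((\<beta> * int (g * h) + int d) * int x))))\<^sup>2
        \<le> exp 4 * (exp (- 4 * real d) + exp (- 4 * real (g * h - d)))"
      unfolding L using l by (intro char_decay[OF bound s k _ N]) (simp_all add: D L)
  qed simp
  moreover have "prob (replicate_pmf m P) {zs. \<not>
      ((\<Sum>y<G * L. weight L D R g h zs y) > 0 \<and> real (\<Sum>y<G * L. weight L D R g h zs y) \<le> 2 * (real m * real R) \<and>
       tv_dist ?p (hyp_law L g (G * L) (weight L D R g h zs)) \<le> 7 / (16 * 2 ^ l))}
    \<le> prob (replicate_pmf m P) {zs. \<not> ?err zs \<le> ?b}"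
  proof (rule prob_mono_supp, rule ccontr)
    fix zs assume zs: "zs \<in> set_pmf (replicate_pmf m P)"
      and bad: "zs \<in> {zs. \<not> ((\<Sum>y<G * L. weight L D R g h zs y) > 0 \<and> real (\<Sum>y<G * L. weight L D R g h zs y) \<le> 2 * (real m * real R) \<and>
       tv_dist ?p (hyp_law L g (G * L) (weight L D R g h zs)) \<le> 7 / (16 * 2 ^ l))}"
      and "zs \<notin> {zs. \<not> ?err zs \<le> ?b}"
    then have err: "?err zs \<le> 5 / (16 * 2 ^ l)" using b by simp
    have len: "length zs = m" using zs by (simp add: set_replicate_pmf)
    then have ne: "zs \<noteq> []" using m0 by auto
    have "(\<Sum>x<L * (g * h). \<bar>pmf ?p x - real (weight L D R g h zs (cell L g h x)) / (real m * real R * real g)\<bar>)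
        \<le> (\<Sum>x<L * (g * h). \<bar>pmf ?p x - (\<Sum>y\<leftarrow>zs. block_kernel L g h D x y) / real m\<bar> + 1 / (real R * real g))"
      using weight_approx[OF L0 gb(1,2) R0 ne pmf_nonneg, where D = D] by (intro sum_mono) (simp add: len)
    also have "\<dots> = ?err zs + real (L * (g * h)) / (real R * real g)"
      by (simp add: sum.distrib)
    also have "real (L * (g * h)) / (real R * real g) = real L * real h / real R"
      using gb(1) by simp
    also have "\<dots> \<le> real L * real G / real R"
      using gb(3) by (intro divide_right_mono mult_left_mono) auto
    also have "\<dots> = 1 / (8 * 2 ^ l)" using L0 G0 by (simp add: R)
    finally have close: "(\<Sum>x<L * (g * h). \<bar>pmf ?p x - real (weight L D R g h zs (cell L g h x)) / (real m * real R * real g)\<bar>) \<le> 7 / (16 * 2 ^ l)"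
      using err by (simp add: field_simps)
    have "(1 :: real) \<le> 2 ^ l" by simp
    then have "7 < 16 * (2 :: real) ^ l" by linarith
    then have d1: "7 / (16 * 2 ^ l) < (1 :: real)" by (simp add: divide_less_eq)
    have supp: "set_pmf ?p \<subseteq> {..<L * (g * h)}" using L0 gb(1,2) by auto
    have hL: "h * L \<le> G * L" using gb(3) by (rule mult_le_mono1)
    have w0: "weight L D R g h zs y = 0" if "y \<ge> h * L" for y
      using that by (simp add: weight_def table_def)
    have T: "real m * real R > 0" using m0 R0 by simp
    note H = hyp_law_bound[OF L0 gb(1,2) hL T w0 supp close d1]
    have "real (\<Sum>y<G * L. weight L D R g h zs y) \<le> 2 * (real m * real R)"
    proof -
      have "real (\<Sum>y<G * L. weight L D R g h zs y) \<le> (1 + 7 / (16 * 2 ^ l)) * (real m * real R)" by (rule H(3))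
      also have "\<dots> \<le> 2 * (real m * real R)" using d1 T by (intro mult_right_mono) linarith+
      finally show ?thesis .
    qed
    then show False using bad H(1,2) by simp
  qed
  ultimately show ?thesis by linarith
qed

text \<open>\<open>n1 * \<delta> = 5\<close> makes each quantile missed with probability at most
  \<open>exp (- 5)\<close>, while t is chosen to make an outlier occur among all samples with
  probability at most 1/100.\<close>

lemma stage_one:
  fixes P :: "nat pmf"
  assumes supp: "set_pmf P \<subseteq> {..b}"
    and tail: "\<And>t. prob P {x. \<bar>real x - \<mu>\<bar> \<ge> t} \<le> 2 * exp (1 - t / (s + real k))"
    and s: "s \<ge> 0" and k: "k > 0" and l: "l > 0" and n1: "n1 = 80 * 2 ^ l"
  shows "prob (replicate_pmf n1 P) {xs. \<not>
      (prob P {range_lo b xs..range_hi xs} \<ge> 1 - 1 / (8 * 2 ^ l) \<and> range_lo b xs \<le> range_hi xs \<and>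
       real (2 * (range_hi xs - range_lo b xs) + 1) \<le> (s + real k) * real (65 * l))} \<le> 1 / 20"
proof -
  define \<tau> where "\<tau> = s + real k"
  have \<tau>: "\<tau> \<ge> 1" using s k by (simp add: \<tau>_def)
  define t where "t = \<tau> * (1 + ln (200 * real n1))"
  define \<delta> where "\<delta> = 1 / (16 * 2 ^ l :: real)"
  have n1p: "n1 > 0" "real n1 > 0" by (simp_all add: n1)
  have d: "0 \<le> \<delta>" "\<delta> \<le> 1" by (simp_all add: \<delta>_def divide_le_eq) (use one_le_power[of "2 :: real" l] in linarith)
  have "1 - t / \<tau> = - ln (200 * real n1)" using \<tau> by (simp add: t_def)
  then have "exp (1 - t / \<tau>) = 1 / (200 * real n1)" using n1p by (simp add: exp_minus inverse_eq_divide)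
  then have eta: "prob P {x. \<bar>real x - \<mu>\<bar> \<ge> t} \<le> 1 / (100 * real n1)"
    using tail[of t] by (simp add: \<tau>_def)
  have pw: "(1 - \<delta>) ^ n1 \<le> 1 / 90"
  proof -
    have "(1 - \<delta>) ^ n1 \<le> exp (- \<delta>) ^ n1" using d exp_ge_add_one_self[of "- \<delta>"] by (intro power_mono) auto
    also have "\<dots> = exp (real n1 * - \<delta>)" by (rule exp_of_nat_mult[symmetric])
    also have "real n1 * - \<delta> = - 5" by (simp add: n1 \<delta>_def)
    also have "exp (- 5 :: real) = 1 / exp 1 ^ 5" by (simp add: exp_minus inverse_eq_divide flip: exp_of_nat_mult)
    also have "\<dots> \<le> 1 / (5 / 2) ^ 5"
      using exp_lower_Taylor_quadratic[of 1] by (intro divide_left_mono power_mono) auto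
    also have "\<dots> \<le> 1 / 90" by (simp add: power_numeral_even power_numeral_odd)
    finally show ?thesis .
  qed
  \<comment> \<open>The origin of 65: \<open>ln (200 * n1) \<le> 14 + l\<close> leads to
    \<open>61 + 4 * l\<close>, which is at most \<open>65 * l\<close> as l is positive.\<close>
  have wide: "4 * t + 1 \<le> \<tau> * real (65 * l)"
  proof -
    have "200 * real n1 = 16000 * 2 ^ l" by (simp add: n1)
    also have "\<dots> \<le> 2 ^ 14 * 2 ^ l" by (intro mult_right_mono) auto
    also have "\<dots> = 2 ^ (14 + l)" by (simp add: power_add)
    finally have "ln (200 * real n1) \<le> ln (2 ^ (14 + l))" using n1p by (intro ln_mono) auto
    also have "\<dots> = real (14 + l) * ln 2" by (rule ln_realpow)
    also have "\<dots> \<le> real (14 + l) * 1" using ln_2_less_1 by (intro mult_left_mono) auto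
    finally have "4 * (1 + ln (200 * real n1)) + 1 \<le> 61 + 4 * real l" by simp
    also have "\<dots> \<le> real (65 * l)" using l by simp
    finally have "\<tau> * (4 * (1 + ln (200 * real n1)) + 1) \<le> \<tau> * real (65 * l)" using \<tau> by (intro mult_left_mono) auto
    moreover have "4 * t + 1 \<le> \<tau> * (4 * (1 + ln (200 * real n1)) + 1)" using \<tau> by (simp add: t_def algebra_simps)
    ultimately show ?thesis by linarith
  qed
  have "prob (replicate_pmf n1 P) {xs. \<not>
      (prob P {range_lo b xs..range_hi xs} \<ge> 1 - 1 / (8 * 2 ^ l) \<and> range_lo b xs \<le> range_hi xs \<and>
       real (2 * (range_hi xs - range_lo b xs) + 1) \<le> (s + real k) * real (65 * l))}
    \<le> prob (replicate_pmf n1 P)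
      {xs. \<not> (prob P {range_lo b xs..range_hi xs} \<ge> 1 - 2 * \<delta> \<and>
              range_lo b xs \<le> range_hi xs \<and> real (range_hi xs - range_lo b xs) \<le> 2 * t)}"
    by (intro prob_mono_supp) (use wide in \<open>auto simp: \<delta>_def \<tau>_def\<close>)
  also have "\<dots> \<le> 2 * (1 - \<delta>) ^ n1 + real n1 * (1 / (100 * real n1))"
    by (rule sample_range[OF supp d n1p(1) eta])
  also have "\<dots> \<le> 1 / 20" using pw n1p by simp
  finally show ?thesis .
qed

text \<open>Each round fails with probability at most 1/20. In units of \<open>1 / 2 ^ l\<close>,
  the error is 1/8 for the mass outside the window, 7/16 for the hypothesis and 1/16 for each of the
  two random words.\<close>

lemma learner_success:
  assumes P: "P \<in> siirv n k" and k: "k > 0" and l: "l > 0"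
    and L: "L = fact k" and D: "D = (L * (65 * l))\<^sup>2" and m: "m = 4096 * L * D * (2 ^ l)\<^sup>2"
    and G: "G = 160 * D\<^sup>2 * 2 ^ l" and R: "R = 8 * L * G * 2 ^ l" and n1: "n1 = 80 * 2 ^ l"
    and B1: "8 * L * (n * k + 1) < 2 ^ w" and B2: "(4 * (m * R) + 4) * (G * L + 1) < 2 ^ w"
    and B3: "(G + 2) * (G * L + 90) < (2 :: nat) ^ w"
    and B4: "16 * 2 ^ l * (n * k + 1) \<le> (2 :: nat) ^ w" and B5: "32 * 2 ^ l * (m * R) \<le> (2 :: nat) ^ w"
    and ls: "ls = learner_prog (n * k) n1 L G D R m" and gs: "gs = generator_prog L (G * L)"
    and T: "length (compile_prog ls) \<le> T" "length (compile_prog gs) \<le> T"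
  shows "success_prob w P (compile_prog ls) (compile_prog gs) T (1 / 2 ^ l) \<ge> 9 / 10"
proof -
  obtain \<mu> s :: real where s: "s \<ge> 0" and supp: "set_pmf P \<subseteq> {..n * k}"
    and tail: "\<And>t. prob P {x. \<bar>real x - \<mu>\<bar> \<ge> t} \<le> 2 * exp (1 - t / (s + real k))"
    and char: "\<And>\<theta>. (norm (expect P (\<lambda>x. cis (\<theta> * real x))))\<^sup>2
      \<le> exp (- (4 * s\<^sup>2 * (sin (fact k * (\<theta> / 2)))\<^sup>2 / (fact k)\<^sup>2))"
    by (rule siirv_analytic[OF P k]) blast
  have fin: "finite (set_pmf P)" using supp by (rule finite_subset) simp
  have L0: "L > 0" by (simp add: L)
  have D0: "D > 0" using L0 l by (simp add: D)
  have G0: "G > 0" using D0 by (simp add: G)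
  have m0: "m > 0" using L0 D0 by (simp add: m)
  have R0: "R > 0" using L0 G0 by (simp add: R)
  have n10: "n1 > 0" by (simp add: n1)
  have Y: "80 + G * L < 2 ^ w" "G * L < 2 ^ w" "64 \<le> (2 :: nat) ^ w"
  proof -
    have "1 * (G * L + 90) \<le> (G + 2) * (G * L + 90)" by (intro mult_right_mono) auto
    from le_less_trans[OF this B3] have "G * L + 90 < 2 ^ w" by (simp only: mult_1)
    then show "80 + G * L < 2 ^ w" "G * L < 2 ^ w" "64 \<le> (2 :: nat) ^ w" by linarith+
  qed
  obtain F where F: "srun w P ls (\<lambda>_. 0) = bind_pmf (replicate_pmf n1 P) (\<lambda>xs. map_pmf (F xs) (replicate_pmf m P))"
    and learned: "\<And>S xs zs. xs \<in> set_pmf (replicate_pmf n1 P) \<Longrightarrow> zs \<in> set_pmf (replicate_pmf m P) \<Longrightarrow>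
      range_lo (n * k) xs \<le> range_hi xs \<Longrightarrow> range_hi xs - range_lo (n * k) xs = S \<Longrightarrow>
      learned L (G * L) (range_lo (n * k) xs) (grid_step G S) (grid_size G S)
        (weight L D R (grid_step G S) (grid_size G S) zs) (F xs zs)"
    unfolding ls by (rule srun_learner[OF L0 G0 R0 n10 m0 supp B1 B2 B3]) blast
  define bad where "bad = {s. \<not> tv_dist P (map_pmf (\<lambda>s. s 0) (srun w (return_pmf 0) gs s)) \<le> 1 / 2 ^ l}"
  have "prob (srun w P ls (\<lambda>_. 0)) bad \<le> 1 / 20 + 1 / 20"
    unfolding F
  proof (rule prob_bind_le[OF stage_one[OF supp tail s k l n1]])
    fix xs assume xs: "xs \<in> set_pmf (replicate_pmf n1 P)"
      and "xs \<notin> {xs. \<not> (prob P {range_lo (n * k) xs..range_hi xs} \<ge> 1 - 1 / (8 * 2 ^ l) \<and> range_lo (n * k) xs \<le> range_hi xs \<and>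
       real (2 * (range_hi xs - range_lo (n * k) xs) + 1) \<le> (s + real k) * real (65 * l))}"
    then have win: "prob P {range_lo (n * k) xs..range_hi xs} \<ge> 1 - 1 / (8 * 2 ^ l)"
      and lohi: "range_lo (n * k) xs \<le> range_hi xs"
      and width: "real (2 * (range_hi xs - range_lo (n * k) xs) + 1) \<le> (s + real k) * real (65 * l)"
      by auto
    define lo where "lo = range_lo (n * k) xs"
    define hi where "hi = range_hi xs"
    define S where "S = hi - lo"
    define g where "g = grid_step G S"
    define h where "h = grid_size G S"
    note gb = grid_bounds[OF G0, of S, folded g_def h_def]
    have hib: "hi \<le> n * k" unfolding hi_def range_hi_eq
      using xs supp by (intro Max.boundedI) (auto simp: set_replicate_pmf)
    then have Sb: "S \<le> n * k" "lo \<le> n * k" using lohi by (auto simp: S_def lo_def hi_def)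
    \<comment> \<open>The window has \<open>S + 1\<close> points and fits into one period, so
      reduction modulo the period loses nothing on it.\<close>
    have hiM: "hi < lo + L * (g * h)"
    proof -
      have "1 * (g * h) \<le> L * (g * h)" using L0 by (intro mult_right_mono) auto
      then have "S < L * (g * h)" using gb(4) unfolding mult_1 by (rule less_le_trans[rotated])
      then show ?thesis unfolding S_def by linarith
    qed
    have loM: "lo + 2 * (L * (g * h)) < 2 ^ w"
    proof -
      have "L * (g * h) \<le> L * (2 * (n * k) + 1)" using gb(5) Sb(1) by (intro mult_left_mono) auto
      moreover have "1 * (n * k) \<le> L * (n * k)" using L0 by (intro mult_right_mono) auto
      moreover have "8 * L * (n * k + 1) = 8 * (L * (n * k)) + 8 * L" "L * (2 * (n * k) + 1) = 2 * (L * (n * k)) + L"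
        by (simp_all add: algebra_simps)
      ultimately have "lo + 2 * (L * (g * h)) \<le> 8 * L * (n * k + 1)" using Sb(2) by linarith
      then show ?thesis using B1 by (rule le_less_trans)
    qed
    have pw: "(0 :: real) < 2 ^ w" "(0 :: real) < 2 ^ l" by simp_all
    have gE: "real g / 2 ^ w \<le> 1 / (16 * 2 ^ l)"
    proof -
      have "g \<le> n * k + 1" using gb(6) Sb(1) by linarith
      then have "16 * 2 ^ l * g \<le> 2 ^ w" using B4 by (meson mult_le_mono2 le_trans)
      then have "real (16 * 2 ^ l * g) \<le> real (2 ^ w)" by (rule of_nat_mono)
      then show ?thesis using pw by (simp add: field_simps)
    qed
    let ?q = "weight L D R g h"
    let ?good = "\<lambda>zs. (\<Sum>y<G * L. ?q zs y) > 0 \<and> real (\<Sum>y<G * L. ?q zs y) \<le> 2 * (real m * real R) \<and>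
       tv_dist (map_pmf (\<lambda>x. x mod (L * (g * h))) P) (hyp_law L g (G * L) (?q zs)) \<le> 7 / (16 * 2 ^ l)"
    have "prob (replicate_pmf m P) {zs. F xs zs \<in> bad} \<le> prob (replicate_pmf m P) {zs. \<not> ?good zs}"
    proof (rule prob_mono_supp, rule ccontr)
      fix zs assume zs: "zs \<in> set_pmf (replicate_pmf m P)" and b: "zs \<in> {zs. F xs zs \<in> bad}"
        and "zs \<notin> {zs. \<not> ?good zs}"
      then have "?good zs" by (simp only: mem_Collect_eq not_not)
      then have good: "(\<Sum>y<G * L. ?q zs y) > 0" "real (\<Sum>y<G * L. ?q zs y) \<le> 2 * (real m * real R)"
        "tv_dist (map_pmf (\<lambda>x. x mod (L * (g * h))) P) (hyp_law L g (G * L) (?q zs)) \<le> 7 / (16 * 2 ^ l)"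
        by blast+
      have st: "learned L (G * L) lo g h (?q zs) (F xs zs)"
        using learned[OF xs zs lohi] by (simp add: lo_def hi_def S_def g_def h_def)
      have hL: "h * L \<le> G * L" using gb(3) by (rule mult_le_mono1)
      have q0: "\<forall>y\<ge>h * L. ?q zs y = 0" by (simp add: weight_def table_def)
      have "real (\<Sum>y<G * L. ?q zs y) \<le> real (2 * (m * R))" using good(2) by simp
      then have W: "(\<Sum>y<G * L. ?q zs y) \<le> 2 * (m * R)" by (simp only: of_nat_le_iff)
      have Wb: "(\<Sum>y<G * L. ?q zs y) + 1 < 2 ^ w"
      proof -
        have "(4 * (m * R) + 4) * 1 \<le> (4 * (m * R) + 4) * (G * L + 1)" by (intro mult_left_mono) auto
        from le_less_trans[OF this B2] have "4 * (m * R) + 4 < 2 ^ w" by (simp only: mult_1_right)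
        then show ?thesis using W by linarith
      qed
      have WE: "real (\<Sum>y<G * L. ?q zs y) / 2 ^ w \<le> 1 / (16 * 2 ^ l)"
      proof -
        have "16 * 2 ^ l * (\<Sum>y<G * L. ?q zs y) \<le> 16 * 2 ^ l * (2 * (m * R))" using W by (rule mult_le_mono2)
        also have "\<dots> \<le> 2 ^ w" using B5 by simp
        finally have "real (16 * 2 ^ l * (\<Sum>y<G * L. ?q zs y)) \<le> real (2 ^ w)" by (rule of_nat_mono)
        then have "16 * 2 ^ l * real (\<Sum>y<G * L. ?q zs y) \<le> 2 ^ w" by (simp only: of_nat_mult of_nat_power of_nat_numeral)
        then show ?thesis using pw by (simp add: field_simps)
      qed
      have "tv_dist P (map_pmf (\<lambda>s. s 0) (srun w (return_pmf 0) gs (F xs zs)))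
        \<le> 1 / (8 * 2 ^ l) + 7 / (16 * 2 ^ l) + (real (\<Sum>y<G * L. ?q zs y) / 2 ^ w + real g / 2 ^ w)"
        unfolding gs srun_generator[OF L0 gb(1,2) hL good(1) q0 st loM Y(2) Wb]
        using win by (intro unwrapped_tv[OF fin _ hiM good(1) gb(1) good(3)]) (simp add: lo_def hi_def)
      also have "\<dots> \<le> 1 / (8 * 2 ^ l) + 7 / (16 * 2 ^ l) + (1 / (16 * 2 ^ l) + 1 / (16 * 2 ^ l))"
        by (intro add_mono order.refl WE gE)
      also have "\<dots> \<le> 1 / 2 ^ l" by (simp add: field_simps)
      finally show False using b by (simp add: bad_def)
    qed
    also have "\<dots> \<le> 1 / 20"
      using width by (intro stage_two[OF fin char s k l L D m G R _ g_def h_def]) (simp add: S_def lo_def hi_def)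
    finally show "prob (map_pmf (F xs) (replicate_pmf m P)) bad \<le> 1 / 20"
      by (simp add: vimage_def)
  qed simp
  moreover have "success_prob w P (compile_prog ls) (compile_prog gs) T (1 / 2 ^ l) = prob (srun w P ls (\<lambda>_. 0)) (- bad)"
  proof -
    have "{s. tv_dist P (map_pmf (\<lambda>s. s 0) (srun w (return_pmf 0) gs s)) \<le> 1 / 2 ^ l} = - bad" by (auto simp: bad_def)
    moreover have "\<forall>p\<in>set ls. wf_stmt w p" unfolding ls by (rule wf_learner[OF Y(1)])
    moreover have "\<forall>p\<in>set gs. wf_stmt w p" unfolding gs by (rule wf_generator[OF Y(1)])
    ultimately show ?thesis using straight_success_prob[OF T _ _ Y(3)] by metis
  qed
  moreover have "prob (srun w P ls (\<lambda>_. 0)) (- bad) = 1 - prob (srun w P ls (\<lambda>_. 0)) bad"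
    using measure_pmf.prob_compl[of bad "srun w P ls (\<lambda>_. 0)"] by (simp add: Compl_eq_Diff_UNIV)
  ultimately show ?thesis by linarith
qed

section \<open>Arithmetic of the resource bounds\<close>

lemma fact_le_exp: "fact k \<le> (2 :: nat) ^ (k\<^sup>2)"
proof -
  have "fact k \<le> k ^ k" using fact_le_power[of k, where 'a = nat] by simp
  also have "\<dots> \<le> (2 ^ k) ^ k" by (intro power_mono) (auto simp: less_imp_le[OF less_exp])
  finally show ?thesis by (simp add: power_mult[symmetric] power2_eq_square)
qed

text \<open>The logarithms of all parameters are at most linear in \<open>k^2 + l\<close>, so
  everything is measured in powers of the single base b. As \<open>4 \<le> b\<close>, numerical
  constants turn into powers of b as well.\<close>

lemma parameter_bounds:
  fixes k l :: nat
  assumes k: "k > 0" and l: "l > 0" and b: "b = 2 ^ (k\<^sup>2 + l)"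
    and L: "L = fact k" and D: "D = (L * (65 * l))\<^sup>2" and m: "m = 4096 * L * D * (2 ^ l)\<^sup>2"
    and G: "G = 160 * D\<^sup>2 * 2 ^ l" and R: "R = 8 * L * G * 2 ^ l" and n1: "n1 = 80 * 2 ^ l"
  shows "4 \<le> b" "k \<le> b" "2 ^ l \<le> b" "L \<le> b" "m \<le> b ^ 21" "G \<le> b ^ 29" "R \<le> b ^ 33" "n1 \<le> b ^ 5" "G * L \<le> b ^ 30"
proof -
  have kk: "k \<le> k\<^sup>2 + l" "1 + 1 \<le> k\<^sup>2 + l"
    using le_square[of k] k l unfolding power2_eq_square by linarith+
  have "(2 :: nat) ^ (1 + 1) \<le> b" unfolding b using kk(2) by (intro power_increasing) auto
  then show b4: "4 \<le> b" by simp
  have pow: "x \<le> b ^ j" if "x \<le> 4 ^ j" for x j :: nat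
    using that b4 by (meson le_trans power_mono zero_le)
  have "k \<le> 2 ^ k" by (simp add: less_imp_le[OF less_exp])
  also have "\<dots> \<le> b" unfolding b using kk(1) by (intro power_increasing) auto
  finally show "k \<le> b" .
  show Eb: "2 ^ l \<le> b" unfolding b by (intro power_increasing) auto
  have "l \<le> 2 ^ l" by (simp add: less_imp_le[OF less_exp])
  then have lb: "l \<le> b" using Eb by linarith
  have "L \<le> 2 ^ (k\<^sup>2)" unfolding L by (rule fact_le_exp)
  also have "\<dots> \<le> b" unfolding b by (intro power_increasing) auto
  finally show Lb: "L \<le> b" .
  have "L * (65 * l) \<le> b * (b ^ 4 * b)" using Lb lb pow[of 65 4] by (intro mult_le_mono) auto
  then have "D \<le> (b * (b ^ 4 * b))\<^sup>2" unfolding D by (intro power_mono) auto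
  also have "\<dots> = b ^ 12" by (simp add: power2_eq_square flip: power_Suc power_Suc2 power_add)
  finally have Db: "D \<le> b ^ 12" .
  have "m \<le> b ^ 6 * b * b ^ 12 * b\<^sup>2" unfolding m using pow[of 4096 6] Lb Db Eb by (intro mult_le_mono power_mono) auto
  also have "\<dots> = b ^ 21" by (simp flip: power_Suc power_Suc2 power_add)
  finally show "m \<le> b ^ 21" .
  have "G \<le> b ^ 4 * (b ^ 12)\<^sup>2 * b" unfolding G using pow[of 160 4] Db Eb by (intro mult_le_mono power_mono) auto
  also have "\<dots> = b ^ 29" by (simp flip: power_Suc power_Suc2 power_add power_mult)
  finally show Gb: "G \<le> b ^ 29" .
  have "R \<le> b\<^sup>2 * b * b ^ 29 * b" unfolding R using pow[of 8 2] Lb Gb Eb by (intro mult_le_mono) auto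
  also have "\<dots> = b ^ 33" by (simp flip: power_Suc power_Suc2 power_add)
  finally show "R \<le> b ^ 33" .
  have "n1 \<le> b ^ 4 * b" unfolding n1 using pow[of 80 4] Eb by (intro mult_le_mono) auto
  also have "\<dots> = b ^ 5" by (simp flip: power_Suc2)
  finally show "n1 \<le> b ^ 5" .
  have "G * L \<le> b ^ 29 * b" using Gb Lb by (rule mult_le_mono)
  also have "\<dots> = b ^ 30" by (simp flip: power_Suc2)
  finally show "G * L \<le> b ^ 30" .
qed

text \<open>The exponent 117 is that of the tally code: 21 for the samples, 91 for all pairs of an
  accumulator and a key, and 5 for constants. Only the range of the samples involves n, linearly,
  hence the single factor \<open>n + 1\<close> in the word size.\<close>

lemma resource_bounds:
  fixes k l :: nat
  assumes k: "k > 0" and l: "l > 0" and b: "b = 2 ^ (k\<^sup>2 + l)"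
    and L: "L = fact k" and D: "D = (L * (65 * l))\<^sup>2" and m: "m = 4096 * L * D * (2 ^ l)\<^sup>2"
    and G: "G = 160 * D\<^sup>2 * 2 ^ l" and R: "R = 8 * L * G * 2 ^ l" and n1: "n1 = 80 * 2 ^ l"
  shows "200 * (2 + n1 + m * (1 + G * L * ((G + 1) * (G * L))) + G * L) \<le> b ^ 117"
    and "200 * (2 + G * L) \<le> b ^ 117"
    and "(n + 1) * b ^ 120 \<le> N \<Longrightarrow> 8 * L * (n * k + 1) < N"
    and "(n + 1) * b ^ 120 \<le> N \<Longrightarrow> (4 * (m * R) + 4) * (G * L + 1) < N"
    and "(n + 1) * b ^ 120 \<le> N \<Longrightarrow> (G + 2) * (G * L + 90) < N"
    and "(n + 1) * b ^ 120 \<le> N \<Longrightarrow> 16 * 2 ^ l * (n * k + 1) \<le> N"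
    and "(n + 1) * b ^ 120 \<le> N \<Longrightarrow> 32 * 2 ^ l * (m * R) \<le> N"
proof -
  note pb = parameter_bounds[OF k l b L D m G R n1]
  have pow: "x \<le> b ^ j" if "x \<le> 4 ^ j" for x j :: nat
    using that pb(1) by (meson le_trans power_mono zero_le)
  have b1: "1 < b" using pb(1) by simp
  have up: "b ^ i \<le> b ^ j" if "i \<le> j" for i j using that b1 by (intro power_increasing) auto
  have pos: "L > 0" "D > 0" "G > 0" "m > 0" "R > 0" using l by (simp_all add: L D G m R)
  have GL: "G * L \<ge> 1" "m * R \<ge> 1" using pos by (simp_all add: Suc_le_eq)
  have mR: "m * R \<le> b ^ 54"
    using mult_le_mono[OF pb(5,7)] by (simp flip: power_add)
  have "1 + G * L * ((G + 1) * (G * L)) \<le> b * (b ^ 30 * (b ^ 30 * b ^ 30))"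
  proof -
    have "1 \<le> G * L * ((G + 1) * (G * L))" using GL(1) by (simp add: Suc_le_eq)
    then have "1 + G * L * ((G + 1) * (G * L)) \<le> 2 * (G * L * ((G + 1) * (G * L)))" by linarith
    also have "\<dots> \<le> b * (b ^ 30 * (b ^ 30 * b ^ 30))"
    proof (intro mult_le_mono pb(9))
      show "2 \<le> b" using pb(1) by simp
      have "G + 1 \<le> 2 * G" using pos by simp
      also have "\<dots> \<le> b * b ^ 29" using pb(1,6) by (intro mult_le_mono) auto
      finally show "G + 1 \<le> b ^ 30" by (simp flip: power_Suc)
    qed
    finally show ?thesis .
  qed
  also have "\<dots> = b ^ 91" by (simp flip: power_Suc power_add)
  finally have "m * (1 + G * L * ((G + 1) * (G * L))) \<le> b ^ 21 * b ^ 91" using pb(5) by (intro mult_le_mono)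
  then have a: "m * (1 + G * L * ((G + 1) * (G * L))) \<le> b ^ 112" by (simp flip: power_add)
  have c: "2 \<le> b ^ 112" "n1 \<le> b ^ 112" "G * L \<le> b ^ 112"
    using pow[of 2 112] pb(8,9) up[of 5 112] up[of 30 112] by simp_all
  have "2 + n1 + m * (1 + G * L * ((G + 1) * (G * L))) + G * L \<le> 4 * b ^ 112" using a c by linarith
  also have "\<dots> \<le> b * b ^ 112" using pb(1) by (intro mult_right_mono) auto
  finally have "200 * (2 + n1 + m * (1 + G * L * ((G + 1) * (G * L))) + G * L) \<le> b ^ 4 * (b * b ^ 112)"
    using pow[of 200 4] by (intro mult_le_mono) auto
  also have "\<dots> = b ^ 117" by (simp flip: power_Suc power_add)
  finally show learn: "200 * (2 + n1 + m * (1 + G * L * ((G + 1) * (G * L))) + G * L) \<le> b ^ 117" .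
  show "200 * (2 + G * L) \<le> b ^ 117"
    by (rule order.trans[OF _ learn]) simp
  assume N: "(n + 1) * b ^ 120 \<le> N"
  have below: "x < N" if "x \<le> (n + 1) * b ^ i" "i < 120" for x i
  proof -
    have "b ^ i < b ^ 120" using that(2) b1 by (rule power_strict_increasing)
    then have "(n + 1) * b ^ i < (n + 1) * b ^ 120" by (rule mult_strict_left_mono) simp
    then show ?thesis using that(1) N by linarith
  qed
  have below': "x < N" if "x \<le> b ^ i" "i < 120" for x i
    by (rule below[OF _ that(2)]) (use that(1) in \<open>simp add: add_increasing2\<close>)
  have nk: "n * k + 1 \<le> (n + 1) * b"
  proof -
    have "n * k + 1 \<le> (n + 1) * k" using k by simp
    also have "\<dots> \<le> (n + 1) * b" using pb(2) by (rule mult_le_mono2)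
    finally show ?thesis .
  qed
  have "8 * L * (n * k + 1) \<le> (b\<^sup>2 * b) * ((n + 1) * b)"
    using pow[of 8 2] pb(4) nk by (intro mult_le_mono) auto
  also have "\<dots> = (n + 1) * b ^ 4" by (simp add: power_numeral_reduce algebra_simps)
  finally show "8 * L * (n * k + 1) < N" by (rule below) simp
  have "4 * (m * R) + 4 \<le> 8 * (m * R)" using GL(2) by linarith
  also have "\<dots> \<le> b\<^sup>2 * b ^ 54" using pow[of 8 2] mR by (intro mult_le_mono) auto
  finally have "(4 * (m * R) + 4) * (G * L + 1) \<le> (b\<^sup>2 * b ^ 54) * (b * b ^ 30)"
  proof (rule mult_le_mono)
    have "G * L + 1 \<le> 2 * (G * L)" using GL(1) by linarith
    also have "\<dots> \<le> b * b ^ 30" using pb(1,9) by (intro mult_le_mono) auto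
    finally show "G * L + 1 \<le> b * b ^ 30" .
  qed
  also have "\<dots> = b ^ 87" by (simp flip: power_Suc power_add)
  finally show "(4 * (m * R) + 4) * (G * L + 1) < N" by (rule below') simp
  have "(G + 2) * (G * L + 90) \<le> (b * b ^ 29) * (b ^ 4 * b ^ 30)"
  proof (rule mult_le_mono)
    have "G + 2 \<le> 3 * G" using pos(3) by linarith
    also have "\<dots> \<le> b * b ^ 29" using pb(1,6) by (intro mult_le_mono) auto
    finally show "G + 2 \<le> b * b ^ 29" .
    have "G * L + 90 \<le> 91 * (G * L)" using GL(1) by linarith
    also have "\<dots> \<le> b ^ 4 * b ^ 30" using pow[of 91 4] pb(9) by (intro mult_le_mono) auto
    finally show "G * L + 90 \<le> b ^ 4 * b ^ 30" .
  qed
  also have "\<dots> = b ^ 64" by (simp flip: power_Suc power_add)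
  finally show "(G + 2) * (G * L + 90) < N" by (rule below') simp
  have "16 * 2 ^ l * (n * k + 1) \<le> (b\<^sup>2 * b) * ((n + 1) * b)"
    using pow[of 16 2] pb(3) nk by (intro mult_le_mono) auto
  also have "\<dots> = (n + 1) * b ^ 4" by (simp add: power_numeral_reduce algebra_simps)
  finally have "16 * 2 ^ l * (n * k + 1) < N" by (rule below) simp
  then show "16 * 2 ^ l * (n * k + 1) \<le> N" by (rule less_imp_le)
  have "32 * 2 ^ l * (m * R) \<le> (b ^ 3 * b) * b ^ 54"
    using pow[of 32 3] pb(3) mR by (intro mult_le_mono) auto
  also have "\<dots> = b ^ 58" by (simp flip: power_Suc2 power_add)
  finally have "32 * 2 ^ l * (m * R) < N" by (rule below') simp
  then show "32 * 2 ^ l * (m * R) \<le> N" by (rule less_imp_le)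
qed

text \<open>Disposes of \<open>k = 0\<close>, where summands would have empty support, by passing to
  1; the budget \<open>k ^ (5 * k)\<close> is 1 in both cases.\<close>

lemma siirv_max_1: "siirv n k \<subseteq> siirv n (max k 1)"
  unfolding siirv_def by (auto; fastforce)

lemma log_recip_ge_1: "log_recip \<epsilon> \<ge> 1"
  by (simp add: log_recip_def)

text \<open>The programs aim at the dyadic accuracy \<open>1 / 2 ^ l\<close>. Of the factor 4 in the
  last bound, one 2 is due to rounding up and the other to the lower bound 1 in
  \<open>log_recip\<close>.\<close>

lemma accuracy_exponent:
  assumes e: "0 < \<epsilon>" "\<epsilon> < 1" and l: "l = nat \<lceil>log_recip \<epsilon>\<rceil>"
  shows "l > 0" "real l \<le> 2 * log_recip \<epsilon>" "1 / 2 ^ l \<le> \<epsilon>" "2 ^ l \<le> 4 / \<epsilon>"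
proof -
  define r where "r = log_recip \<epsilon>"
  have r: "r \<ge> 1" by (simp add: r_def log_recip_ge_1)
  have "real l = of_int \<lceil>r\<rceil>" using r by (simp add: l r_def)
  then have lr: "r \<le> real l" "real l \<le> r + 1" by linarith+
  then show "real l \<le> 2 * log_recip \<epsilon>" using r by (simp add: r_def)
  have "real l > 0" using lr r by linarith
  then show "l > 0" by simp
  have "1 / \<epsilon> = 2 powr (log 2 (1 / \<epsilon>))" using e by simp
  also have "\<dots> \<le> 2 powr (real l)"
    using lr(1) by (intro powr_mono) (auto simp: r_def log_recip_def)
  also have "\<dots> = 2 ^ l" by (simp add: powr_realpow)
  finally have "1 / \<epsilon> \<le> 2 ^ l" .
  then show "1 / 2 ^ l \<le> \<epsilon>" using e by (simp add: field_simps)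
  have "2 powr r \<le> 2 / \<epsilon>"
  proof (cases "log 2 (1 / \<epsilon>) \<le> 1")
    case True
    then have "r = 1" by (simp add: r_def log_recip_def)
    then show ?thesis using e by (simp add: field_simps)
  next
    case False
    then have "r = log 2 (1 / \<epsilon>)" by (simp add: r_def log_recip_def)
    then have "2 powr r = 1 / \<epsilon>" using e by simp
    then show ?thesis using e by (simp add: divide_right_mono)
  qed
  moreover have "2 ^ l \<le> 2 powr (r + 1)"
    using lr(2) by (simp add: powr_realpow[symmetric])
  moreover have "2 powr (r + 1) = 2 * 2 powr r" by (simp add: powr_add)
  ultimately show "2 ^ l \<le> 4 / \<epsilon>" by simp
qed

text \<open>The cube is the dependence of the sample size on the factorial: one factor in m itself
  and two more in D.\<close>

lemma fact_cube_le: "real (fact (max k 1)) ^ 3 \<le> real k ^ (5 * k)"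
proof (cases "k = 0")
  case False
  then have k: "real k \<ge> 1" by simp
  have "real (fact k) \<le> real (k ^ k)" using fact_le_power[of k, where 'a = nat] by (intro of_nat_mono) simp
  then have "real (fact k) ^ 3 \<le> real (k ^ k) ^ 3" by (intro power_mono) auto
  also have "\<dots> = real k ^ (3 * k)" by (simp add: power_mult[symmetric] mult.commute)
  also have "\<dots> \<le> real k ^ (5 * k)" using k by (intro power_increasing) auto
  finally show ?thesis using False by (simp add: max_def)
qed simp

lemma square_le_budget: "real ((max k 1)\<^sup>2) \<le> real k ^ (5 * k)"
proof (cases "k = 0")
  case False
  then have "real k ^ 2 \<le> real k ^ (5 * k)" by (intro power_increasing) auto
  then show ?thesis using False by (simp add: max_def)
qed simp

theorem theorem4:
  shows "\<exists>C::real. C > 0 \<and>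
    (\<forall>(n::nat) (k::nat) (\<epsilon>::real). \<epsilon> > 0 \<longrightarrow>
      (\<exists>learner generator (m::nat) (T::nat).
         real m \<le> real k ^ (5 * k) * (C * (log_recip \<epsilon> ^ (k + 2) / \<epsilon>\<^sup>2)) \<and>
         real T \<le> 2 powr (C * (real k ^ (5 * k) * log_recip \<epsilon> ^ (k + 2))) \<and>
         (\<forall>w P. word_size_ok C n k \<epsilon> w \<longrightarrow> P \<in> siirv n k \<longrightarrow>
            uses_samples w P learner T m \<and>
            runs_in_time w P learner generator T \<and>
            success_prob w P learner generator T \<epsilon> \<ge> 9 / 10)))"
proof (intro exI[of _ "2000000000"] conjI allI impI)
  fix n k :: nat and \<epsilon> :: real
  assume e0: "\<epsilon> > 0"
  \<comment> \<open>Dictated by the sample bound, whose constant is about \<open>1.1 * 10^9\<close>;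
    time and word size ask for factors of a few hundred only.\<close>
  let ?C = "2000000000 :: real"
  define r where "r = log_recip \<epsilon>"
  define A where "A = real k ^ (5 * k) * r ^ (k + 2)"
  define \<kappa> where "\<kappa> = max k 1"
  have r: "r \<ge> 1" by (simp add: r_def log_recip_ge_1)
  have kpos: "\<kappa> > 0" by (simp add: \<kappa>_def)
  have finP: "finite (set_pmf P)" if "P \<in> siirv n k" for P
  proof -
    have "P \<in> siirv n \<kappa>" using that siirv_max_1 by (auto simp: \<kappa>_def)
    then obtain \<mu> s :: real where "set_pmf P \<subseteq> {..n * \<kappa>}" using siirv_analytic[OF _ kpos] by metis
    then show ?thesis by (rule finite_subset) simp
  qed
  show "\<exists>learner generator (m::nat) (T::nat).
         real m \<le> real k ^ (5 * k) * (?C * (log_recip \<epsilon> ^ (k + 2) / \<epsilon>\<^sup>2)) \<and>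
         real T \<le> 2 powr (?C * (real k ^ (5 * k) * log_recip \<epsilon> ^ (k + 2))) \<and>
         (\<forall>w P. word_size_ok ?C n k \<epsilon> w \<longrightarrow> P \<in> siirv n k \<longrightarrow>
            uses_samples w P learner T m \<and>
            runs_in_time w P learner generator T \<and>
            success_prob w P learner generator T \<epsilon> \<ge> 9 / 10)"
  proof (cases "\<epsilon> < 1")
    case False
    \<comment> \<open>Total variation never exceeds 1, so for \<open>\<epsilon> \<ge> 1\<close> any
      output is accurate enough and empty programs succeed.\<close>
    have "success_prob w P [] [] 0 \<epsilon> \<ge> 9 / 10" if P: "P \<in> siirv n k" for w P
    proof -
      have "tv_dist P (output_rv w [] 0 \<sigma>) \<le> \<epsilon>" for \<sigma>
        using tv_dist_le_1[OF finP[OF P], of "output_rv w [] 0 \<sigma>"] False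
        by (simp add: output_rv_def run_generator_def)
      then show ?thesis by (simp add: success_prob_def)
    qed
    moreover have "uses_samples w P [] 0 0" "runs_in_time w P [] [] 0" for w P
      using straight_learner_properties[of "[]" 0 "[]" w P] by (simp_all add: compile_prog_Nil)
    moreover have "0 \<le> real k ^ (5 * k) * (?C * (log_recip \<epsilon> ^ (k + 2) / \<epsilon>\<^sup>2))"
      using r by (simp add: r_def)
    ultimately show ?thesis
      by (intro exI[of _ "[]"] exI[of _ "[]"] exI[of _ 0] exI[of _ 0]) auto
  next
    case True
    define l where "l = nat \<lceil>log_recip \<epsilon>\<rceil>"
    note ae = accuracy_exponent[OF e0 True l_def, folded r_def]
    define b :: nat where "b = 2 ^ (\<kappa>\<^sup>2 + l)"
    define L :: nat where "L = fact \<kappa>"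
    define D where "D = (L * (65 * l))\<^sup>2"
    define m where "m = 4096 * L * D * (2 ^ l)\<^sup>2"
    define G where "G = 160 * D\<^sup>2 * 2 ^ l"
    define R where "R = 8 * L * G * 2 ^ l"
    define n1 :: nat where "n1 = 80 * 2 ^ l"
    define T where "T = b ^ 117"
    define ls where "ls = learner_prog (n * \<kappa>) n1 L G D R m"
    define gs where "gs = generator_prog L (G * L)"
    note rb = resource_bounds[OF kpos ae(1) b_def L_def D_def m_def G_def R_def n1_def]
    have T: "length (compile_prog ls) \<le> T" "length (compile_prog gs) \<le> T"
      unfolding T_def ls_def gs_def
      by (rule order.trans[OF length_learner rb(1)], rule order.trans[OF length_generator rb(2)])
    have k1: "real k ^ (5 * k) \<ge> 1" by (cases "k = 0") simp_all
    have r2: "r\<^sup>2 \<le> r ^ (k + 2)" "r \<le> r ^ (k + 2)" "1 \<le> r ^ (k + 2)"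
      using r power_increasing[of 2 "k + 2" r] power_increasing[of 1 "k + 2" r] power_increasing[of 0 "k + 2" r] by simp_all
    have A: "r \<le> A" "real k ^ (5 * k) \<le> A" "A \<ge> 1"
    proof -
      have "1 * r \<le> A" unfolding A_def using k1 r2 r by (intro mult_mono) auto
      then show "r \<le> A" by simp
      then show "A \<ge> 1" using r by linarith
      have "real k ^ (5 * k) * 1 \<le> A" unfolding A_def using r2 by (intro mult_left_mono) auto
      then show "real k ^ (5 * k) \<le> A" by simp
    qed
    have exponent: "real (\<kappa>\<^sup>2 + l) \<le> 3 * A"
      using square_le_budget[of k] A ae(2) unfolding \<kappa>_def by simp
    have samples: "real (n1 + m) \<le> real k ^ (5 * k) * (?C * (log_recip \<epsilon> ^ (k + 2) / \<epsilon>\<^sup>2))"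
    proof -
      have L1: "real L \<ge> 1" by (simp add: L_def)
      have l1: "real l \<ge> 1" using ae(1) by simp
      \<comment> \<open>The constant is \<open>4096 * 65^2\<close>.\<close>
      have m_eq: "real m = 17305600 * (real L ^ 3 * (real l)\<^sup>2 * (2 ^ l)\<^sup>2)"
        by (simp add: m_def D_def power2_eq_square power3_eq_cube)
      have "real n1 = 80 * (1 * 1 * 2 ^ l)" by (simp add: n1_def)
      also have "\<dots> \<le> 80 * (real L ^ 3 * (real l)\<^sup>2 * (2 ^ l)\<^sup>2)"
        using L1 l1 by (intro mult_left_mono mult_mono one_le_power) (auto simp: power2_eq_square)
      finally have "real (n1 + m) \<le> 17305680 * (real L ^ 3 * (real l)\<^sup>2 * (2 ^ l)\<^sup>2)"
        using m_eq by simp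
      also have "\<dots> \<le> 17305680 * (real k ^ (5 * k) * (4 * r ^ (k + 2)) * (16 / \<epsilon>\<^sup>2))"
      proof (intro mult_left_mono mult_mono)
        show "real L ^ 3 \<le> real k ^ (5 * k)" unfolding L_def \<kappa>_def by (rule fact_cube_le)
        have "(real l)\<^sup>2 \<le> (2 * r)\<^sup>2" using ae(2) by (intro power_mono) auto
        also have "\<dots> = 4 * r\<^sup>2" by (simp add: power_mult_distrib)
        also have "\<dots> \<le> 4 * r ^ (k + 2)" using r2(1) by simp
        finally show "(real l)\<^sup>2 \<le> 4 * r ^ (k + 2)" .
        have "(2 ^ l)\<^sup>2 \<le> (4 / \<epsilon>)\<^sup>2" using ae(4) by (intro power_mono) auto
        then show "(2 ^ l)\<^sup>2 \<le> 16 / \<epsilon>\<^sup>2" by (simp add: power_divide)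
      qed (use r in auto)
      also have "\<dots> = 1107563520 * (real k ^ (5 * k) * (r ^ (k + 2) / \<epsilon>\<^sup>2))" by simp
      also have "\<dots> \<le> ?C * (real k ^ (5 * k) * (r ^ (k + 2) / \<epsilon>\<^sup>2))"
        using r by (intro mult_right_mono) auto
      finally show ?thesis by (simp add: r_def mult_ac)
    qed
    have time: "real T \<le> 2 powr (?C * (real k ^ (5 * k) * log_recip \<epsilon> ^ (k + 2)))"
    proof -
      have "real T = 2 ^ ((\<kappa>\<^sup>2 + l) * 117)" unfolding T_def b_def power_mult[symmetric] by simp
      also have "\<dots> = 2 powr real ((\<kappa>\<^sup>2 + l) * 117)" by (rule powr_realpow[symmetric]) simp
      also have "\<dots> \<le> 2 powr (?C * A)"
        using exponent A(3) by (intro powr_mono) auto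
      finally show ?thesis by (simp add: A_def r_def)
    qed
    have "uses_samples w P (compile_prog ls) T (n1 + m) \<and> runs_in_time w P (compile_prog ls) (compile_prog gs) T \<and>
        success_prob w P (compile_prog ls) (compile_prog gs) T \<epsilon> \<ge> 9 / 10"
      if w: "word_size_ok ?C n k \<epsilon> w" and P: "P \<in> siirv n k" for w P
    proof (intro conjI)
      show "uses_samples w P (compile_prog ls) T (n1 + m)"
        using straight_learner_properties(1)[OF T] by (simp add: ls_def draws_learner)
      show "runs_in_time w P (compile_prog ls) (compile_prog gs) T"
        by (rule straight_learner_properties(2)[OF T])
      have big: "(n + 1) * b ^ 120 \<le> 2 ^ w"
      proof -
        have lg: "log 2 (real n + 1) \<ge> 0" by simp
        have "real ((n + 1) * b ^ 120) = (real n + 1) * 2 ^ ((\<kappa>\<^sup>2 + l) * 120)"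
          unfolding b_def power_mult[symmetric] by (simp add: distrib_right)
        also have "\<dots> = 2 powr (log 2 (real n + 1)) * 2 powr real ((\<kappa>\<^sup>2 + l) * 120)"
          by (simp add: powr_realpow[symmetric] del: of_nat_mult of_nat_add of_nat_power)
        also have "\<dots> = 2 powr (log 2 (real n + 1) + real ((\<kappa>\<^sup>2 + l) * 120))" by (rule powr_add[symmetric])
        also have "\<dots> \<le> 2 powr real w"
        proof (rule powr_mono)
          have "real ((\<kappa>\<^sup>2 + l) * 120) \<le> 360 * A" using exponent by simp
          moreover have "?C * (log 2 (real n + 1) + A) \<le> real w"
            using w by (simp add: word_size_ok_def A_def r_def)
          ultimately show "log 2 (real n + 1) + real ((\<kappa>\<^sup>2 + l) * 120) \<le> real w" using lg A(3) by argo
        qed simp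
        also have "\<dots> = real (2 ^ w)" by (simp add: powr_realpow)
        finally show ?thesis by (simp only: of_nat_le_iff)
      qed
      have "P \<in> siirv n \<kappa>" using P siirv_max_1 by (auto simp: \<kappa>_def)
      then have "9 / 10 \<le> success_prob w P (compile_prog ls) (compile_prog gs) T (1 / 2 ^ l)"
        by (rule learner_success[OF _ kpos ae(1) L_def D_def m_def G_def R_def n1_def rb(3)[OF big] rb(4)[OF big]
              rb(5)[OF big] rb(6)[OF big] rb(7)[OF big] ls_def gs_def T])
      also have "\<dots> \<le> success_prob w P (compile_prog ls) (compile_prog gs) T \<epsilon>"
        unfolding success_prob_def using ae(3) by (intro measure_pmf.finite_measure_mono) auto
      finally show "9 / 10 \<le> success_prob w P (compile_prog ls) (compile_prog gs) T \<epsilon>" .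
    qed
    then show ?thesis using samples time by blast
  qed
qed simp

end
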